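(* Let $\mathcal{A}$ be an abelian category, $\mathcal{C}$ an additive category and $(L,E,R)$ a fully faithful adjunction triple with $E\colon\mathcal{A}\to\mathcal{C}$ and $L,R\colon\mathcal{C}\to\mathcal{A}$, and let $C\colon\mathcal{C}\to\mathcal{A}$ be the associated intermediate extension functor. Let $\mathcal{A}$ be a codistinguished abelian subcategory of a triangulated category $\mathcal{T}$. Then each of the three functors $L$, $R$ and $C$ realises $\mathcal{C}$ as a codistinguished abelian subcategory of $\mathcal{T}$. Moreover, if $\mathcal{A}$ is extension closed in $\mathcal{T}$, then the essential images $L\mathcal{C}$, $R\mathcal{C}$ and $C\mathcal{C}$ are also extension closed in $\mathcal{T}$.
   Context: An adjunction triple $(L,E,R)$ means $L\dashv E\dashv R$; it is fully faithful if $L$ or (equivalently) $R$ is fully faithful. In this situation $\mathcal{C}$ is automatically abelian. Let $\eta^L\colon\mathrm{id}_{\mathcal{C}}\to EL$ be the unit of $(L,E)$ and $\varepsilon^R\colon ER\to\mathrm{id}_{\mathcal{C}}$ the counit of $(E,R)$. The norm is the natural transformation $\mathfrak{n}\colon L\to R$ whose component $\mathfrak{n}_y$ is the unique morphism $Ly\to Ry$ with $\varepsilon^R_y\circ E(\mathfrak{n}_y)\circ\eta^L_y=\mathrm{id}_y$. The intermediate extension functor $C\colon\mathcal{C}\to\mathcal{A}$ sends $x$ to $Cx=\mathrm{Im}(\mathfrak{n}_x)$, with canonical image factorisation $Lx\xrightarrow{\pi_x}Cx\xrightarrow{\iota_x}Rx$ of $\mathfrak{n}_x$, and sends $f\colon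 x\to y$ to the unique $Cf$ with $Cf\circ\pi_x=\pi_y\circ Lf$ and $\iota_y\circ Cf=Rf\circ\iota_x$. Conventions: a subcategory is a full subcategory closed under isomorphisms; an additive subcategory has additive inclusion. An additive subcategory $\mathcal{B}$ of a triangulated category $\mathcal{T}$ (suspension $\Sigma$) is a codistinguished abelian subcategory if it is abelian and, for every distinguished triangle $a\xrightarrow{f}b\xrightarrow{g}c\to\Sigma a$ with $a,b,c$ in $\mathcal{B}$, the sequence $0\to a\xrightarrow{f}b\xrightarrow{g}c\to0$ is short exact in $\mathcal{B}$. It is extension closed in $\mathcal{T}$ if for every distinguished triangle $a\to b\to c\to\Sigma a$ with $a,c$ in $\mathcal{B}$, also $b$ is in $\mathcal{B}$. A functor $F\colon \mathcal{C}\to\mathcal{A}$ realises $\mathcal{C}$ as a codistinguished abelian subcategory of $\mathcal{T}$ if the composite $\mathcal{C}\xrightarrow{F}\mathcal{A}\subseteq\mathcal{T}$ is fully faithful with essential image a codistinguished abelian subcategory of $\mathcal{T}$. *)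

theory Defs
  imports "HOL-Algebra.Group"
begin

section \<open>Categories with addition on the hom-sets\<close>

text \<open>
  Arrows know their domain and codomain, so distinct hom-sets are disjoint. The fields
  \<open>Add\<close> and \<open>Zero\<close> are meaningful only for preadditive categories; \<open>Zero C x y\<close> is the zero
  arrow from \<open>x\<close> to \<open>y\<close>. Values of the operations outside the carriers \<open>Ob\<close> and \<open>Arr\<close> are
  irrelevant.
\<close>

record ('o, 'm) precat =
  Ob :: "'o set"
  Arr :: "'m set"
  Dom :: "'m \<Rightarrow> 'o"
  Cod :: "'m \<Rightarrow> 'o"
  Ide :: "'o \<Rightarrow> 'm"
  Comp :: "'m \<Rightarrow> 'm \<Rightarrow> 'm" (infixl "\<cdot>\<index>" 70)
  Add :: "'m \<Rightarrow> 'm \<Rightarrow> 'm" (infixl "\<boxplus>\<index>" 65)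
  Zero :: "'o \<Rightarrow> 'o \<Rightarrow> 'm"

definition Hom :: "('o, 'm) precat \<Rightarrow> 'o \<Rightarrow> 'o \<Rightarrow> 'm set" where
  "Hom C x y = {f \<in> Arr C. Dom C f = x \<and> Cod C f = y}"

locale category =
  fixes C :: "('o, 'm) precat" (structure)
  assumes Dom_in_Ob: "f \<in> Arr C \<Longrightarrow> Dom C f \<in> Ob C"
    and Cod_in_Ob: "f \<in> Arr C \<Longrightarrow> Cod C f \<in> Ob C"
    and Ide_in_Hom: "x \<in> Ob C \<Longrightarrow> Ide C x \<in> Hom C x x"
    and Comp_in_Hom: "f \<in> Hom C x y \<Longrightarrow> g \<in> Hom C y z \<Longrightarrow> g \<cdot> f \<in> Hom C x z"
    and Comp_Ide: "f \<in> Hom C x y \<Longrightarrow> f \<cdot> Ide C x = f"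
    and Ide_Comp: "f \<in> Hom C x y \<Longrightarrow> Ide C y \<cdot> f = f"
    and Comp_assoc: "f \<in> Hom C w x \<Longrightarrow> g \<in> Hom C x y \<Longrightarrow> h \<in> Hom C y z
      \<Longrightarrow> (h \<cdot> g) \<cdot> f = h \<cdot> (g \<cdot> f)"

definition iso_arr :: "('o, 'm) precat \<Rightarrow> 'm \<Rightarrow> bool" where
  "iso_arr C f \<longleftrightarrow> f \<in> Arr C \<and> (\<exists>g \<in> Hom C (Cod C f) (Dom C f).
     g \<cdot>\<^bsub>C\<^esub> f = Ide C (Dom C f) \<and> f \<cdot>\<^bsub>C\<^esub> g = Ide C (Cod C f))"

definition isomorphic :: "('o, 'm) precat \<Rightarrow> 'o \<Rightarrow> 'o \<Rightarrow> bool" where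
  "isomorphic C x y \<longleftrightarrow> (\<exists>f \<in> Hom C x y. iso_arr C f)"

definition mono_arr :: "('o, 'm) precat \<Rightarrow> 'm \<Rightarrow> bool" where
  "mono_arr C f \<longleftrightarrow> f \<in> Arr C \<and> (\<forall>w. \<forall>g \<in> Hom C w (Dom C f). \<forall>h \<in> Hom C w (Dom C f).
     f \<cdot>\<^bsub>C\<^esub> g = f \<cdot>\<^bsub>C\<^esub> h \<longrightarrow> g = h)"

definition epi_arr :: "('o, 'm) precat \<Rightarrow> 'm \<Rightarrow> bool" where
  "epi_arr C f \<longleftrightarrow> f \<in> Arr C \<and> (\<forall>w. \<forall>g \<in> Hom C (Cod C f) w. \<forall>h \<in> Hom C (Cod C f) w.
     g \<cdot>\<^bsub>C\<^esub> f = h \<cdot>\<^bsub>C\<^esub> f \<longrightarrow> g = h)"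

definition zero_object :: "('o, 'm) precat \<Rightarrow> 'o \<Rightarrow> bool" where
  "zero_object C z \<longleftrightarrow> z \<in> Ob C \<and>
     (\<forall>x \<in> Ob C. (\<exists>!f. f \<in> Hom C x z) \<and> (\<exists>!f. f \<in> Hom C z x))"

section \<open>Additive and abelian categories\<close>

definition Hom_group :: "('o, 'm) precat \<Rightarrow> 'o \<Rightarrow> 'o \<Rightarrow> 'm monoid" where
  "Hom_group C x y = \<lparr>carrier = Hom C x y, monoid.mult = Add C, one = Zero C x y\<rparr>"

definition Neg :: "('o, 'm) precat \<Rightarrow> 'm \<Rightarrow> 'm" where
  "Neg C f = inv\<^bsub>Hom_group C (Dom C f) (Cod C f)\<^esub> f"

locale preadditive_category = category +
  assumes Hom_comm_group: "x \<in> Ob C \<Longrightarrow> y \<in> Ob C \<Longrightarrow> comm_group (Hom_group C x y)"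
    and Comp_Add: "f \<in> Hom C x y \<Longrightarrow> f' \<in> Hom C x y \<Longrightarrow> g \<in> Hom C y z
      \<Longrightarrow> g \<cdot> (f \<boxplus> f') = (g \<cdot> f) \<boxplus> (g \<cdot> f')"
    and Add_Comp: "f \<in> Hom C x y \<Longrightarrow> g \<in> Hom C y z \<Longrightarrow> g' \<in> Hom C y z
      \<Longrightarrow> (g \<boxplus> g') \<cdot> f = (g \<cdot> f) \<boxplus> (g' \<cdot> f)"

definition biproduct ::
  "('o, 'm) precat \<Rightarrow> 'o \<Rightarrow> 'o \<Rightarrow> 'o \<Rightarrow> 'm \<Rightarrow> 'm \<Rightarrow> 'm \<Rightarrow> 'm \<Rightarrow> bool" where
  "biproduct C x y s i j p q \<longleftrightarrow>
     i \<in> Hom C x s \<and> j \<in> Hom C y s \<and> p \<in> Hom C s x \<and> q \<in> Hom C s y \<and>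
     p \<cdot>\<^bsub>C\<^esub> i = Ide C x \<and> q \<cdot>\<^bsub>C\<^esub> j = Ide C y \<and>
     p \<cdot>\<^bsub>C\<^esub> j = Zero C y x \<and> q \<cdot>\<^bsub>C\<^esub> i = Zero C x y \<and>
     (i \<cdot>\<^bsub>C\<^esub> p) \<boxplus>\<^bsub>C\<^esub> (j \<cdot>\<^bsub>C\<^esub> q) = Ide C s"

locale additive_category = preadditive_category +
  assumes ex_zero_object: "\<exists>z. zero_object C z"
    and ex_biproduct: "x \<in> Ob C \<Longrightarrow> y \<in> Ob C \<Longrightarrow> \<exists>s \<in> Ob C. \<exists>i j p q. biproduct C x y s i j p q"

definition is_kernel :: "('o, 'm) precat \<Rightarrow> 'm \<Rightarrow> 'm \<Rightarrow> bool" where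
  "is_kernel C f k \<longleftrightarrow> f \<in> Arr C \<and> k \<in> Arr C \<and> Cod C k = Dom C f \<and>
     f \<cdot>\<^bsub>C\<^esub> k = Zero C (Dom C k) (Cod C f) \<and>
     (\<forall>w. \<forall>g \<in> Hom C w (Dom C f). f \<cdot>\<^bsub>C\<^esub> g = Zero C w (Cod C f) \<longrightarrow>
        (\<exists>!u. u \<in> Hom C w (Dom C k) \<and> k \<cdot>\<^bsub>C\<^esub> u = g))"

definition is_cokernel :: "('o, 'm) precat \<Rightarrow> 'm \<Rightarrow> 'm \<Rightarrow> bool" where
  "is_cokernel C f q \<longleftrightarrow> f \<in> Arr C \<and> q \<in> Arr C \<and> Dom C q = Cod C f \<and>
     q \<cdot>\<^bsub>C\<^esub> f = Zero C (Dom C f) (Cod C q) \<and>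
     (\<forall>w. \<forall>g \<in> Hom C (Cod C f) w. g \<cdot>\<^bsub>C\<^esub> f = Zero C (Dom C f) w \<longrightarrow>
        (\<exists>!u. u \<in> Hom C (Cod C q) w \<and> u \<cdot>\<^bsub>C\<^esub> q = g))"

locale abelian_category = additive_category +
  assumes ex_kernel: "f \<in> Arr C \<Longrightarrow> \<exists>k. is_kernel C f k"
    and ex_cokernel: "f \<in> Arr C \<Longrightarrow> \<exists>q. is_cokernel C f q"
    and mono_normal: "mono_arr C k \<Longrightarrow> \<exists>f. is_kernel C f k"
    and epi_normal: "epi_arr C q \<Longrightarrow> \<exists>f. is_cokernel C f q"

definition short_exact :: "('o, 'm) precat \<Rightarrow> 'm \<Rightarrow> 'm \<Rightarrow> bool" where
  "short_exact C f g \<longleftrightarrow> is_kernel C g f \<and> is_cokernel C f g"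

text \<open>The image of \<open>f\<close> is the kernel \<open>i\<close> of a cokernel of \<open>f\<close>.\<close>

definition image_factorisation :: "('o, 'm) precat \<Rightarrow> 'm \<Rightarrow> 'o \<Rightarrow> 'm \<Rightarrow> 'm \<Rightarrow> bool" where
  "image_factorisation C f m p i \<longleftrightarrow>
     p \<in> Hom C (Dom C f) m \<and> i \<in> Hom C m (Cod C f) \<and> i \<cdot>\<^bsub>C\<^esub> p = f \<and>
     (\<exists>q. is_cokernel C f q \<and> is_kernel C q i)"

section \<open>Functors and adjunctions\<close>

record ('o, 'm, 'p, 'n) ftor =
  onOb :: "'o \<Rightarrow> 'p"
  onArr :: "'m \<Rightarrow> 'n"

locale is_functor =
  fixes C :: "('o, 'm) precat" and D :: "('p, 'n) precat" and F :: "('o, 'm, 'p, 'n) ftor"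
  assumes onOb: "x \<in> Ob C \<Longrightarrow> onOb F x \<in> Ob D"
    and onArr: "f \<in> Hom C x y \<Longrightarrow> onArr F f \<in> Hom D (onOb F x) (onOb F y)"
    and onArr_Ide: "x \<in> Ob C \<Longrightarrow> onArr F (Ide C x) = Ide D (onOb F x)"
    and onArr_Comp: "f \<in> Hom C x y \<Longrightarrow> g \<in> Hom C y z
      \<Longrightarrow> onArr F (g \<cdot>\<^bsub>C\<^esub> f) = onArr F g \<cdot>\<^bsub>D\<^esub> onArr F f"

definition id_ftor :: "('o, 'm, 'o, 'm) ftor" where
  "id_ftor = \<lparr>onOb = (\<lambda>x. x), onArr = (\<lambda>f. f)\<rparr>"

definition comp_ftor ::
  "('p, 'n, 'q, 'k) ftor \<Rightarrow> ('o, 'm, 'p, 'n) ftor \<Rightarrow> ('o, 'm, 'q, 'k) ftor"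
  (infixl "\<circ>\<^sub>F" 55) where
  "G \<circ>\<^sub>F F = \<lparr>onOb = (\<lambda>x. onOb G (onOb F x)), onArr = (\<lambda>f. onArr G (onArr F f))\<rparr>"

definition additive_functor ::
  "('o, 'm) precat \<Rightarrow> ('p, 'n) precat \<Rightarrow> ('o, 'm, 'p, 'n) ftor \<Rightarrow> bool" where
  "additive_functor C D F \<longleftrightarrow> is_functor C D F \<and>
     (\<forall>x y. \<forall>f \<in> Hom C x y. \<forall>g \<in> Hom C x y.
        onArr F (f \<boxplus>\<^bsub>C\<^esub> g) = onArr F f \<boxplus>\<^bsub>D\<^esub> onArr F g)"

definition fully_faithful ::
  "('o, 'm) precat \<Rightarrow> ('p, 'n) precat \<Rightarrow> ('o, 'm, 'p, 'n) ftor \<Rightarrow> bool" where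
  "fully_faithful C D F \<longleftrightarrow> is_functor C D F \<and>
     (\<forall>x \<in> Ob C. \<forall>y \<in> Ob C. bij_betw (onArr F) (Hom C x y) (Hom D (onOb F x) (onOb F y)))"

definition essential_image ::
  "('o, 'm) precat \<Rightarrow> ('p, 'n) precat \<Rightarrow> ('o, 'm, 'p, 'n) ftor \<Rightarrow> 'p set" where
  "essential_image C D F = {y \<in> Ob D. \<exists>x \<in> Ob C. isomorphic D (onOb F x) y}"

definition is_equivalence ::
  "('o, 'm) precat \<Rightarrow> ('p, 'n) precat \<Rightarrow> ('o, 'm, 'p, 'n) ftor \<Rightarrow> bool" where
  "is_equivalence C D F \<longleftrightarrow> fully_faithful C D F \<and> essential_image C D F = Ob D"

definition nat_trans :: "('o, 'm) precat \<Rightarrow> ('p, 'n) precat \<Rightarrow> ('o, 'm, 'p, 'n) ftor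
    \<Rightarrow> ('o, 'm, 'p, 'n) ftor \<Rightarrow> ('o \<Rightarrow> 'n) \<Rightarrow> bool" where
  "nat_trans C D F G \<tau> \<longleftrightarrow> is_functor C D F \<and> is_functor C D G \<and>
     (\<forall>x \<in> Ob C. \<tau> x \<in> Hom D (onOb F x) (onOb G x)) \<and>
     (\<forall>x y. \<forall>f \<in> Hom C x y. \<tau> y \<cdot>\<^bsub>D\<^esub> onArr F f = onArr G f \<cdot>\<^bsub>D\<^esub> \<tau> x)"

text \<open>
  \<open>adjunction C D F G \<eta> \<epsilon>\<close>: the functor \<open>F\<close> from \<open>C\<close> to \<open>D\<close> is left adjoint to \<open>G\<close>, with
  unit \<open>\<eta>\<close> and counit \<open>\<epsilon>\<close>.
\<close>

definition adjunction :: "('o, 'm) precat \<Rightarrow> ('p, 'n) precat \<Rightarrow> ('o, 'm, 'p, 'n) ftor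
    \<Rightarrow> ('p, 'n, 'o, 'm) ftor \<Rightarrow> ('o \<Rightarrow> 'm) \<Rightarrow> ('p \<Rightarrow> 'n) \<Rightarrow> bool" where
  "adjunction C D F G \<eta> \<epsilon> \<longleftrightarrow>
     is_functor C D F \<and> is_functor D C G \<and>
     nat_trans C C id_ftor (G \<circ>\<^sub>F F) \<eta> \<and> nat_trans D D (F \<circ>\<^sub>F G) id_ftor \<epsilon> \<and>
     (\<forall>x \<in> Ob C. \<epsilon> (onOb F x) \<cdot>\<^bsub>D\<^esub> onArr F (\<eta> x) = Ide D (onOb F x)) \<and>
     (\<forall>y \<in> Ob D. onArr G (\<epsilon> y) \<cdot>\<^bsub>C\<^esub> \<eta> (onOb G y) = Ide C (onOb G y))"

section \<open>Adjunction triples and intermediate extension\<close>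

text \<open>
  The functor \<open>E\<close> goes from \<open>A\<close> to \<open>C\<close>; \<open>\<eta>L\<close>, \<open>\<epsilon>L\<close> belong to the adjunction of \<open>L\<close> and \<open>E\<close>,
  and \<open>\<eta>R\<close>, \<open>\<epsilon>R\<close> to that of \<open>E\<close> and \<open>R\<close>.
\<close>

definition adjunction_triple :: "('p, 'n) precat \<Rightarrow> ('o, 'm) precat
    \<Rightarrow> ('o, 'm, 'p, 'n) ftor \<Rightarrow> ('p, 'n, 'o, 'm) ftor \<Rightarrow> ('o, 'm, 'p, 'n) ftor
    \<Rightarrow> ('o \<Rightarrow> 'm) \<Rightarrow> ('p \<Rightarrow> 'n) \<Rightarrow> ('p \<Rightarrow> 'n) \<Rightarrow> ('o \<Rightarrow> 'm) \<Rightarrow> bool" where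
  "adjunction_triple A C L E R \<eta>L \<epsilon>L \<eta>R \<epsilon>R \<longleftrightarrow>
     adjunction C A L E \<eta>L \<epsilon>L \<and> adjunction A C E R \<eta>R \<epsilon>R"

definition fully_faithful_triple :: "('p, 'n) precat \<Rightarrow> ('o, 'm) precat
    \<Rightarrow> ('o, 'm, 'p, 'n) ftor \<Rightarrow> ('p, 'n, 'o, 'm) ftor \<Rightarrow> ('o, 'm, 'p, 'n) ftor
    \<Rightarrow> ('o \<Rightarrow> 'm) \<Rightarrow> ('p \<Rightarrow> 'n) \<Rightarrow> ('p \<Rightarrow> 'n) \<Rightarrow> ('o \<Rightarrow> 'm) \<Rightarrow> bool" where
  "fully_faithful_triple A C L E R \<eta>L \<epsilon>L \<eta>R \<epsilon>R \<longleftrightarrow>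
     adjunction_triple A C L E R \<eta>L \<epsilon>L \<eta>R \<epsilon>R \<and>
     (fully_faithful C A L \<or> fully_faithful C A R)"

definition norm_map :: "('p, 'n) precat \<Rightarrow> ('o, 'm) precat
    \<Rightarrow> ('o, 'm, 'p, 'n) ftor \<Rightarrow> ('p, 'n, 'o, 'm) ftor \<Rightarrow> ('o, 'm, 'p, 'n) ftor
    \<Rightarrow> ('o \<Rightarrow> 'm) \<Rightarrow> ('o \<Rightarrow> 'm) \<Rightarrow> 'o \<Rightarrow> 'n" where
  "norm_map A C L E R \<eta>L \<epsilon>R y = (THE n. n \<in> Hom A (onOb L y) (onOb R y) \<and>
     \<epsilon>R y \<cdot>\<^bsub>C\<^esub> onArr E n \<cdot>\<^bsub>C\<^esub> \<eta>L y = Ide C y)"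

text \<open>
  The intermediate extension functor depends on a choice of image factorisations
  \<open>\<iota> x \<cdot> \<pi> x\<close> of the components of the norm; \<open>intermediate_extension\<close> holds of every functor
  \<open>F\<close> arising from such a choice. Functoriality of \<open>F\<close> is a consequence and not required.
\<close>

definition intermediate_extension :: "('p, 'n) precat \<Rightarrow> ('o, 'm) precat
    \<Rightarrow> ('o, 'm, 'p, 'n) ftor \<Rightarrow> ('p, 'n, 'o, 'm) ftor \<Rightarrow> ('o, 'm, 'p, 'n) ftor
    \<Rightarrow> ('o \<Rightarrow> 'm) \<Rightarrow> ('o \<Rightarrow> 'm)
    \<Rightarrow> ('o, 'm, 'p, 'n) ftor \<Rightarrow> ('o \<Rightarrow> 'n) \<Rightarrow> ('o \<Rightarrow> 'n) \<Rightarrow> bool" where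
  "intermediate_extension A C L E R \<eta>L \<epsilon>R F \<pi> \<iota> \<longleftrightarrow>
     (\<forall>x \<in> Ob C.
        image_factorisation A (norm_map A C L E R \<eta>L \<epsilon>R x) (onOb F x) (\<pi> x) (\<iota> x)) \<and>
     (\<forall>x y. \<forall>f \<in> Hom C x y.
        onArr F f \<in> Hom A (onOb F x) (onOb F y) \<and>
        onArr F f \<cdot>\<^bsub>A\<^esub> \<pi> x = \<pi> y \<cdot>\<^bsub>A\<^esub> onArr L f \<and>
        \<iota> y \<cdot>\<^bsub>A\<^esub> onArr F f = onArr R f \<cdot>\<^bsub>A\<^esub> \<iota> x)"

section \<open>Triangulated categories\<close>

text \<open>
  A triangle is a triple \<open>(f, g, h)\<close> of composable arrows \<open>f : x \<rightarrow> y\<close>, \<open>g : y \<rightarrow> z\<close>,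
  \<open>h : z \<rightarrow> \<Sigma> x\<close>; the objects are recovered as domains and codomains.
\<close>

fun triangle :: "('p, 'n) precat \<Rightarrow> ('p, 'n, 'p, 'n) ftor \<Rightarrow> 'n \<times> 'n \<times> 'n \<Rightarrow> bool" where
  "triangle T \<Sigma> (f, g, h) \<longleftrightarrow> f \<in> Arr T \<and> g \<in> Arr T \<and> h \<in> Arr T \<and>
     Cod T f = Dom T g \<and> Cod T g = Dom T h \<and> Cod T h = onOb \<Sigma> (Dom T f)"

fun triangle_morphism :: "('p, 'n) precat \<Rightarrow> ('p, 'n, 'p, 'n) ftor
    \<Rightarrow> 'n \<times> 'n \<times> 'n \<Rightarrow> 'n \<times> 'n \<times> 'n \<Rightarrow> 'n \<times> 'n \<times> 'n \<Rightarrow> bool" where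
  "triangle_morphism T \<Sigma> (f, g, h) (f', g', h') (u, v, w) \<longleftrightarrow>
     u \<in> Hom T (Dom T f) (Dom T f') \<and>
     v \<in> Hom T (Dom T g) (Dom T g') \<and>
     w \<in> Hom T (Dom T h) (Dom T h') \<and>
     v \<cdot>\<^bsub>T\<^esub> f = f' \<cdot>\<^bsub>T\<^esub> u \<and>
     w \<cdot>\<^bsub>T\<^esub> g = g' \<cdot>\<^bsub>T\<^esub> v \<and>
     onArr \<Sigma> u \<cdot>\<^bsub>T\<^esub> h = h' \<cdot>\<^bsub>T\<^esub> w"

text \<open>
  The suspension \<open>\<Sigma>\<close> is only required to be an autoequivalence, not an automorphism;
  \<open>\<Delta>\<close> is the class of distinguished triangles.
\<close>

locale triangulated_category = additive_category T
  for T :: "('p, 'n) precat" (structure) +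
  fixes \<Sigma> :: "('p, 'n, 'p, 'n) ftor" and \<Delta> :: "('n \<times> 'n \<times> 'n) set"
  assumes suspension_additive: "additive_functor T T \<Sigma>"
    and suspension_equivalence: "is_equivalence T T \<Sigma>"
    and distinguished_triangle: "t \<in> \<Delta> \<Longrightarrow> triangle T \<Sigma> t"
    and distinguished_iso: "t \<in> \<Delta> \<Longrightarrow> triangle T \<Sigma> t' \<Longrightarrow> triangle_morphism T \<Sigma> t t' (u, v, w)
      \<Longrightarrow> iso_arr T u \<Longrightarrow> iso_arr T v \<Longrightarrow> iso_arr T w \<Longrightarrow> t' \<in> \<Delta>"
    and TR1_Ide: "x \<in> Ob T \<Longrightarrow> zero_object T z
      \<Longrightarrow> (Ide T x, Zero T x z, Zero T z (onOb \<Sigma> x)) \<in> \<Delta>"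
    and TR1_cone: "f \<in> Arr T \<Longrightarrow> \<exists>g h. (f, g, h) \<in> \<Delta>"
    and TR2: "triangle T \<Sigma> (f, g, h)
      \<Longrightarrow> (f, g, h) \<in> \<Delta> \<longleftrightarrow> (g, h, Neg T (onArr \<Sigma> f)) \<in> \<Delta>"
    and TR3: "(f, g, h) \<in> \<Delta> \<Longrightarrow> (f', g', h') \<in> \<Delta>
      \<Longrightarrow> u \<in> Hom T (Dom T f) (Dom T f') \<Longrightarrow> v \<in> Hom T (Cod T f) (Cod T f')
      \<Longrightarrow> v \<cdot> f = f' \<cdot> u
      \<Longrightarrow> \<exists>w. triangle_morphism T \<Sigma> (f, g, h) (f', g', h') (u, v, w)"
    and TR4: "(f, p\<^sub>1, d\<^sub>1) \<in> \<Delta> \<Longrightarrow> (g, p\<^sub>3, d\<^sub>3) \<in> \<Delta> \<Longrightarrow> Cod T f = Dom T g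
      \<Longrightarrow> (g \<cdot> f, p\<^sub>2, d\<^sub>2) \<in> \<Delta>
      \<Longrightarrow> \<exists>a b. (a, b, onArr \<Sigma> p\<^sub>1 \<cdot> d\<^sub>3) \<in> \<Delta> \<and>
            triangle_morphism T \<Sigma> (f, p\<^sub>1, d\<^sub>1) (g \<cdot> f, p\<^sub>2, d\<^sub>2) (Ide T (Dom T f), g, a) \<and>
            triangle_morphism T \<Sigma> (g \<cdot> f, p\<^sub>2, d\<^sub>2) (g, p\<^sub>3, d\<^sub>3) (f, Ide T (Cod T g), b)"

section \<open>Subcategories\<close>

text \<open>
  Subcategories are full and closed under isomorphism, hence given by their set of objects.
  In an additive subcategory, the inherited addition makes the inclusion additive.
\<close>

definition full_subcat :: "('p, 'n) precat \<Rightarrow> 'p set \<Rightarrow> ('p, 'n) precat"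
  (infixl "\<restriction>\<^sub>C" 90) where
  "T \<restriction>\<^sub>C S = T\<lparr>Ob := S, Arr := {f \<in> Arr T. Dom T f \<in> S \<and> Cod T f \<in> S}\<rparr>"

definition subcategory :: "('p, 'n) precat \<Rightarrow> 'p set \<Rightarrow> bool" where
  "subcategory T S \<longleftrightarrow> S \<subseteq> Ob T \<and> (\<forall>x \<in> S. \<forall>y \<in> Ob T. isomorphic T x y \<longrightarrow> y \<in> S)"

definition additive_subcategory :: "('p, 'n) precat \<Rightarrow> 'p set \<Rightarrow> bool" where
  "additive_subcategory T S \<longleftrightarrow> subcategory T S \<and> additive_category (T \<restriction>\<^sub>C S)"

definition codistinguished_abelian_subcategory ::
  "('p, 'n) precat \<Rightarrow> ('n \<times> 'n \<times> 'n) set \<Rightarrow> 'p set \<Rightarrow> bool" where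
  "codistinguished_abelian_subcategory T \<Delta> S \<longleftrightarrow>
     additive_subcategory T S \<and> abelian_category (T \<restriction>\<^sub>C S) \<and>
     (\<forall>f g h. (f, g, h) \<in> \<Delta> \<and> Dom T f \<in> S \<and> Cod T f \<in> S \<and> Cod T g \<in> S
        \<longrightarrow> short_exact (T \<restriction>\<^sub>C S) f g)"

definition extension_closed ::
  "('p, 'n) precat \<Rightarrow> ('n \<times> 'n \<times> 'n) set \<Rightarrow> 'p set \<Rightarrow> bool" where
  "extension_closed T \<Delta> S \<longleftrightarrow>
     (\<forall>f g h. (f, g, h) \<in> \<Delta> \<and> Dom T f \<in> S \<and> Cod T g \<in> S \<longrightarrow> Cod T f \<in> S)"

text \<open>
  For a functor \<open>F\<close> from \<open>C\<close> to the subcategory of \<open>T\<close> on \<open>S\<close>, the composite with the inclusion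
  into \<open>T\<close> has the same action on objects and arrows, the inclusion acting as \<open>id_ftor\<close>.
\<close>

definition into_ambient :: "('o, 'm, 'p, 'n) ftor \<Rightarrow> ('o, 'm, 'p, 'n) ftor" where
  "into_ambient F = id_ftor \<circ>\<^sub>F F"

definition realises_codistinguished :: "('p, 'n) precat \<Rightarrow> ('n \<times> 'n \<times> 'n) set \<Rightarrow> 'p set
    \<Rightarrow> ('o, 'm) precat \<Rightarrow> ('o, 'm, 'p, 'n) ftor \<Rightarrow> bool" where
  "realises_codistinguished T \<Delta> S C F \<longleftrightarrow>
     is_functor C (T \<restriction>\<^sub>C S) F \<and>
     fully_faithful C T (into_ambient F) \<and>
     codistinguished_abelian_subcategory T \<Delta> (essential_image C T (into_ambient F))"

end

(*
  By the triangle identities E sends the counit LE s -> s and the unit s -> RE s to isomorphisms,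
  and their composite LE s -> RE s is the norm at E s. The essential images of L, R and the
  intermediate extension are the objects s for which the counit is invertible, the unit is
  invertible, or the counit is epi and the unit mono. On each of them E is fully faithful and
  dense. As E has adjoints on both sides it is exact, and the abelian structure is computed in the
  ambient abelian category and moved into the image along E. Extension closure follows from the
  four and five lemmas applied to the counits and units of a short exact sequence. The
  triangulated category enters only through the short exact sequences of A that its triangles
  give; the claims about R follow from those about L by passing to opposite categories.
*)

theory Submission
  imports Defs
begin

text \<open>\<open>C\<close> is only given as additive, so an abelian structure cannot simply be
  copied from it, and \<open>L\<close> is in general only right exact, so it need not carry kernels
  to kernels. Kernels in an essential image are therefore found by a detour: form the kernel in
  \<open>A\<close>, apply \<open>E\<close>, and choose an object of the image whose value under
  \<open>E\<close> is isomorphic. The detour uses only that \<open>E\<close> is bijective on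
  hom-sets of the image and dense. This condition is its own dual, so one argument serves all three
  functors and yields cokernels along with kernels.

  Functors come without additivity. That zero arrows are preserved is deduced from the adjunctions;
  the sum equation of a biproduct is reached through joint epimorphy of its two injections, which
  left adjoints preserve.

  For the intermediate extension neither counit nor unit need be invertible, and fullness of
  \<open>E\<close> becomes the problem of factoring an arrow through an epimorphic counit. The
  obstruction is a composite with the kernel of that counit; it becomes zero after a monomorphic
  unit, because the norm is natural, and is therefore zero.\<close>

lemma Hom_iff [simp]: "f \<in> Hom C x y \<longleftrightarrow> f \<in> Arr C \<and> Dom C f = x \<and> Cod C f = y"
  by (auto simp: Hom_def)

section \<open>Categories and duality\<close>

context category
begin

declare Dom_in_Ob [simp] Cod_in_Ob [simp]

lemma Ide_arr [simp]:
  assumes "x \<in> Ob C"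
  shows "Ide C x \<in> Arr C" "Dom C (Ide C x) = x" "Cod C (Ide C x) = x"
  using Ide_in_Hom[OF assms] by auto

lemma Comp_arr [simp]:
  assumes "f \<in> Arr C" "g \<in> Arr C" "Cod C f = Dom C g"
  shows "g \<cdot> f \<in> Arr C" "Dom C (g \<cdot> f) = Dom C f" "Cod C (g \<cdot> f) = Cod C g"
  using Comp_in_Hom[of f "Dom C f" "Cod C f" g "Cod C g"] assms by auto

lemma Comp_Ide_arr [simp]: "f \<in> Arr C \<Longrightarrow> Dom C f = x \<Longrightarrow> f \<cdot> Ide C x = f"
  using Comp_Ide[of f x "Cod C f"] by auto

lemma Ide_Comp_arr [simp]: "f \<in> Arr C \<Longrightarrow> Cod C f = y \<Longrightarrow> Ide C y \<cdot> f = f"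
  using Ide_Comp[of f "Dom C f" y] by auto

lemma Comp_assoc_arr [simp]:
  "f \<in> Arr C \<Longrightarrow> g \<in> Arr C \<Longrightarrow> h \<in> Arr C \<Longrightarrow> Cod C f = Dom C g \<Longrightarrow> Cod C g = Dom C h
    \<Longrightarrow> (h \<cdot> g) \<cdot> f = h \<cdot> (g \<cdot> f)"
  using Comp_assoc[of f "Dom C f" "Cod C f" g "Cod C g" h "Cod C h"] by auto

text \<open>Simplification brackets composites to the right, where the left side of an equation
  \<open>g \<cdot> f = h\<close> no longer occurs as a subterm; this form rewrites with it in front
  of a further factor \<open>k\<close>.\<close>

lemma Comp_reassoc:
  assumes "g \<cdot> f = h" "f \<in> Arr C" "g \<in> Arr C" "Cod C f = Dom C g" "k \<in> Arr C" "Cod C k = Dom C f"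
  shows "g \<cdot> (f \<cdot> k) = h \<cdot> k"
  using assms Comp_assoc_arr[of k f g] by simp

lemma iso_arrE:
  assumes "iso_arr C f"
  obtains g where "f \<in> Arr C" "g \<in> Arr C" "Dom C g = Cod C f" "Cod C g = Dom C f"
    "g \<cdot> f = Ide C (Dom C f)" "f \<cdot> g = Ide C (Cod C f)"
  using assms by (auto simp: iso_arr_def)

lemma iso_arrI:
  assumes "f \<in> Arr C" "g \<in> Arr C" "Dom C g = Cod C f" "Cod C g = Dom C f"
    "g \<cdot> f = Ide C (Dom C f)" "f \<cdot> g = Ide C (Cod C f)"
  shows "iso_arr C f"
  using assms by (auto simp: iso_arr_def)

lemma mono_arrI:
  assumes "f \<in> Arr C"
    "\<And>g h. g \<in> Arr C \<Longrightarrow> h \<in> Arr C \<Longrightarrow> Dom C g = Dom C h \<Longrightarrow> Cod C g = Dom C f \<Longrightarrow> Cod C h = Dom C f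
      \<Longrightarrow> f \<cdot> g = f \<cdot> h \<Longrightarrow> g = h"
  shows "mono_arr C f"
  using assms by (auto simp: mono_arr_def)

lemma mono_arrD:
  assumes "mono_arr C f" "f \<cdot> g = f \<cdot> h"
    "g \<in> Arr C" "h \<in> Arr C" "Dom C g = Dom C h" "Cod C g = Dom C f" "Cod C h = Dom C f"
  shows "g = h"
  using assms by (auto simp: mono_arr_def)

lemma epi_arrI:
  assumes "f \<in> Arr C"
    "\<And>g h. g \<in> Arr C \<Longrightarrow> h \<in> Arr C \<Longrightarrow> Cod C g = Cod C h \<Longrightarrow> Dom C g = Cod C f \<Longrightarrow> Dom C h = Cod C f
      \<Longrightarrow> g \<cdot> f = h \<cdot> f \<Longrightarrow> g = h"
  shows "epi_arr C f"
  using assms by (auto simp: epi_arr_def)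

lemma epi_arrD:
  assumes "epi_arr C f" "g \<cdot> f = h \<cdot> f"
    "g \<in> Arr C" "h \<in> Arr C" "Cod C g = Cod C h" "Dom C g = Cod C f" "Dom C h = Cod C f"
  shows "g = h"
  using assms by (auto simp: epi_arr_def)

end

lemma mono_arr_in_Arr: "mono_arr C f \<Longrightarrow> f \<in> Arr C"
  by (simp add: mono_arr_def)

lemma epi_arr_in_Arr: "epi_arr C f \<Longrightarrow> f \<in> Arr C"
  by (simp add: epi_arr_def)

lemma iso_arr_in_Arr: "iso_arr C f \<Longrightarrow> f \<in> Arr C"
  by (simp add: iso_arr_def)

section \<open>Opposite categories\<close>

definition dual :: "('o, 'm) precat \<Rightarrow> ('o, 'm) precat" where
  "dual C = \<lparr>Ob = Ob C, Arr = Arr C, Dom = Cod C, Cod = Dom C, Ide = Ide C,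
     Comp = (\<lambda>g f. f \<cdot>\<^bsub>C\<^esub> g), Add = Add C, Zero = (\<lambda>x y. Zero C y x)\<rparr>"

lemma dual_sel [simp]:
  "Ob (dual C) = Ob C" "Arr (dual C) = Arr C" "Dom (dual C) = Cod C" "Cod (dual C) = Dom C"
  "Ide (dual C) = Ide C" "g \<cdot>\<^bsub>dual C\<^esub> f = f \<cdot>\<^bsub>C\<^esub> g" "Add (dual C) = Add C"
  "Zero (dual C) x y = Zero C y x"
  by (simp_all add: dual_def)

text \<open>An equality of records and not merely an equivalence, so a doubly dualised statement
  needs no comparison functor.\<close>

lemma dual_dual [simp]: "dual (dual C) = C"
  by (cases C) (simp add: dual_def)

lemma Hom_dual: "Hom (dual C) x y = Hom C y x"
  by (auto simp: Hom_def)

lemma mono_arr_dual [simp]: "mono_arr (dual C) f = epi_arr C f"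
  by (simp add: mono_arr_def epi_arr_def Hom_dual del: Hom_iff)

lemma epi_arr_dual [simp]: "epi_arr (dual C) f = mono_arr C f"
  by (simp add: mono_arr_def epi_arr_def Hom_dual del: Hom_iff)

lemma iso_arr_dual [simp]: "iso_arr (dual C) f = iso_arr C f"
  by (auto simp: iso_arr_def)

lemma is_kernel_dual [simp]: "is_kernel (dual C) f k = is_cokernel C f k"
  by (simp add: is_kernel_def is_cokernel_def Hom_dual del: Hom_iff)

lemma is_cokernel_dual [simp]: "is_cokernel (dual C) f k = is_kernel C f k"
  by (simp add: is_kernel_def is_cokernel_def Hom_dual del: Hom_iff)

lemma zero_object_dual [simp]: "zero_object (dual C) z = zero_object C z"
  by (auto simp: zero_object_def Hom_dual simp del: Hom_iff)

lemma short_exact_dual [simp]: "short_exact (dual C) g f = short_exact C f g"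
  by (auto simp: short_exact_def)

lemma biproduct_dual: "biproduct (dual C) x y s i j p q = biproduct C x y s p q i j"
  by (auto simp: biproduct_def)

lemma Hom_group_dual: "Hom_group (dual C) x y = Hom_group C y x"
  by (simp add: Hom_group_def Hom_dual del: Hom_iff)

lemma category_dual:
  assumes "category C"
  shows "category (dual C)"
proof -
  interpret category C by fact
  show ?thesis by unfold_locales auto
qed

lemma preadditive_category_dual:
  assumes "preadditive_category C"
  shows "preadditive_category (dual C)"
proof -
  interpret preadditive_category C by fact
  interpret d: category "dual C" by (rule category_dual) unfold_locales
  show ?thesis
  proof (rule preadditive_category.intro[OF d.category_axioms], rule preadditive_category_axioms.intro)
    show "comm_group (Hom_group (dual C) x y)" if "x \<in> Ob (dual C)" "y \<in> Ob (dual C)" for x y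
      using that by (simp add: Hom_group_dual Hom_comm_group)
  next
    fix f f' g x y z
    assume "f \<in> Hom (dual C) x y" "f' \<in> Hom (dual C) x y" "g \<in> Hom (dual C) y z"
    then show "g \<cdot>\<^bsub>dual C\<^esub> (f \<boxplus>\<^bsub>dual C\<^esub> f') = (g \<cdot>\<^bsub>dual C\<^esub> f) \<boxplus>\<^bsub>dual C\<^esub> (g \<cdot>\<^bsub>dual C\<^esub> f')"
      using Add_Comp[of g z y f x f'] by simp
  next
    fix f g g' x y z
    assume "f \<in> Hom (dual C) x y" "g \<in> Hom (dual C) y z" "g' \<in> Hom (dual C) y z"
    then show "(g \<boxplus>\<^bsub>dual C\<^esub> g') \<cdot>\<^bsub>dual C\<^esub> f = (g \<cdot>\<^bsub>dual C\<^esub> f) \<boxplus>\<^bsub>dual C\<^esub> (g' \<cdot>\<^bsub>dual C\<^esub> f)"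
      using Comp_Add[of g z y g' f x] by simp
  qed
qed

lemma additive_category_dual:
  assumes "additive_category C"
  shows "additive_category (dual C)"
proof -
  interpret additive_category C by fact
  interpret d: preadditive_category "dual C" by (rule preadditive_category_dual) unfold_locales
  show ?thesis
  proof
    show "\<exists>z. zero_object (dual C) z"
      using ex_zero_object by simp
  next
    fix x y assume "x \<in> Ob (dual C)" "y \<in> Ob (dual C)"
    then show "\<exists>s\<in>Ob (dual C). \<exists>i j p q. biproduct (dual C) x y s i j p q"
      using ex_biproduct[of x y] unfolding biproduct_dual by simp blast
  qed
qed

lemma abelian_category_dual:
  assumes "abelian_category C"
  shows "abelian_category (dual C)"
proof -
  interpret abelian_category C by fact
  interpret d: additive_category "dual C" by (rule additive_category_dual) unfold_locales
  show ?thesis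
    by unfold_locales (auto intro: ex_kernel ex_cokernel mono_normal epi_normal)
qed

section \<open>Cancellation for monomorphisms, epimorphisms and isomorphisms\<close>

context category
begin

lemma iso_mono:
  assumes "iso_arr C f"
  shows "mono_arr C f"
proof -
  obtain f' where f: "f \<in> Arr C" "f' \<in> Arr C" "Dom C f' = Cod C f" "Cod C f' = Dom C f"
    "f' \<cdot> f = Ide C (Dom C f)" "f \<cdot> f' = Ide C (Cod C f)"
    using assms by (rule iso_arrE)
  show ?thesis
  proof (rule mono_arrI[OF f(1)])
    fix g h
    assume a: "g \<in> Arr C" "h \<in> Arr C" "Cod C g = Dom C f" "Cod C h = Dom C f" "f \<cdot> g = f \<cdot> h"
    then have "f' \<cdot> (f \<cdot> g) = f' \<cdot> (f \<cdot> h)" by simp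
    then show "g = h" using a(1-4) f Comp_reassoc[OF f(5)] by simp
  qed
qed

lemma iso_epi: "iso_arr C f \<Longrightarrow> epi_arr C f"
  using category.iso_mono[OF category_dual[OF category_axioms], of f] by simp

lemma iso_comp:
  assumes "iso_arr C f" "iso_arr C g" "Cod C f = Dom C g"
  shows "iso_arr C (g \<cdot> f)"
proof -
  obtain f' where f: "f \<in> Arr C" "f' \<in> Arr C" "Dom C f' = Cod C f" "Cod C f' = Dom C f"
    "f' \<cdot> f = Ide C (Dom C f)" "f \<cdot> f' = Ide C (Cod C f)"
    using assms(1) by (rule iso_arrE)
  obtain g' where g: "g \<in> Arr C" "g' \<in> Arr C" "Dom C g' = Cod C g" "Cod C g' = Dom C g"
    "g' \<cdot> g = Ide C (Dom C g)" "g \<cdot> g' = Ide C (Cod C g)"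
    using assms(2) by (rule iso_arrE)
  show ?thesis
    by (rule iso_arrI[of _ "f' \<cdot> g'"])
      (use f g assms(3) Comp_reassoc[OF g(5)] Comp_reassoc[OF f(6)] in auto)
qed

lemma iso_inverse:
  assumes "f \<in> Arr C" "g \<in> Arr C" "Dom C g = Cod C f" "Cod C g = Dom C f"
    "g \<cdot> f = Ide C (Dom C f)" "f \<cdot> g = Ide C (Cod C f)"
  shows "iso_arr C g"
  using assms by (intro iso_arrI[of g f]) auto

lemma iso_Ide: "x \<in> Ob C \<Longrightarrow> iso_arr C (Ide C x)"
  by (rule iso_arrI[of _ "Ide C x"]) auto

text \<open>Since \<open>f \<cdot> (g \<cdot> f) = f\<close>, cancelling the monomorphism
  \<open>f\<close> makes its right inverse two-sided.\<close>

lemma mono_split_iso: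
  assumes "mono_arr C f" "g \<in> Arr C" "Dom C g = Cod C f" "Cod C g = Dom C f" "f \<cdot> g = Ide C (Cod C f)"
  shows "iso_arr C f"
proof -
  have f: "f \<in> Arr C" using assms(1) by (rule mono_arr_in_Arr)
  have "g \<cdot> f = Ide C (Dom C f)"
    by (rule mono_arrD[OF assms(1)]) (use f assms Comp_reassoc[OF assms(5)] in auto)
  then show ?thesis using f assms by (intro iso_arrI) auto
qed

lemma epi_split_iso:
  assumes "epi_arr C f" "g \<in> Arr C" "Dom C g = Cod C f" "Cod C g = Dom C f" "g \<cdot> f = Ide C (Dom C f)"
  shows "iso_arr C f"
  using category.mono_split_iso[OF category_dual[OF category_axioms], of f g] assms by simp

lemma epi_comp:
  assumes "epi_arr C f" "epi_arr C g" "Cod C f = Dom C g"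
  shows "epi_arr C (g \<cdot> f)"
proof (rule epi_arrI)
  have a: "f \<in> Arr C" "g \<in> Arr C" using assms by (auto simp: epi_arr_def)
  then show "g \<cdot> f \<in> Arr C" using assms(3) by simp
  fix h k
  assume h: "h \<in> Arr C" "k \<in> Arr C" "Cod C h = Cod C k" "Dom C h = Cod C (g \<cdot> f)"
    "Dom C k = Cod C (g \<cdot> f)" "h \<cdot> (g \<cdot> f) = k \<cdot> (g \<cdot> f)"
  then have "(h \<cdot> g) \<cdot> f = (k \<cdot> g) \<cdot> f" using a assms(3) by simp
  then have "h \<cdot> g = k \<cdot> g"
    by (rule epi_arrD[OF assms(1)]) (use a h assms(3) in auto)
  then show "h = k"
    by (rule epi_arrD[OF assms(2)]) (use a h assms(3) in auto)
qed

lemma epi_of_comp: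
  assumes "epi_arr C (g \<cdot> f)" "f \<in> Arr C" "g \<in> Arr C" "Cod C f = Dom C g"
  shows "epi_arr C g"
proof (rule epi_arrI)
  fix h k
  assume h: "h \<in> Arr C" "k \<in> Arr C" "Cod C h = Cod C k" "Dom C h = Cod C g"
    "Dom C k = Cod C g" "h \<cdot> g = k \<cdot> g"
  show "h = k"
    by (rule epi_arrD[OF assms(1)]) (use h assms Comp_reassoc[OF h(6)] in auto)
qed (use assms in auto)

lemma mono_comp:
  assumes "mono_arr C f" "mono_arr C g" "Cod C f = Dom C g"
  shows "mono_arr C (g \<cdot> f)"
  using category.epi_comp[OF category_dual[OF category_axioms], of g f] assms by simp

lemma mono_of_comp:
  assumes "mono_arr C (g \<cdot> f)" "f \<in> Arr C" "g \<in> Arr C" "Cod C f = Dom C g"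
  shows "mono_arr C f"
  using category.epi_of_comp[OF category_dual[OF category_axioms], of f g] assms by simp

lemma iso_cancel_left:
  assumes "iso_arr C (g \<cdot> f)" "iso_arr C g" "f \<in> Arr C" "Cod C f = Dom C g"
  shows "iso_arr C f"
proof -
  obtain g' where g: "g \<in> Arr C" "g' \<in> Arr C" "Dom C g' = Cod C g" "Cod C g' = Dom C g"
    "g' \<cdot> g = Ide C (Dom C g)" "g \<cdot> g' = Ide C (Cod C g)"
    using assms(2) by (rule iso_arrE)
  have "iso_arr C (g' \<cdot> (g \<cdot> f))"
    by (rule iso_comp) (use assms g iso_inverse[OF g] in auto)
  moreover have "g' \<cdot> (g \<cdot> f) = f"
    using g assms(3,4) Comp_reassoc[OF g(5)] by simp
  ultimately show ?thesis by simp
qed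

lemma iso_cancel_right:
  assumes "iso_arr C (g \<cdot> f)" "iso_arr C f" "g \<in> Arr C" "Cod C f = Dom C g"
  shows "iso_arr C g"
  using category.iso_cancel_left[OF category_dual[OF category_axioms], of f g] assms by simp

lemma isomorphicI: "iso_arr C f \<Longrightarrow> Dom C f = x \<Longrightarrow> Cod C f = y \<Longrightarrow> isomorphic C x y"
  by (auto simp: isomorphic_def iso_arr_def)

lemma isomorphicE:
  assumes "isomorphic C x y"
  obtains f where "iso_arr C f" "f \<in> Arr C" "Dom C f = x" "Cod C f = y"
  using assms by (auto simp: isomorphic_def)

lemma isomorphic_sym:
  assumes "isomorphic C x y"
  shows "isomorphic C y x"
proof -
  obtain f where f: "iso_arr C f" "Dom C f = x" "Cod C f = y"
    using assms by (rule isomorphicE)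
  from f(1) obtain g where "f \<in> Arr C" "g \<in> Arr C" "Dom C g = Cod C f" "Cod C g = Dom C f"
    "g \<cdot> f = Ide C (Dom C f)" "f \<cdot> g = Ide C (Cod C f)"
    by (rule iso_arrE)
  then show ?thesis using f by (intro isomorphicI[OF iso_inverse, of f g]) auto
qed

lemma isomorphic_trans:
  assumes "isomorphic C x y" "isomorphic C y z"
  shows "isomorphic C x z"
proof -
  obtain f where f: "iso_arr C f" "f \<in> Arr C" "Dom C f = x" "Cod C f = y"
    using assms(1) by (rule isomorphicE)
  obtain g where g: "iso_arr C g" "g \<in> Arr C" "Dom C g = y" "Cod C g = z"
    using assms(2) by (rule isomorphicE)
  show ?thesis using f g by (intro isomorphicI[of "g \<cdot> f"] iso_comp) auto
qed

lemma isomorphic_dual: "isomorphic (dual C) x y \<longleftrightarrow> isomorphic C x y"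
proof -
  have "isomorphic (dual C) x y \<longleftrightarrow> isomorphic C y x"
    by (auto simp: isomorphic_def)
  then show ?thesis using isomorphic_sym by blast
qed

end

section \<open>Preadditive and abelian categories\<close>

context preadditive_category
begin

lemma Zero_arr [simp]:
  assumes "x \<in> Ob C" "y \<in> Ob C"
  shows "Zero C x y \<in> Arr C" "Dom C (Zero C x y) = x" "Cod C (Zero C x y) = y"
proof -
  interpret comm_group "Hom_group C x y" using assms by (rule Hom_comm_group)
  show "Zero C x y \<in> Arr C" "Dom C (Zero C x y) = x" "Cod C (Zero C x y) = y"
    using one_closed by (simp_all add: Hom_group_def)
qed

lemma Add_arr [simp]:
  assumes "f \<in> Arr C" "g \<in> Arr C" "Dom C f = Dom C g" "Cod C f = Cod C g"
  shows "f \<boxplus> g \<in> Arr C" "Dom C (f \<boxplus> g) = Dom C f" "Cod C (f \<boxplus> g) = Cod C f"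
proof -
  interpret comm_group "Hom_group C (Dom C g) (Cod C g)" using assms by (intro Hom_comm_group) auto
  show "f \<boxplus> g \<in> Arr C" "Dom C (f \<boxplus> g) = Dom C f" "Cod C (f \<boxplus> g) = Cod C f"
    using m_closed[of f g] assms by (simp_all add: Hom_group_def)
qed

lemma Add_Zero [simp]:
  assumes "f \<in> Arr C" "Dom C f = x" "Cod C f = y"
  shows "f \<boxplus> Zero C x y = f" "Zero C x y \<boxplus> f = f"
proof -
  interpret comm_group "Hom_group C x y" using assms by (intro Hom_comm_group) auto
  show "f \<boxplus> Zero C x y = f" "Zero C x y \<boxplus> f = f"
    using r_one[of f] l_one[of f] assms by (simp_all add: Hom_group_def)
qed

lemma Comp_Zero [simp]:
  assumes "f \<in> Arr C" "x \<in> Ob C" "Dom C f = y"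
  shows "f \<cdot> Zero C x y = Zero C x (Cod C f)"
proof -
  interpret comm_group "Hom_group C x (Cod C f)" using assms by (intro Hom_comm_group) auto
  have y: "y \<in> Ob C" using assms by auto
  have "f \<cdot> Zero C x y = (f \<cdot> Zero C x y) \<boxplus> (f \<cdot> Zero C x y)"
    using Comp_Add[of "Zero C x y" x y "Zero C x y" f "Cod C f"] assms y by simp
  then show ?thesis
    using r_cancel_one[of "f \<cdot> Zero C x y" "f \<cdot> Zero C x y"] assms y
    by (simp add: Hom_group_def)
qed

lemma Zero_Comp [simp]:
  assumes "f \<in> Arr C" "y \<in> Ob C" "Cod C f = x"
  shows "Zero C x y \<cdot> f = Zero C (Dom C f) y"
  using preadditive_category.Comp_Zero[OF preadditive_category_dual[OF preadditive_category_axioms], of f y x]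
    assms by simp

text \<open>The hypothesis is applied to the difference of two arrows; \<open>n\<close> below is the
  inverse of \<open>h\<close> in its hom-group.\<close>

lemma mono_arrI_Zero:
  assumes f: "f \<in> Arr C"
    and 0: "\<And>g. g \<in> Arr C \<Longrightarrow> Cod C g = Dom C f \<Longrightarrow> f \<cdot> g = Zero C (Dom C g) (Cod C f)
      \<Longrightarrow> g = Zero C (Dom C g) (Dom C f)"
  shows "mono_arr C f"
proof (rule mono_arrI[OF f])
  fix g h
  assume a: "g \<in> Arr C" "h \<in> Arr C" "Dom C g = Dom C h" "Cod C g = Dom C f" "Cod C h = Dom C f"
    "f \<cdot> g = f \<cdot> h"
  let ?x = "Dom C g" and ?y = "Dom C f"
  interpret G: comm_group "Hom_group C ?x ?y" using a f by (intro Hom_comm_group) auto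
  define n where "n = inv\<^bsub>Hom_group C ?x ?y\<^esub> h"
  have n: "n \<in> Arr C" "Dom C n = ?x" "Cod C n = ?y" "h \<boxplus> n = Zero C ?x ?y" "n \<boxplus> h = Zero C ?x ?y"
    using G.inv_closed[of h] G.r_inv[of h] G.l_inv[of h] a by (simp_all add: Hom_group_def n_def)
  have "f \<cdot> (g \<boxplus> n) = f \<cdot> (h \<boxplus> n)"
    using Comp_Add[of g ?x ?y n f "Cod C f"] Comp_Add[of h ?x ?y n f "Cod C f"] a f n(1-3) by simp
  then have "g \<boxplus> n = Zero C ?x ?y"
    using 0[of "g \<boxplus> n"] a f n by simp
  then have "g \<boxplus> n = h \<boxplus> n" using n by simp
  then show "g = h"
    using G.right_cancel[of n g h] a n(1-3) by (simp add: Hom_group_def)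
qed

lemma epi_arrI_Zero:
  assumes f: "f \<in> Arr C"
    and 0: "\<And>g. g \<in> Arr C \<Longrightarrow> Dom C g = Cod C f \<Longrightarrow> g \<cdot> f = Zero C (Dom C f) (Cod C g)
      \<Longrightarrow> g = Zero C (Cod C f) (Cod C g)"
  shows "epi_arr C f"
  using preadditive_category.mono_arrI_Zero[OF preadditive_category_dual[OF preadditive_category_axioms], of f]
    assms by simp

lemma mono_arrD_Zero:
  assumes "mono_arr C f" "g \<in> Arr C" "Cod C g = Dom C f" "f \<cdot> g = Zero C (Dom C g) (Cod C f)"
  shows "g = Zero C (Dom C g) (Dom C f)"
  by (rule mono_arrD[OF assms(1)]) (use assms mono_arr_in_Arr[OF assms(1)] in auto)

lemma epi_arrD_Zero:
  assumes "epi_arr C f" "g \<in> Arr C" "Dom C g = Cod C f" "g \<cdot> f = Zero C (Dom C f) (Cod C g)"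
  shows "g = Zero C (Cod C f) (Cod C g)"
  by (rule epi_arrD[OF assms(1)]) (use assms epi_arr_in_Arr[OF assms(1)] in auto)

text \<open>Every arrow into or out of \<open>x\<close> factors through the identity of
  \<open>x\<close>. Being an equation between arrows, the criterion can be transported by functors
  that preserve zero arrows.\<close>

lemma zero_objectI:
  assumes x: "x \<in> Ob C" and 0: "Ide C x = Zero C x x"
  shows "zero_object C x"
proof -
  have 1: "f = Zero C (Dom C f) x" if "f \<in> Arr C" "Cod C f = x" for f
    using that Ide_Comp_arr[of f x] x unfolding 0 by simp
  have 2: "f = Zero C x (Cod C f)" if "f \<in> Arr C" "Dom C f = x" for f
    using that Comp_Ide_arr[of f x] x unfolding 0 by simp
  show ?thesis
    unfolding zero_object_def
  proof (intro conjI ballI)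
    fix y assume y: "y \<in> Ob C"
    show "\<exists>!f. f \<in> Hom C y x" by (rule ex1I[of _ "Zero C y x"]) (use x y 1 in auto)
    show "\<exists>!f. f \<in> Hom C x y" by (rule ex1I[of _ "Zero C x y"]) (use x y 2 in auto)
  qed (rule x)
qed

lemma zero_object_Ide: "zero_object C z \<Longrightarrow> Ide C z = Zero C z z"
  unfolding zero_object_def using Ide_in_Hom Zero_arr by (metis Hom_iff)

lemma zero_object_in_Ob: "zero_object C z \<Longrightarrow> z \<in> Ob C"
  by (simp add: zero_object_def)

text \<open>Uniqueness of factorisations is split off as monicity of \<open>k\<close>, which leaves
  only their existence to check.\<close>

lemma is_kernelI:
  assumes "f \<in> Arr C" "k \<in> Arr C" "Cod C k = Dom C f" "f \<cdot> k = Zero C (Dom C k) (Cod C f)"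
    and "mono_arr C k"
    and "\<And>g. g \<in> Arr C \<Longrightarrow> Cod C g = Dom C f \<Longrightarrow> f \<cdot> g = Zero C (Dom C g) (Cod C f)
      \<Longrightarrow> \<exists>u. u \<in> Arr C \<and> Dom C u = Dom C g \<and> Cod C u = Dom C k \<and> k \<cdot> u = g"
  shows "is_kernel C f k"
proof -
  have "\<exists>!u. u \<in> Hom C w (Dom C k) \<and> k \<cdot> u = g"
    if g: "g \<in> Hom C w (Dom C f)" "f \<cdot> g = Zero C w (Cod C f)" for w g
  proof -
    obtain u where "u \<in> Arr C" "Dom C u = Dom C g" "Cod C u = Dom C k" "k \<cdot> u = g"
      using assms(6)[of g] g by auto
    then show ?thesis
      using g mono_arrD[OF assms(5)] by (intro ex1I[of _ u]) auto
  qed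
  then show ?thesis using assms unfolding is_kernel_def by blast
qed

lemma is_kernelD:
  assumes "is_kernel C f k"
  shows "f \<in> Arr C" "k \<in> Arr C" "Cod C k = Dom C f" "f \<cdot> k = Zero C (Dom C k) (Cod C f)"
  using assms by (auto simp: is_kernel_def)

lemma kernel_factor:
  assumes "is_kernel C f k" "g \<in> Arr C" "Cod C g = Dom C f" "f \<cdot> g = Zero C (Dom C g) (Cod C f)"
  obtains u where "u \<in> Arr C" "Dom C u = Dom C g" "Cod C u = Dom C k" "k \<cdot> u = g"
proof -
  have "\<exists>!u. u \<in> Hom C (Dom C g) (Dom C k) \<and> k \<cdot> u = g"
    using assms unfolding is_kernel_def by (metis Hom_iff)
  then show ?thesis using that by auto
qed

lemma kernel_mono:
  assumes "is_kernel C f k"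
  shows "mono_arr C k"
proof (rule mono_arrI)
  note k = is_kernelD[OF assms]
  show "k \<in> Arr C" by (rule k)
  fix g h
  assume a: "g \<in> Arr C" "h \<in> Arr C" "Dom C g = Dom C h" "Cod C g = Dom C k" "Cod C h = Dom C k"
    "k \<cdot> g = k \<cdot> h"
  have "\<exists>!u. u \<in> Hom C (Dom C g) (Dom C k) \<and> k \<cdot> u = k \<cdot> g"
    using assms[unfolded is_kernel_def] k a Comp_reassoc[OF k(4)]
    by (metis Comp_arr Dom_in_Ob Cod_in_Ob Hom_iff Zero_Comp)
  then show "g = h" using a by (metis Hom_iff)
qed

lemma is_cokernelD:
  assumes "is_cokernel C f q"
  shows "f \<in> Arr C" "q \<in> Arr C" "Dom C q = Cod C f" "q \<cdot> f = Zero C (Dom C f) (Cod C q)"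
  using assms by (auto simp: is_cokernel_def)

lemma cokernel_factor:
  assumes "is_cokernel C f q" "g \<in> Arr C" "Dom C g = Cod C f" "g \<cdot> f = Zero C (Dom C f) (Cod C g)"
  obtains u where "u \<in> Arr C" "Cod C u = Cod C g" "Dom C u = Cod C q" "u \<cdot> q = g"
  using preadditive_category.kernel_factor[OF preadditive_category_dual[OF preadditive_category_axioms], of f q g]
    assms by auto

lemma cokernel_epi:
  assumes "is_cokernel C f q"
  shows "epi_arr C q"
  using preadditive_category.kernel_mono[OF preadditive_category_dual[OF preadditive_category_axioms], of f q]
    assms by simp

text \<open>Serves to exchange the domain of a kernel for an isomorphic object that lies in a
  prescribed subcategory.\<close>

lemma kernel_comp_iso:
  assumes "is_kernel C f k" "iso_arr C t" "Cod C t = Dom C k"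
  shows "is_kernel C f (k \<cdot> t)"
proof -
  note k = is_kernelD[OF assms(1)]
  obtain t' where t: "t \<in> Arr C" "t' \<in> Arr C" "Dom C t' = Cod C t" "Cod C t' = Dom C t"
    "t' \<cdot> t = Ide C (Dom C t)" "t \<cdot> t' = Ide C (Cod C t)"
    using assms(2) by (rule iso_arrE)
  show ?thesis
  proof (rule is_kernelI)
    show "mono_arr C (k \<cdot> t)"
      by (intro mono_comp kernel_mono[OF assms(1)] iso_mono assms)
    show "f \<cdot> (k \<cdot> t) = Zero C (Dom C (k \<cdot> t)) (Cod C f)"
      using k t assms(3) Comp_reassoc[OF k(4)] by simp
    fix g assume g: "g \<in> Arr C" "Cod C g = Dom C f" "f \<cdot> g = Zero C (Dom C g) (Cod C f)"
    obtain u where u: "u \<in> Arr C" "Dom C u = Dom C g" "Cod C u = Dom C k" "k \<cdot> u = g"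
      using kernel_factor[OF assms(1) g] .
    then show "\<exists>u. u \<in> Arr C \<and> Dom C u = Dom C g \<and> Cod C u = Dom C (k \<cdot> t) \<and> (k \<cdot> t) \<cdot> u = g"
      using k t assms(3) Comp_reassoc[OF t(6), of u]
      by (intro exI[of _ "t' \<cdot> u"]) auto
  qed (use k t assms(3) in auto)
qed

text \<open>A monomorphism after \<open>f\<close> does not change which arrows are killed; in
  particular the codomain of \<open>f\<close> may be exchanged along an isomorphism.\<close>

lemma kernel_mono_comp:
  assumes "is_kernel C f k" "mono_arr C t" "Dom C t = Cod C f"
  shows "is_kernel C (t \<cdot> f) k"
proof (rule is_kernelI)
  note k = is_kernelD[OF assms(1)]
  have t: "t \<in> Arr C" using assms(2) by (rule mono_arr_in_Arr)
  show "(t \<cdot> f) \<cdot> k = Zero C (Dom C k) (Cod C (t \<cdot> f))" "t \<cdot> f \<in> Arr C" "k \<in> Arr C"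
    "Cod C k = Dom C (t \<cdot> f)"
    using k t assms(3) by auto
  show "mono_arr C k" using kernel_mono[OF assms(1)] .
  fix g assume g: "g \<in> Arr C" "Cod C g = Dom C (t \<cdot> f)" "(t \<cdot> f) \<cdot> g = Zero C (Dom C g) (Cod C (t \<cdot> f))"
  have "f \<cdot> g = Zero C (Dom C g) (Cod C f)"
    using mono_arrD_Zero[OF assms(2), of "f \<cdot> g"] g k t assms(3) by simp
  then show "\<exists>u. u \<in> Arr C \<and> Dom C u = Dom C g \<and> Cod C u = Dom C k \<and> k \<cdot> u = g"
    using kernel_factor[OF assms(1), of g] g k t assms(3) by (metis Comp_arr(2))
qed

text \<open>The identity of \<open>y\<close> composes with the zero arrow to zero, so it factors
  through \<open>q\<close> and provides a left inverse of this epimorphism.\<close>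

lemma cokernel_Zero_iso:
  assumes "is_cokernel C (Zero C x y) q" "x \<in> Ob C" "y \<in> Ob C"
  shows "iso_arr C q"
proof -
  note q = is_cokernelD[OF assms(1)]
  obtain u where "u \<in> Arr C" "Cod C u = y" "Dom C u = Cod C q" "u \<cdot> q = Ide C y"
    using cokernel_factor[OF assms(1), of "Ide C y"] assms(2,3) by auto
  then show ?thesis
    using q assms(2,3) by (intro epi_split_iso[OF cokernel_epi[OF assms(1)]]) auto
qed

end

section \<open>Normality and uniqueness of image factorisations\<close>

context abelian_category
begin

text \<open>By normality \<open>k\<close> is the kernel of some \<open>f\<close>. As
  \<open>f\<close> kills \<open>k\<close>, it factors through \<open>q\<close>; so whatever
  \<open>q\<close> kills is killed by \<open>f\<close> and lifts to \<open>k\<close>.\<close>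

lemma mono_is_kernel:
  assumes "mono_arr C k" "is_cokernel C k q"
  shows "is_kernel C q k"
proof (rule is_kernelI)
  note q = is_cokernelD[OF assms(2)]
  show "q \<in> Arr C" "k \<in> Arr C" "Cod C k = Dom C q" "q \<cdot> k = Zero C (Dom C k) (Cod C q)"
    "mono_arr C k"
    using q assms by auto
  obtain f where f: "is_kernel C f k" using mono_normal[OF assms(1)] ..
  note k = is_kernelD[OF f]
  obtain f' where f': "f' \<in> Arr C" "Dom C f' = Cod C q" "Cod C f' = Cod C f" "f' \<cdot> q = f"
    using cokernel_factor[OF assms(2), of f] k by auto
  fix g assume g: "g \<in> Arr C" "Cod C g = Dom C q" "q \<cdot> g = Zero C (Dom C g) (Cod C q)"
  have "f \<cdot> g = f' \<cdot> (q \<cdot> g)"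
    using f' g q by (intro Comp_reassoc[OF f'(4), symmetric]) auto
  then have "f \<cdot> g = Zero C (Dom C g) (Cod C f)"
    using f' g q by simp
  then show "\<exists>u. u \<in> Arr C \<and> Dom C u = Dom C g \<and> Cod C u = Dom C k \<and> k \<cdot> u = g"
    using kernel_factor[OF f, of g] g k q by metis
qed

lemma epi_is_cokernel:
  assumes "epi_arr C q" "is_kernel C q k"
  shows "is_cokernel C k q"
  using abelian_category.mono_is_kernel[OF abelian_category_dual[OF abelian_category_axioms], of q k]
    assms by simp

text \<open>The cokernel of an epimorphism is a zero arrow, and a monomorphism is the kernel of its
  cokernel; hence the identity of the codomain lifts through \<open>f\<close>.\<close>

lemma mono_epi_iso:
  assumes "mono_arr C f" "epi_arr C f"
  shows "iso_arr C f"
proof -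
  obtain q where q: "is_cokernel C f q" using ex_cokernel mono_arr_in_Arr[OF assms(1)] by blast
  note q' = is_cokernelD[OF q]
  have "q = Zero C (Cod C f) (Cod C q)"
    using epi_arrD_Zero[OF assms(2), of q] q' by simp
  then have "q \<cdot> Ide C (Cod C f) = Zero C (Dom C (Ide C (Cod C f))) (Cod C q)"
    using q' by simp
  then obtain u where "u \<in> Arr C" "Dom C u = Cod C f" "Cod C u = Dom C f" "f \<cdot> u = Ide C (Cod C f)"
    using kernel_factor[OF mono_is_kernel[OF assms(1) q], of "Ide C (Cod C f)"] q' by auto
  then show ?thesis by (intro mono_split_iso assms)
qed

text \<open>
  Any subobject \<open>m\<close> of the image through which \<open>p\<close> factors is a kernel of a map that kills \<open>f\<close>,
  hence kills the image.
\<close>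

lemma image_factorisation_epi:
  assumes "image_factorisation C f m p i"
  shows "epi_arr C p"
proof (rule epi_arrI_Zero)
  obtain q where q: "is_cokernel C f q" "is_kernel C q i"
    and pi: "p \<in> Arr C" "Dom C p = Dom C f" "Cod C p = m" "i \<in> Arr C" "Dom C i = m" "Cod C i = Cod C f"
      "i \<cdot> p = f"
    using assms by (auto simp: image_factorisation_def)
  note q' = is_cokernelD[OF q(1)] is_kernelD[OF q(2)]
  show "p \<in> Arr C" by (rule pi)
  fix g assume g: "g \<in> Arr C" "Dom C g = Cod C p" "g \<cdot> p = Zero C (Dom C p) (Cod C g)"
  obtain n where n: "is_kernel C g n" using ex_kernel g(1) by blast
  note n' = is_kernelD[OF n]
  obtain p' where p': "p' \<in> Arr C" "Dom C p' = Dom C p" "Cod C p' = Dom C n" "n \<cdot> p' = p"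
    using kernel_factor[OF n, of p] g pi by auto
  have "mono_arr C (i \<cdot> n)"
    using kernel_mono[OF n] kernel_mono[OF q(2)] g pi n' by (intro mono_comp) auto
  then obtain h where h: "is_kernel C h (i \<cdot> n)" using mono_normal by blast
  note h' = is_kernelD[OF h]
  have "(i \<cdot> n) \<cdot> p' = f"
    using n' pi p' g by simp
  then have "h \<cdot> f = (h \<cdot> (i \<cdot> n)) \<cdot> p'"
    using h' n' pi p' g Comp_assoc_arr[of p' "i \<cdot> n" h] by simp
  also have "\<dots> = Zero C (Dom C f) (Cod C h)"
    by (subst h'(4)) (use h' n' pi p' g in auto)
  finally obtain h1 where h1: "h1 \<in> Arr C" "Cod C h1 = Cod C h" "Dom C h1 = Cod C q" "h1 \<cdot> q = h"
    using cokernel_factor[OF q(1), of h] h' n' pi g by auto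
  have "h \<cdot> i = Zero C (Dom C i) (Cod C h)"
    using h1 q' pi Comp_reassoc[OF h1(4), of i] Dom_in_Ob[of i] by simp
  then obtain t where t: "t \<in> Arr C" "Dom C t = m" "Cod C t = Dom C n" "i \<cdot> (n \<cdot> t) = i"
    using kernel_factor[OF h, of i] h' pi n' g by auto
  \<comment> \<open>The kernel \<open>n\<close> of \<open>g\<close> thereby has a right inverse,
    which forces \<open>g\<close> to vanish.\<close>
  have "n \<cdot> t = Ide C m"
    by (rule mono_arrD[OF kernel_mono[OF q(2)]]) (use t pi n' g in auto)
  then have "g \<cdot> (n \<cdot> t) = g"
    using g pi by simp
  then show "g = Zero C (Cod C p) (Cod C g)"
    using t n' g pi Comp_reassoc[OF n'(4), of t] by simp
qed

text \<open>The arrow \<open>p'\<close> kills the kernel of \<open>p\<close>, because the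
  monomorphism \<open>i'\<close> can be cancelled. As \<open>p\<close> is the cokernel of its
  kernel, this yields a comparison \<open>t\<close>, epic because \<open>p'\<close> is and monic
  because \<open>i\<close> is.\<close>

lemma epi_mono_factorisation_unique:
  assumes "epi_arr C p" "mono_arr C i" "Cod C p = Dom C i"
    and "epi_arr C p'" "mono_arr C i'" "Cod C p' = Dom C i'"
    and "Dom C p = Dom C p'" "Cod C i = Cod C i'" "i \<cdot> p = i' \<cdot> p'"
  shows "isomorphic C (Cod C p) (Cod C p')"
proof -
  have arr: "p \<in> Arr C" "i \<in> Arr C" "p' \<in> Arr C" "i' \<in> Arr C"
    using assms by (auto simp: epi_arr_def mono_arr_def)
  obtain k where k: "is_kernel C p k" using ex_kernel arr by blast
  note k' = is_kernelD[OF k]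
  have "i' \<cdot> (p' \<cdot> k) = i \<cdot> (p \<cdot> k)"
    using Comp_reassoc[OF refl, of p' i' k] Comp_reassoc[OF refl, of p i k] assms arr k' by simp
  then have "i' \<cdot> (p' \<cdot> k) = Zero C (Dom C k) (Cod C i)"
    using assms arr k' by simp
  then have "p' \<cdot> k = Zero C (Dom C k) (Cod C p')"
    using mono_arrD_Zero[OF assms(5), of "p' \<cdot> k"] assms arr k' by simp
  then obtain t where t: "t \<in> Arr C" "Cod C t = Cod C p'" "Dom C t = Cod C p" "t \<cdot> p = p'"
    using cokernel_factor[OF epi_is_cokernel[OF assms(1) k], of p'] assms arr k' by auto
  have "(i' \<cdot> t) \<cdot> p = i \<cdot> p"
    using t assms arr by simp
  then have it: "i' \<cdot> t = i"
    by (rule epi_arrD[OF assms(1)]) (use t assms arr in auto)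
  have "epi_arr C t" using epi_of_comp[of t p] t arr assms(4) by simp
  moreover have "mono_arr C t" using mono_of_comp[of i' t] t arr assms it by simp
  ultimately show ?thesis
    using mono_epi_iso t by (intro isomorphicI[of t]) auto
qed

end

section \<open>Adjunctions\<close>

context is_functor
begin

declare onOb [simp] onArr_Ide [simp]

lemma onArr_arr [simp]:
  assumes "f \<in> Arr C"
  shows "onArr F f \<in> Arr D" "Dom D (onArr F f) = onOb F (Dom C f)" "Cod D (onArr F f) = onOb F (Cod C f)"
  using onArr[of f "Dom C f" "Cod C f"] assms by auto

lemma onArr_Comp_arr [simp]:
  "f \<in> Arr C \<Longrightarrow> g \<in> Arr C \<Longrightarrow> Cod C f = Dom C g
    \<Longrightarrow> onArr F (g \<cdot>\<^bsub>C\<^esub> f) = onArr F g \<cdot>\<^bsub>D\<^esub> onArr F f"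
  using onArr_Comp[of f "Dom C f" "Cod C f" g "Cod C g"] by simp

lemma is_functor_dual: "is_functor (dual C) (dual D) F"
  by unfold_locales auto

lemma onArr_iso:
  assumes "category C" "category D" "iso_arr C f"
  shows "iso_arr D (onArr F f)"
proof -
  interpret C: category C by fact
  interpret D: category D by fact
  obtain g where g: "f \<in> Arr C" "g \<in> Arr C" "Dom C g = Cod C f" "Cod C g = Dom C f"
    "g \<cdot>\<^bsub>C\<^esub> f = Ide C (Dom C f)" "f \<cdot>\<^bsub>C\<^esub> g = Ide C (Cod C f)"
    using assms(3) by (rule C.iso_arrE)
  have "onArr F g \<cdot>\<^bsub>D\<^esub> onArr F f = Ide D (onOb F (Dom C f))"
    using g onArr_Comp_arr[of f g] by simp
  moreover have "onArr F f \<cdot>\<^bsub>D\<^esub> onArr F g = Ide D (onOb F (Cod C f))"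
    using g onArr_Comp_arr[of g f] by simp
  ultimately show ?thesis
    using g by (intro D.iso_arrI[of _ "onArr F g"]) auto
qed

end

section \<open>Transposition along an adjunction\<close>

locale adjoint_pair = C: category C + D: category D
  for C :: "('o, 'm) precat" and D :: "('p, 'n) precat" +
  fixes F :: "('o, 'm, 'p, 'n) ftor" and G :: "('p, 'n, 'o, 'm) ftor"
    and \<eta> :: "'o \<Rightarrow> 'm" and \<epsilon> :: "'p \<Rightarrow> 'n"
  assumes adj: "adjunction C D F G \<eta> \<epsilon>"

sublocale adjoint_pair \<subseteq> F: is_functor C D F
  using adj by (simp add: adjunction_def)

sublocale adjoint_pair \<subseteq> G: is_functor D C G
  using adj by (simp add: adjunction_def)

context adjoint_pair
begin

lemma unit_arr [simp]:
  assumes "x \<in> Ob C"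
  shows "\<eta> x \<in> Arr C" "Dom C (\<eta> x) = x" "Cod C (\<eta> x) = onOb G (onOb F x)"
  using adj assms by (auto simp: adjunction_def nat_trans_def id_ftor_def comp_ftor_def)

lemma counit_arr [simp]:
  assumes "y \<in> Ob D"
  shows "\<epsilon> y \<in> Arr D" "Dom D (\<epsilon> y) = onOb F (onOb G y)" "Cod D (\<epsilon> y) = y"
  using adj assms by (auto simp: adjunction_def nat_trans_def id_ftor_def comp_ftor_def)

lemma unit_natural:
  "f \<in> Arr C \<Longrightarrow> \<eta> (Cod C f) \<cdot>\<^bsub>C\<^esub> f = onArr G (onArr F f) \<cdot>\<^bsub>C\<^esub> \<eta> (Dom C f)"
  using adj by (auto simp: adjunction_def nat_trans_def id_ftor_def comp_ftor_def)

lemma counit_natural: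
  "f \<in> Arr D \<Longrightarrow> \<epsilon> (Cod D f) \<cdot>\<^bsub>D\<^esub> onArr F (onArr G f) = f \<cdot>\<^bsub>D\<^esub> \<epsilon> (Dom D f)"
  using adj by (auto simp: adjunction_def nat_trans_def id_ftor_def comp_ftor_def)

lemma triangle_F [simp]: "x \<in> Ob C \<Longrightarrow> \<epsilon> (onOb F x) \<cdot>\<^bsub>D\<^esub> onArr F (\<eta> x) = Ide D (onOb F x)"
  using adj by (auto simp: adjunction_def)

lemma triangle_G [simp]: "y \<in> Ob D \<Longrightarrow> onArr G (\<epsilon> y) \<cdot>\<^bsub>C\<^esub> \<eta> (onOb G y) = Ide C (onOb G y)"
  using adj by (auto simp: adjunction_def)

text \<open>Dualising exchanges the two functors and exchanges unit with counit, so each fact below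
  is proved for one side and read off for the other.\<close>

lemma adjoint_pair_dual: "adjoint_pair (dual D) (dual C) G F \<epsilon> \<eta>"
proof -
  interpret Cd: category "dual C" by (rule category_dual) unfold_locales
  interpret Dd: category "dual D" by (rule category_dual) unfold_locales
  interpret FF: is_functor "dual C" "dual D" F by (rule F.is_functor_dual)
  interpret GG: is_functor "dual D" "dual C" G by (rule G.is_functor_dual)
  have "is_functor (dual C) (dual C) id_ftor" "is_functor (dual D) (dual D) id_ftor"
    "is_functor (dual C) (dual C) (G \<circ>\<^sub>F F)" "is_functor (dual D) (dual D) (F \<circ>\<^sub>F G)"
    by (unfold_locales; force simp: id_ftor_def comp_ftor_def)+
  then have "nat_trans (dual D) (dual D) id_ftor (F \<circ>\<^sub>F G) \<epsilon>" "nat_trans (dual C) (dual C) (G \<circ>\<^sub>F F) id_ftor \<eta>"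
    by (auto simp: nat_trans_def id_ftor_def comp_ftor_def unit_natural counit_natural)
  then show ?thesis
    by unfold_locales (auto simp: adjunction_def FF.is_functor_axioms GG.is_functor_axioms)
qed

text \<open>Naturality of the counit moves \<open>f\<close> in front of the counit at
  \<open>F x\<close>, where the triangle identity applies.\<close>

lemma transpose_transpose:
  assumes "f \<in> Arr D" "Dom D f = onOb F x" "x \<in> Ob C"
  shows "\<epsilon> (Cod D f) \<cdot>\<^bsub>D\<^esub> onArr F (onArr G f \<cdot>\<^bsub>C\<^esub> \<eta> x) = f"
  using assms D.Comp_reassoc[OF counit_natural[OF assms(1)], of "onArr F (\<eta> x)"] by simp

lemma transpose_inj:
  assumes "onArr G f \<cdot>\<^bsub>C\<^esub> \<eta> x = onArr G f' \<cdot>\<^bsub>C\<^esub> \<eta> x" "x \<in> Ob C" "f \<in> Arr D" "f' \<in> Arr D"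
    "Dom D f = onOb F x" "Dom D f' = onOb F x" "Cod D f = Cod D f'"
  shows "f = f'"
  using assms transpose_transpose[of f x] transpose_transpose[of f' x] by simp

lemma cotranspose_cotranspose:
  assumes "g \<in> Arr C" "Cod C g = onOb G y" "y \<in> Ob D"
  shows "onArr G (\<epsilon> y \<cdot>\<^bsub>D\<^esub> onArr F g) \<cdot>\<^bsub>C\<^esub> \<eta> (Dom C g) = g"
  using adjoint_pair.transpose_transpose[OF adjoint_pair_dual, of g y] assms by simp

lemma cotranspose_inj:
  assumes "\<epsilon> y \<cdot>\<^bsub>D\<^esub> onArr F g = \<epsilon> y \<cdot>\<^bsub>D\<^esub> onArr F g'" "y \<in> Ob D" "g \<in> Arr C" "g' \<in> Arr C"
    "Cod C g = onOb G y" "Cod C g' = onOb G y" "Dom C g = Dom C g'"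
  shows "g = g'"
  using adjoint_pair.transpose_inj[OF adjoint_pair_dual, of g y g'] assms by simp

lemma transpose_Comp:
  assumes "g \<in> Arr D" "f \<in> Arr C" "Dom D g = onOb F (Cod C f)"
  shows "(onArr G g \<cdot>\<^bsub>C\<^esub> \<eta> (Cod C f)) \<cdot>\<^bsub>C\<^esub> f = onArr G (g \<cdot>\<^bsub>D\<^esub> onArr F f) \<cdot>\<^bsub>C\<^esub> \<eta> (Dom C f)"
  using assms by (simp add: unit_natural)

text \<open>Arrows out of \<open>F s\<close> transpose to arrows out of \<open>s\<close>, compatibly
  with precomposition, so a jointly epic pair stays jointly epic under \<open>F\<close>. Applied to
  the injections of a biproduct, this stands in for additivity of \<open>F\<close>.\<close>

lemma left_adjoint_joint_epi:
  assumes joint: "\<And>f g. f \<in> Arr C \<Longrightarrow> g \<in> Arr C \<Longrightarrow> Dom C f = s \<Longrightarrow> Dom C g = s \<Longrightarrow> Cod C f = Cod C g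
      \<Longrightarrow> f \<cdot>\<^bsub>C\<^esub> i = g \<cdot>\<^bsub>C\<^esub> i \<Longrightarrow> f \<cdot>\<^bsub>C\<^esub> j = g \<cdot>\<^bsub>C\<^esub> j \<Longrightarrow> f = g"
    and ij: "i \<in> Arr C" "j \<in> Arr C" "Cod C i = s" "Cod C j = s"
    and fg: "f \<in> Arr D" "g \<in> Arr D" "Dom D f = onOb F s" "Dom D g = onOb F s" "Cod D f = Cod D g"
      "f \<cdot>\<^bsub>D\<^esub> onArr F i = g \<cdot>\<^bsub>D\<^esub> onArr F i" "f \<cdot>\<^bsub>D\<^esub> onArr F j = g \<cdot>\<^bsub>D\<^esub> onArr F j"
  shows "f = g"
proof -
  have s: "s \<in> Ob C" using C.Cod_in_Ob[of i] ij by simp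
  have "onArr G f \<cdot>\<^bsub>C\<^esub> \<eta> s = onArr G g \<cdot>\<^bsub>C\<^esub> \<eta> s"
  proof (rule joint)
    show "(onArr G f \<cdot>\<^bsub>C\<^esub> \<eta> s) \<cdot>\<^bsub>C\<^esub> i = (onArr G g \<cdot>\<^bsub>C\<^esub> \<eta> s) \<cdot>\<^bsub>C\<^esub> i"
      unfolding transpose_Comp[of f i, unfolded ij(3), OF fg(1) ij(1) fg(3)]
        transpose_Comp[of g i, unfolded ij(3), OF fg(2) ij(1) fg(4)] fg(6) ..
    show "(onArr G f \<cdot>\<^bsub>C\<^esub> \<eta> s) \<cdot>\<^bsub>C\<^esub> j = (onArr G g \<cdot>\<^bsub>C\<^esub> \<eta> s) \<cdot>\<^bsub>C\<^esub> j"
      unfolding transpose_Comp[of f j, unfolded ij(4), OF fg(1) ij(2) fg(3)]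
        transpose_Comp[of g j, unfolded ij(4), OF fg(2) ij(2) fg(4)] fg(7) ..
  qed (use fg(1-5) s in auto)
  then show ?thesis by (rule transpose_inj) (use fg(1-5) s in auto)
qed

lemma left_adjoint_epi:
  assumes "epi_arr C f"
  shows "epi_arr D (onArr F f)"
proof (rule D.epi_arrI)
  note f = epi_arr_in_Arr[OF assms]
  show "onArr F f \<in> Arr D" using f by simp
  fix g h
  assume gh: "g \<in> Arr D" "h \<in> Arr D" "Cod D g = Cod D h" "Dom D g = Cod D (onArr F f)"
    "Dom D h = Cod D (onArr F f)" "g \<cdot>\<^bsub>D\<^esub> onArr F f = h \<cdot>\<^bsub>D\<^esub> onArr F f"
  show "g = h"
  \<comment> \<open>An epimorphism is a jointly epic pair with equal members.\<close>
  proof (rule left_adjoint_joint_epi[OF _ f f refl refl gh(1,2) _ _ gh(3,6,6)])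
    fix k l
    assume "k \<in> Arr C" "l \<in> Arr C" "Dom C k = Cod C f" "Dom C l = Cod C f" "Cod C k = Cod C l"
      "k \<cdot>\<^bsub>C\<^esub> f = l \<cdot>\<^bsub>C\<^esub> f"
    then show "k = l" using C.epi_arrD[OF assms] by metis
  qed (use f gh(4,5) in auto)
qed

lemma right_adjoint_mono:
  assumes "mono_arr D f"
  shows "mono_arr C (onArr G f)"
  using adjoint_pair.left_adjoint_epi[OF adjoint_pair_dual, of f] assms by simp

text \<open>Fullness gives a preimage \<open>t\<close> of the counit at \<open>F x\<close>. It is a
  left inverse of the unit by faithfulness and one triangle identity, and a right inverse by
  naturality of the unit and the other.\<close>

lemma fully_faithful_unit_iso:
  assumes ff: "fully_faithful C D F" and x: "x \<in> Ob C"
  shows "iso_arr C (\<eta> x)"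
proof -
  have bij: "bij_betw (onArr F) (Hom C y z) (Hom D (onOb F y) (onOb F z))"
    if "y \<in> Ob C" "z \<in> Ob C" for y z
    using ff that by (simp add: fully_faithful_def)
  let ?y = "onOb G (onOb F x)"
  have y: "?y \<in> Ob C" using x by simp
  have "\<epsilon> (onOb F x) \<in> onArr F ` Hom C ?y x"
    using bij[OF y x] x by (simp add: bij_betw_def)
  then obtain t where t: "t \<in> Arr C" "Dom C t = ?y" "Cod C t = x" "onArr F t = \<epsilon> (onOb F x)"
    by auto
  have "onArr F (t \<cdot>\<^bsub>C\<^esub> \<eta> x) = onArr F (Ide C x)"
    using t x by simp
  then have "t \<cdot>\<^bsub>C\<^esub> \<eta> x = Ide C x"
    using inj_onD[OF bij_betw_imp_inj_on[OF bij[OF x x]], of "t \<cdot>\<^bsub>C\<^esub> \<eta> x" "Ide C x"] t x by simp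
  moreover have "\<eta> x \<cdot>\<^bsub>C\<^esub> t = Ide C ?y"
    using unit_natural[OF t(1)] t x by simp
  ultimately show ?thesis
    using t x by (intro C.iso_arrI[of _ t]) auto
qed

end

section \<open>Zero arrows, kernels and cokernels under adjoints\<close>

locale additive_adjoint_pair = adjoint_pair C D F G \<eta> \<epsilon> + C: additive_category C + D: additive_category D
  for C :: "('o, 'm) precat" and D :: "('p, 'n) precat" and F G \<eta> \<epsilon>
begin

lemma additive_adjoint_pair_dual: "additive_adjoint_pair (dual D) (dual C) G F \<epsilon> \<eta>"
  by (intro additive_adjoint_pair.intro adjoint_pair_dual additive_category_dual
      C.additive_category_axioms D.additive_category_axioms)

text \<open>Arrows out of \<open>F z\<close>, for a zero object \<open>z\<close>, transpose to
  arrows out of \<open>z\<close>, and there is only one of these into each target. Every zero arrow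
  factors through \<open>z\<close>.\<close>

lemma left_adjoint_Zero:
  assumes "x \<in> Ob C" "y \<in> Ob C"
  shows "onArr F (Zero C x y) = Zero D (onOb F x) (onOb F y)"
proof -
  obtain z where z: "zero_object C z" using C.ex_zero_object ..
  then have z': "z \<in> Ob C" by (rule C.zero_object_in_Ob)
  have uniq: "\<exists>!f. f \<in> Hom C z w" if "w \<in> Ob C" for w
    using z that by (auto simp: zero_object_def)
  have "onArr F (Zero C z y) = Zero D (onOb F z) (onOb F y)"
  proof (rule transpose_inj)
    show "onArr G (onArr F (Zero C z y)) \<cdot>\<^bsub>C\<^esub> \<eta> z = onArr G (Zero D (onOb F z) (onOb F y)) \<cdot>\<^bsub>C\<^esub> \<eta> z"
      using uniq[of "onOb G (onOb F y)"] z' assms by auto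
  qed (use z' assms in auto)
  moreover have "Zero C x y = Zero C z y \<cdot>\<^bsub>C\<^esub> Zero C x z"
    using z' assms by simp
  then have "onArr F (Zero C x y) = onArr F (Zero C z y) \<cdot>\<^bsub>D\<^esub> onArr F (Zero C x z)"
    using z' assms F.onArr_Comp_arr[of "Zero C x z" "Zero C z y"] by simp
  ultimately show ?thesis
    using z' assms by simp
qed

lemma right_adjoint_Zero:
  assumes "x \<in> Ob D" "y \<in> Ob D"
  shows "onArr G (Zero D x y) = Zero C (onOb G x) (onOb G y)"
  using additive_adjoint_pair.left_adjoint_Zero[OF additive_adjoint_pair_dual, of y x] assms by simp

text \<open>A test arrow \<open>g\<close> into the domain of \<open>G f\<close> is transposed to an
  arrow into the domain of \<open>f\<close>, factored there through \<open>k\<close>, and the factor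
  is transposed back.\<close>

lemma right_adjoint_kernel:
  assumes "is_kernel D f k"
  shows "is_kernel C (onArr G f) (onArr G k)"
proof (rule C.is_kernelI)
  note k = D.is_kernelD[OF assms]
  show "onArr G f \<in> Arr C" "onArr G k \<in> Arr C" "Cod C (onArr G k) = Dom C (onArr G f)"
    using k by auto
  show "onArr G f \<cdot>\<^bsub>C\<^esub> onArr G k = Zero C (Dom C (onArr G k)) (Cod C (onArr G f))"
    using k G.onArr_Comp_arr[of k f] by (simp add: right_adjoint_Zero)
  show "mono_arr C (onArr G k)"
    using D.kernel_mono[OF assms] by (rule right_adjoint_mono)
  fix g
  assume g: "g \<in> Arr C" "Cod C g = Dom C (onArr G f)"
    "onArr G f \<cdot>\<^bsub>C\<^esub> g = Zero C (Dom C g) (Cod C (onArr G f))"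
  let ?h = "\<epsilon> (Dom D f) \<cdot>\<^bsub>D\<^esub> onArr F g"
  have h: "?h \<in> Arr D" "Dom D ?h = onOb F (Dom C g)" "Cod D ?h = Dom D f"
    using g k by auto
  have "f \<cdot>\<^bsub>D\<^esub> ?h = \<epsilon> (Cod D f) \<cdot>\<^bsub>D\<^esub> onArr F (onArr G f \<cdot>\<^bsub>C\<^esub> g)"
    using D.Comp_reassoc[OF counit_natural[of f], of "onArr F g"] g(1,2) k by simp
  also have "\<dots> = Zero D (Dom D ?h) (Cod D f)"
    using g k by (simp add: left_adjoint_Zero)
  finally obtain u where u: "u \<in> Arr D" "Dom D u = onOb F (Dom C g)" "Cod D u = Dom D k" "k \<cdot>\<^bsub>D\<^esub> u = ?h"
    using D.kernel_factor[OF assms h(1,3)] h by metis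
  have "onArr G k \<cdot>\<^bsub>C\<^esub> (onArr G u \<cdot>\<^bsub>C\<^esub> \<eta> (Dom C g)) = onArr G (k \<cdot>\<^bsub>D\<^esub> u) \<cdot>\<^bsub>C\<^esub> \<eta> (Dom C g)"
    using u(1-3) k g by simp
  also have "\<dots> = g"
    unfolding u(4) using cotranspose_cotranspose[of g "Dom D f"] g k by simp
  finally show "\<exists>u. u \<in> Arr C \<and> Dom C u = Dom C g \<and> Cod C u = Dom C (onArr G k) \<and> onArr G k \<cdot>\<^bsub>C\<^esub> u = g"
    using u k g by (intro exI[of _ "onArr G u \<cdot>\<^bsub>C\<^esub> \<eta> (Dom C g)"]) auto
qed

lemma left_adjoint_cokernel:
  assumes "is_cokernel C f q"
  shows "is_cokernel D (onArr F f) (onArr F q)"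
  using additive_adjoint_pair.right_adjoint_kernel[OF additive_adjoint_pair_dual, of f q] assms by simp

end

section \<open>Full subcategories\<close>

lemma full_subcat_sel [simp]:
  "Ob (T \<restriction>\<^sub>C S) = S" "f \<in> Arr (T \<restriction>\<^sub>C S) \<longleftrightarrow> f \<in> Arr T \<and> Dom T f \<in> S \<and> Cod T f \<in> S"
  "Dom (T \<restriction>\<^sub>C S) = Dom T" "Cod (T \<restriction>\<^sub>C S) = Cod T"
  "Ide (T \<restriction>\<^sub>C S) = Ide T" "Comp (T \<restriction>\<^sub>C S) = Comp T" "Add (T \<restriction>\<^sub>C S) = Add T" "Zero (T \<restriction>\<^sub>C S) = Zero T"
  by (simp_all add: full_subcat_def)

lemma full_subcat_dual: "dual T \<restriction>\<^sub>C S = dual (T \<restriction>\<^sub>C S)"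
  by (auto simp: full_subcat_def dual_def)

lemma full_subcat_full_subcat: "S \<subseteq> A \<Longrightarrow> T \<restriction>\<^sub>C A \<restriction>\<^sub>C S = T \<restriction>\<^sub>C S"
  by (rule precat.equality) (auto simp: full_subcat_def)

lemma Hom_full_subcat: "x \<in> S \<Longrightarrow> y \<in> S \<Longrightarrow> Hom (T \<restriction>\<^sub>C S) x y = Hom T x y"
  by (auto simp: Hom_def)

lemma iso_arr_full_subcat: "iso_arr (T \<restriction>\<^sub>C S) f \<longleftrightarrow> iso_arr T f \<and> Dom T f \<in> S \<and> Cod T f \<in> S"
  by (auto simp: iso_arr_def)

lemma isomorphic_full_subcat:
  "isomorphic (T \<restriction>\<^sub>C S) x y \<longleftrightarrow> isomorphic T x y \<and> x \<in> S \<and> y \<in> S"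
  by (auto simp: isomorphic_def iso_arr_full_subcat)

lemma preadditive_category_full_subcat:
  assumes "preadditive_category T" "S \<subseteq> Ob T"
  shows "preadditive_category (T \<restriction>\<^sub>C S)"
proof -
  interpret preadditive_category T by fact
  interpret S: category "T \<restriction>\<^sub>C S"
    by unfold_locales (use assms(2) in auto)
  show ?thesis
  proof (rule preadditive_category.intro[OF S.category_axioms], rule preadditive_category_axioms.intro)
    fix x y assume "x \<in> Ob (T \<restriction>\<^sub>C S)" "y \<in> Ob (T \<restriction>\<^sub>C S)"
    then show "comm_group (Hom_group (T \<restriction>\<^sub>C S) x y)"
      using Hom_comm_group[of x y] assms(2)
      by (simp add: Hom_group_def Hom_full_subcat subset_iff del: Hom_iff)
  qed (auto simp: Comp_Add Add_Comp)
qed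

text \<open>Passing to \<open>S\<close> leaves fewer test objects, and fullness keeps the
  factorising arrows.\<close>

lemma is_kernel_full_subcat:
  assumes "is_kernel T f k" "Dom T k \<in> S" "Dom T f \<in> S" "Cod T f \<in> S"
  shows "is_kernel (T \<restriction>\<^sub>C S) f k"
  unfolding is_kernel_def
proof (intro conjI allI ballI impI)
  fix w g
  assume "g \<in> Hom (T \<restriction>\<^sub>C S) w (Dom (T \<restriction>\<^sub>C S) f)" "f \<cdot>\<^bsub>T \<restriction>\<^sub>C S\<^esub> g = Zero (T \<restriction>\<^sub>C S) w (Cod (T \<restriction>\<^sub>C S) f)"
  then have "\<exists>!u. u \<in> Hom T w (Dom T k) \<and> k \<cdot>\<^bsub>T\<^esub> u = g" and "w \<in> S"
    using assms(1) unfolding is_kernel_def by auto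
  then show "\<exists>!u. u \<in> Hom (T \<restriction>\<^sub>C S) w (Dom (T \<restriction>\<^sub>C S) k) \<and> k \<cdot>\<^bsub>T \<restriction>\<^sub>C S\<^esub> u = g"
    using assms(2) by (simp add: Hom_full_subcat del: Hom_iff)
qed (use assms in \<open>auto simp: is_kernel_def\<close>)

lemma short_exact_full_subcat:
  assumes "short_exact T f g" "Dom T f \<in> S" "Cod T f \<in> S" "Cod T g \<in> S"
  shows "short_exact (T \<restriction>\<^sub>C S) f g"
proof -
  have k: "is_kernel T g f" and c: "is_kernel (dual T) f g"
    using assms(1) by (simp_all add: short_exact_def)
  then have fg: "Cod T f = Dom T g" by (simp add: is_kernel_def)
  show ?thesis
    unfolding short_exact_def
  proof
    show "is_kernel (T \<restriction>\<^sub>C S) g f"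
      using is_kernel_full_subcat[OF k] assms(2-4) fg by simp
    show "is_cokernel (T \<restriction>\<^sub>C S) f g"
      using is_kernel_full_subcat[OF c, of S] assms(2-4) by (simp add: full_subcat_dual)
  qed
qed

section \<open>Adjunction triples\<close>

locale adjoint_triple = A: abelian_category A + C: additive_category C +
    LE: adjoint_pair C A L E \<eta>L \<epsilon>L + ER: adjoint_pair A C E R \<eta>R \<epsilon>R
  for A :: "('p, 'n) precat" and C :: "('o, 'm) precat" and L E R \<eta>L \<epsilon>L \<eta>R \<epsilon>R
begin

lemma adjoint_triple_dual: "adjoint_triple (dual A) (dual C) R E L \<epsilon>R \<eta>R \<epsilon>L \<eta>L"
  by (intro adjoint_triple.intro ER.adjoint_pair_dual LE.adjoint_pair_dual abelian_category_dual
      additive_category_dual A.abelian_category_axioms C.additive_category_axioms)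

end

sublocale adjoint_triple \<subseteq> LE: additive_adjoint_pair C A L E \<eta>L \<epsilon>L
  by unfold_locales

sublocale adjoint_triple \<subseteq> ER: additive_adjoint_pair A C E R \<eta>R \<epsilon>R
  by unfold_locales

context adjoint_triple
begin

text \<open>
  An arrow \<open>\<zeta> : L y \<rightarrow> R y\<close> corresponding to the inverse of \<open>\<eta>L y\<close> yields a section of \<open>\<epsilon>R y\<close>.
  Monicity of \<open>\<epsilon>R y\<close> is tested after transposing arrows into \<open>E (R y)\<close> along both adjunctions.
\<close>

lemma counit_iso_if_unit_iso:
  assumes iso: "\<And>x. x \<in> Ob C \<Longrightarrow> iso_arr C (\<eta>L x)" and y: "y \<in> Ob C"
  shows "iso_arr C (\<epsilon>R y)"
proof -
  obtain t where t: "t \<in> Arr C" "Dom C t = onOb E (onOb L y)" "Cod C t = y"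
    "t \<cdot>\<^bsub>C\<^esub> \<eta>L y = Ide C y"
    using iso[OF y] y by (elim C.iso_arrE) auto
  define \<zeta> where "\<zeta> = onArr R t \<cdot>\<^bsub>A\<^esub> \<eta>R (onOb L y)"
  have \<zeta>: "\<zeta> \<in> Arr A" "Dom A \<zeta> = onOb L y" "Cod A \<zeta> = onOb R y"
    unfolding \<zeta>_def using t y by auto
  have "\<epsilon>R y \<cdot>\<^bsub>C\<^esub> onArr E \<zeta> = t"
    unfolding \<zeta>_def using ER.transpose_transpose[of t "onOb L y"] t y by simp
  then have split: "\<epsilon>R y \<cdot>\<^bsub>C\<^esub> (onArr E \<zeta> \<cdot>\<^bsub>C\<^esub> \<eta>L y) = Ide C y"
    using C.Comp_reassoc[of "\<epsilon>R y" "onArr E \<zeta>" t "\<eta>L y"] \<zeta> t y by simp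
  have "mono_arr C (\<epsilon>R y)"
  proof (rule C.mono_arrI)
    show "\<epsilon>R y \<in> Arr C" using y by simp
    have key: "(\<epsilon>R y \<cdot>\<^bsub>C\<^esub> onArr E (\<epsilon>L (onOb R y) \<cdot>\<^bsub>A\<^esub> onArr L g)) \<cdot>\<^bsub>C\<^esub> \<eta>L (Dom C g) = \<epsilon>R y \<cdot>\<^bsub>C\<^esub> g"
      if "g \<in> Arr C" "Cod C g = onOb E (onOb R y)" for g
      using LE.cotranspose_cotranspose[of g "onOb R y"] that y by simp
    fix g h
    assume gh: "g \<in> Arr C" "h \<in> Arr C" "Dom C g = Dom C h" "Cod C g = Dom C (\<epsilon>R y)"
      "Cod C h = Dom C (\<epsilon>R y)" "\<epsilon>R y \<cdot>\<^bsub>C\<^esub> g = \<epsilon>R y \<cdot>\<^bsub>C\<^esub> h"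
    then have cod: "Cod C g = onOb E (onOb R y)" "Cod C h = onOb E (onOb R y)"
      and ob: "Dom C h \<in> Ob C" using y by auto
    have "(\<epsilon>R y \<cdot>\<^bsub>C\<^esub> onArr E (\<epsilon>L (onOb R y) \<cdot>\<^bsub>A\<^esub> onArr L g)) \<cdot>\<^bsub>C\<^esub> \<eta>L (Dom C h)
        = (\<epsilon>R y \<cdot>\<^bsub>C\<^esub> onArr E (\<epsilon>L (onOb R y) \<cdot>\<^bsub>A\<^esub> onArr L h)) \<cdot>\<^bsub>C\<^esub> \<eta>L (Dom C h)"
      unfolding key[OF gh(2) cod(2)] key[OF gh(1) cod(1), unfolded gh(3)] by (rule gh(6))
    then have "\<epsilon>R y \<cdot>\<^bsub>C\<^esub> onArr E (\<epsilon>L (onOb R y) \<cdot>\<^bsub>A\<^esub> onArr L g)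
        = \<epsilon>R y \<cdot>\<^bsub>C\<^esub> onArr E (\<epsilon>L (onOb R y) \<cdot>\<^bsub>A\<^esub> onArr L h)"
      by (rule C.epi_arrD[OF C.iso_epi[OF iso[OF ob]]]) (use gh(1-3) cod ob y in auto)
    then have "\<epsilon>L (onOb R y) \<cdot>\<^bsub>A\<^esub> onArr L g = \<epsilon>L (onOb R y) \<cdot>\<^bsub>A\<^esub> onArr L h"
      by (rule ER.cotranspose_inj) (use gh(1-3) cod ob y in auto)
    then show "g = h"
      by (rule LE.cotranspose_inj) (use gh(1-3) cod ob y in auto)
  qed
  then show ?thesis
    by (rule C.mono_split_iso[of _ "onArr E \<zeta> \<cdot>\<^bsub>C\<^esub> \<eta>L y"]) (use \<zeta> y split in auto)
qed

end

text \<open>The alternative between \<open>L\<close> and \<open>R\<close> is replaced by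
  invertibility of both \<open>\<eta>L\<close> and \<open>\<epsilon>R\<close>. This form is
  symmetric under passing to opposite categories, so every lemma on \<open>\<epsilon>L\<close> has a
  dual on \<open>\<eta>R\<close>.\<close>

locale ff_adjoint_triple = adjoint_triple A C L E R \<eta>L \<epsilon>L \<eta>R \<epsilon>R
  for A :: "('p, 'n) precat" and C :: "('o, 'm) precat" and L E R \<eta>L \<epsilon>L \<eta>R \<epsilon>R +
  assumes unit_iso: "x \<in> Ob C \<Longrightarrow> iso_arr C (\<eta>L x)"
    and counit_iso: "x \<in> Ob C \<Longrightarrow> iso_arr C (\<epsilon>R x)"

lemma (in adjoint_triple) ff_adjoint_tripleI:
  assumes "fully_faithful C A L \<or> fully_faithful C A R"
  shows "ff_adjoint_triple A C L E R \<eta>L \<epsilon>L \<eta>R \<epsilon>R"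
  using assms
proof
  assume "fully_faithful C A L"
  then have "iso_arr C (\<eta>L x)" if "x \<in> Ob C" for x
    using that by (rule LE.fully_faithful_unit_iso)
  then show ?thesis
    by unfold_locales (auto intro: counit_iso_if_unit_iso)
next
  assume ff: "fully_faithful C A R"
  \<comment> \<open>In the opposite categories \<open>R\<close> is left adjoint to \<open>E\<close>
    with unit \<open>\<epsilon>R\<close>, so this case is the previous one read there.\<close>
  have "fully_faithful (dual C) (dual A) R"
    using ff is_functor.is_functor_dual[of C A R] unfolding fully_faithful_def by (auto simp: Hom_dual simp del: Hom_iff)
  then have 1: "iso_arr (dual C) (\<epsilon>R x)" if "x \<in> Ob C" for x
    using adjoint_pair.fully_faithful_unit_iso[OF ER.adjoint_pair_dual, of x] that by simp
  then have "iso_arr C (\<eta>L x)" if "x \<in> Ob C" for x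
    using adjoint_triple.counit_iso_if_unit_iso[OF adjoint_triple_dual, of x] that by simp
  with 1 show ?thesis by unfold_locales auto
qed

section \<open>Counits along quotients and extensions, and \<open>E\<close> on hom-sets\<close>

context ff_adjoint_triple
begin

lemma ff_adjoint_triple_dual: "ff_adjoint_triple (dual A) (dual C) R E L \<epsilon>R \<eta>R \<epsilon>L \<eta>L"
  by (intro ff_adjoint_triple.intro adjoint_triple_dual ff_adjoint_triple_axioms.intro)
    (auto simp: unit_iso counit_iso)

text \<open>In the triangle identity at \<open>x\<close> the factor \<open>L (\<eta>L x)\<close> is
  invertible, hence so is the other factor.\<close>

lemma counit_L_iso:
  assumes "x \<in> Ob C"
  shows "iso_arr A (\<epsilon>L (onOb L x))"
proof (rule A.iso_cancel_right)
  show "iso_arr A (onArr L (\<eta>L x))"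
    using LE.F.onArr_iso C.category_axioms A.category_axioms unit_iso[OF assms] by blast
qed (use assms A.iso_Ide in auto)

text \<open>By naturality the counit at the codomain is the last factor of an epimorphism. So the
  property passes to quotients, in particular from \<open>L x\<close> to the image of the
  norm.\<close>

lemma counit_epi_of_epi:
  assumes "epi_arr A f" "epi_arr A (\<epsilon>L (Dom A f))"
  shows "epi_arr A (\<epsilon>L (Cod A f))"
proof -
  have f: "f \<in> Arr A" using assms(1) by (rule epi_arr_in_Arr)
  have "epi_arr A (\<epsilon>L (Cod A f) \<cdot>\<^bsub>A\<^esub> onArr L (onArr E f))"
    unfolding LE.counit_natural[OF f] by (rule A.epi_comp) (use assms f in auto)
  then show ?thesis by (rule A.epi_of_comp) (use f in auto)
qed

lemma counit_iso_of_iso: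
  assumes "iso_arr A f" "iso_arr A (\<epsilon>L (Dom A f))"
  shows "iso_arr A (\<epsilon>L (Cod A f))"
proof -
  have f: "f \<in> Arr A" using assms(1) by (rule iso_arr_in_Arr)
  have 1: "iso_arr A (\<epsilon>L (Cod A f) \<cdot>\<^bsub>A\<^esub> onArr L (onArr E f))"
    unfolding LE.counit_natural[OF f] by (rule A.iso_comp) (use assms f in auto)
  have "iso_arr A (onArr L (onArr E f))"
    using LE.F.onArr_iso LE.G.onArr_iso C.category_axioms A.category_axioms assms(1) by blast
  with 1 show ?thesis by (rule A.iso_cancel_right) (use f in auto)
qed

text \<open>A four lemma in the form of a zero test. An arrow \<open>g\<close> that kills the middle
  counit also kills \<open>i\<close>, because the counit at the subobject is epic, so
  \<open>g = h \<cdot> p\<close>. As \<open>L\<close> and \<open>E\<close> preserve the epimorphism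
  \<open>p\<close>, the arrow \<open>h\<close> kills the counit at the quotient and is zero.\<close>

lemma counit_epi_extension:
  assumes "short_exact A i p" "epi_arr A (\<epsilon>L (Dom A i))" "epi_arr A (\<epsilon>L (Cod A p))"
  shows "epi_arr A (\<epsilon>L (Cod A i))"
proof (rule A.epi_arrI_Zero)
  have c: "is_cokernel A i p" using assms(1) by (simp add: short_exact_def)
  note ip = A.is_cokernelD[OF c]
  let ?b = "Cod A i"
  show "\<epsilon>L ?b \<in> Arr A" using ip by simp
  fix g
  assume g: "g \<in> Arr A" "Dom A g = Cod A (\<epsilon>L ?b)" "g \<cdot>\<^bsub>A\<^esub> \<epsilon>L ?b = Zero A (Dom A (\<epsilon>L ?b)) (Cod A g)"
  then have g': "Dom A g = ?b" using ip by simp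
  have "(g \<cdot>\<^bsub>A\<^esub> i) \<cdot>\<^bsub>A\<^esub> \<epsilon>L (Dom A i) = g \<cdot>\<^bsub>A\<^esub> (\<epsilon>L ?b \<cdot>\<^bsub>A\<^esub> onArr L (onArr E i))"
    using LE.counit_natural[OF ip(1)] g(1) g' ip by simp
  also have "\<dots> = Zero A (Dom A (\<epsilon>L (Dom A i))) (Cod A g)"
    using A.Comp_reassoc[OF g(3), of "onArr L (onArr E i)"] g(1) g' ip by simp
  finally have "g \<cdot>\<^bsub>A\<^esub> i = Zero A (Dom A i) (Cod A g)"
    using A.epi_arrD_Zero[OF assms(2), of "g \<cdot>\<^bsub>A\<^esub> i"] g(1) g' ip by simp
  then obtain h where h: "h \<in> Arr A" "Cod A h = Cod A g" "Dom A h = Cod A p" "h \<cdot>\<^bsub>A\<^esub> p = g"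
    using A.cokernel_factor[OF c, of g] g(1) g' by metis
  have "(h \<cdot>\<^bsub>A\<^esub> \<epsilon>L (Cod A p)) \<cdot>\<^bsub>A\<^esub> onArr L (onArr E p) = (h \<cdot>\<^bsub>A\<^esub> p) \<cdot>\<^bsub>A\<^esub> \<epsilon>L (Dom A p)"
    using LE.counit_natural[OF ip(2)] h(1-3) ip by simp
  also have "\<dots> = Zero A (Dom A (onArr L (onArr E p))) (Cod A g)"
    unfolding h(4) using g ip by simp
  finally have "h \<cdot>\<^bsub>A\<^esub> \<epsilon>L (Cod A p) = Zero A (Dom A (\<epsilon>L (Cod A p))) (Cod A h)"
    using A.epi_arrD_Zero[OF LE.left_adjoint_epi[OF ER.left_adjoint_epi[OF A.cokernel_epi[OF c]]],
        of "h \<cdot>\<^bsub>A\<^esub> \<epsilon>L (Cod A p)"] h(1-3) ip by simp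
  then have "h = Zero A (Cod A p) (Cod A g)"
    using A.epi_arrD_Zero[OF assms(3), of h] h(1-3) ip by simp
  then show "g = Zero A (Cod A (\<epsilon>L ?b)) (Cod A g)"
    using h(4) ip g(1) g' by simp
qed

text \<open>As left adjoints, \<open>L\<close> and \<open>E\<close> keep the sequence exact only on
  the right. Exactness on the left is recovered from the assumption: the middle counit after
  \<open>L (E i)\<close> equals \<open>i\<close> after an isomorphism, so \<open>L (E i)\<close> is
  monic and hence the kernel of \<open>L (E p)\<close>. Then the usual chase shows the middle counit
  to be monic.\<close>

lemma counit_iso_extension:
  assumes "short_exact A i p" "iso_arr A (\<epsilon>L (Dom A i))" "iso_arr A (\<epsilon>L (Cod A p))"
  shows "iso_arr A (\<epsilon>L (Cod A i))"
proof (rule A.mono_epi_iso)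
  show "epi_arr A (\<epsilon>L (Cod A i))"
    by (rule counit_epi_extension[OF assms(1)]) (intro A.iso_epi assms)+
  have k: "is_kernel A p i" and c: "is_cokernel A i p"
    using assms(1) by (simp_all add: short_exact_def)
  note ip = A.is_cokernelD[OF c]
  let ?b = "Cod A i" and ?i = "onArr L (onArr E i)" and ?p = "onArr L (onArr E p)"
  have nat_i: "\<epsilon>L ?b \<cdot>\<^bsub>A\<^esub> ?i = i \<cdot>\<^bsub>A\<^esub> \<epsilon>L (Dom A i)"
    by (rule LE.counit_natural[OF ip(1)])
  have "mono_arr A (i \<cdot>\<^bsub>A\<^esub> \<epsilon>L (Dom A i))"
    by (rule A.mono_comp[OF A.iso_mono[OF assms(2)] A.kernel_mono[OF k]]) (use ip in auto)
  then have mono: "mono_arr A (\<epsilon>L ?b \<cdot>\<^bsub>A\<^esub> ?i)" unfolding nat_i .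
  then have "mono_arr A ?i"
    by (rule A.mono_of_comp) (use ip in auto)
  then have ker: "is_kernel A ?p ?i"
    using LE.left_adjoint_cokernel[OF ER.left_adjoint_cokernel[OF c]] by (rule A.mono_is_kernel)
  show "mono_arr A (\<epsilon>L ?b)"
  proof (rule A.mono_arrI_Zero)
    show "\<epsilon>L ?b \<in> Arr A" using ip by simp
    fix g
    assume g: "g \<in> Arr A" "Cod A g = Dom A (\<epsilon>L ?b)" "\<epsilon>L ?b \<cdot>\<^bsub>A\<^esub> g = Zero A (Dom A g) (Cod A (\<epsilon>L ?b))"
    then have g': "Cod A g = onOb L (onOb E ?b)" using ip by simp
    have "\<epsilon>L (Cod A p) \<cdot>\<^bsub>A\<^esub> (?p \<cdot>\<^bsub>A\<^esub> g) = p \<cdot>\<^bsub>A\<^esub> (\<epsilon>L ?b \<cdot>\<^bsub>A\<^esub> g)"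
      using A.Comp_reassoc[OF LE.counit_natural[OF ip(2)], of g] ip g(1) g' by simp
    also have "\<dots> = Zero A (Dom A g) (Cod A p)"
      unfolding g(3) using ip g(1) by simp
    finally have "?p \<cdot>\<^bsub>A\<^esub> g = Zero A (Dom A g) (Cod A ?p)"
      using A.mono_arrD_Zero[OF A.iso_mono[OF assms(3)], of "?p \<cdot>\<^bsub>A\<^esub> g"] ip g(1) g' by simp
    then obtain h where h: "h \<in> Arr A" "Dom A h = Dom A g" "Cod A h = Dom A ?i" "?i \<cdot>\<^bsub>A\<^esub> h = g"
      using A.kernel_factor[OF ker, of g] ip g(1) g' by auto
    have "(\<epsilon>L ?b \<cdot>\<^bsub>A\<^esub> ?i) \<cdot>\<^bsub>A\<^esub> h = \<epsilon>L ?b \<cdot>\<^bsub>A\<^esub> (?i \<cdot>\<^bsub>A\<^esub> h)"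
      using h(1-3) ip by (intro A.Comp_assoc_arr) auto
    also have "\<dots> = Zero A (Dom A h) (Cod A (\<epsilon>L ?b \<cdot>\<^bsub>A\<^esub> ?i))"
      unfolding h(4) g(3) using h(2) ip by simp
    finally have "h = Zero A (Dom A h) (Dom A (\<epsilon>L ?b \<cdot>\<^bsub>A\<^esub> ?i))"
      using h(1-3) ip by (intro A.mono_arrD_Zero[OF mono]) auto
    then have "h = Zero A (Dom A g) (Dom A ?i)"
      using h(2) ip by simp
    then show "g = Zero A (Dom A g) (Dom A (\<epsilon>L ?b))"
      using h(4) ip g(1) by simp
  qed
qed

text \<open>Naturality of the counit expresses \<open>f\<close> after the counit at its domain
  through \<open>E f\<close> alone, and that counit is epic.\<close>

lemma E_faithful:
  assumes "epi_arr A (\<epsilon>L (Dom A f))" "onArr E f = onArr E g" "f \<in> Arr A" "g \<in> Arr A"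
    "Dom A f = Dom A g" "Cod A f = Cod A g"
  shows "f = g"
proof -
  have "f \<cdot>\<^bsub>A\<^esub> \<epsilon>L (Dom A f) = g \<cdot>\<^bsub>A\<^esub> \<epsilon>L (Dom A f)"
    using LE.counit_natural[of f] LE.counit_natural[of g] assms(2-6) by simp
  then show ?thesis by (rule A.epi_arrD[OF assms(1)]) (use assms(3-6) in auto)
qed

text \<open>Under the bijection between arrows \<open>L (E s) -> t\<close> and
  \<open>E s -> E t\<close>, the left side of the equation corresponds to \<open>E f\<close> and the
  right side to \<open>h\<close>.\<close>

lemma E_full:
  assumes "f \<cdot>\<^bsub>A\<^esub> \<epsilon>L s = \<epsilon>L t \<cdot>\<^bsub>A\<^esub> onArr L h"
    and "f \<in> Arr A" "Dom A f = s" "Cod A f = t" "h \<in> Arr C" "Dom C h = onOb E s" "Cod C h = onOb E t"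
  shows "onArr E f = h"
proof -
  have st: "s \<in> Ob A" "t \<in> Ob A" using assms A.Dom_in_Ob A.Cod_in_Ob by blast+
  have "onArr E f = onArr E f \<cdot>\<^bsub>C\<^esub> (onArr E (\<epsilon>L s) \<cdot>\<^bsub>C\<^esub> \<eta>L (onOb E s))"
    using assms(2-4) st by simp
  also have "\<dots> = onArr E (f \<cdot>\<^bsub>A\<^esub> \<epsilon>L s) \<cdot>\<^bsub>C\<^esub> \<eta>L (onOb E s)"
    using assms(2-4) st by (simp del: LE.triangle_G)
  also have "\<dots> = h"
    unfolding assms(1) using LE.cotranspose_cotranspose[of h t] assms(5-7) st by simp
  finally show ?thesis .
qed

text \<open>Turns fullness of \<open>E\<close> into a factorisation problem in \<open>A\<close>: the
  arrow \<open>L (E s) -> t\<close> corresponding to \<open>h\<close> has to factor through the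
  counit at \<open>s\<close>.\<close>

lemma E_bij:
  assumes st: "s \<in> Ob A" "t \<in> Ob A" and epi: "epi_arr A (\<epsilon>L s)"
    and factor: "\<And>h. h \<in> Arr C \<Longrightarrow> Dom C h = onOb E s \<Longrightarrow> Cod C h = onOb E t \<Longrightarrow>
      \<exists>f. f \<in> Arr A \<and> Dom A f = s \<and> Cod A f = t \<and> f \<cdot>\<^bsub>A\<^esub> \<epsilon>L s = \<epsilon>L t \<cdot>\<^bsub>A\<^esub> onArr L h"
  shows "bij_betw (onArr E) (Hom A s t) (Hom C (onOb E s) (onOb E t))"
proof (rule bij_betw_imageI)
  show "inj_on (onArr E) (Hom A s t)"
    using E_faithful epi by (intro inj_onI) simp
  show "onArr E ` Hom A s t = Hom C (onOb E s) (onOb E t)"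
  proof
    show "Hom C (onOb E s) (onOb E t) \<subseteq> onArr E ` Hom A s t"
    proof
      fix h assume h: "h \<in> Hom C (onOb E s) (onOb E t)"
      then obtain f where f: "f \<in> Arr A" "Dom A f = s" "Cod A f = t" "f \<cdot>\<^bsub>A\<^esub> \<epsilon>L s = \<epsilon>L t \<cdot>\<^bsub>A\<^esub> onArr L h"
        using factor[of h] by auto
      then have "onArr E f = h" using h by (intro E_full[of f s t h]) auto
      then show "h \<in> onArr E ` Hom A s t" using f by auto
    qed
  qed auto
qed

lemma E_bij_counit_iso:
  assumes "s \<in> Ob A" "t \<in> Ob A" and iso: "iso_arr A (\<epsilon>L s)"
  shows "bij_betw (onArr E) (Hom A s t) (Hom C (onOb E s) (onOb E t))"
proof (rule E_bij[OF assms(1,2) A.iso_epi[OF iso]])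
  fix h assume h: "h \<in> Arr C" "Dom C h = onOb E s" "Cod C h = onOb E t"
  obtain e where e: "e \<in> Arr A" "Dom A e = s" "Cod A e = onOb L (onOb E s)" "e \<cdot>\<^bsub>A\<^esub> \<epsilon>L s = Ide A (onOb L (onOb E s))"
    using iso assms(1) by (elim A.iso_arrE) auto
  then show "\<exists>f. f \<in> Arr A \<and> Dom A f = s \<and> Cod A f = t \<and> f \<cdot>\<^bsub>A\<^esub> \<epsilon>L s = \<epsilon>L t \<cdot>\<^bsub>A\<^esub> onArr L h"
    using h assms by (intro exI[of _ "\<epsilon>L t \<cdot>\<^bsub>A\<^esub> onArr L h \<cdot>\<^bsub>A\<^esub> e"]) auto
qed

text \<open>Cancelling the isomorphism \<open>\<epsilon>R y\<close> leaves a transposition along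
  \<open>L\<close> and \<open>E\<close>. For \<open>x = y\<close> this is the uniqueness of the
  norm; the general case compares arrows \<open>L x -> R y\<close> along an arrow of
  \<open>C\<close>.\<close>

lemma norm_inj:
  assumes "\<epsilon>R y \<cdot>\<^bsub>C\<^esub> (onArr E m \<cdot>\<^bsub>C\<^esub> \<eta>L x) = \<epsilon>R y \<cdot>\<^bsub>C\<^esub> (onArr E n \<cdot>\<^bsub>C\<^esub> \<eta>L x)"
    and "x \<in> Ob C" "y \<in> Ob C" "m \<in> Arr A" "n \<in> Arr A"
    and "Dom A m = onOb L x" "Dom A n = onOb L x" "Cod A m = onOb R y" "Cod A n = onOb R y"
  shows "m = n"
proof -
  have "onArr E m \<cdot>\<^bsub>C\<^esub> \<eta>L x = onArr E n \<cdot>\<^bsub>C\<^esub> \<eta>L x"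
    by (rule C.mono_arrD[OF C.iso_mono[OF counit_iso[OF assms(3)]] assms(1)]) (use assms(2-9) in auto)
  then show ?thesis
    by (rule LE.transpose_inj) (use assms(2-9) in auto)
qed

text \<open>For \<open>s = t\<close> and \<open>h\<close> the identity, both sides are the norm at \<open>E s\<close>.\<close>

lemma unit_counit_natural:
  assumes "s \<in> Ob A" "t \<in> Ob A" "h \<in> Arr C" "Dom C h = onOb E s" "Cod C h = onOb E t"
  shows "\<eta>R t \<cdot>\<^bsub>A\<^esub> (\<epsilon>L t \<cdot>\<^bsub>A\<^esub> onArr L h) = onArr R h \<cdot>\<^bsub>A\<^esub> (\<eta>R s \<cdot>\<^bsub>A\<^esub> \<epsilon>L s)"
proof (rule norm_inj)
  have "\<epsilon>R (onOb E t) \<cdot>\<^bsub>C\<^esub> (onArr E (\<eta>R t \<cdot>\<^bsub>A\<^esub> (\<epsilon>L t \<cdot>\<^bsub>A\<^esub> onArr L h)) \<cdot>\<^bsub>C\<^esub> \<eta>L (onOb E s))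
      = (\<epsilon>R (onOb E t) \<cdot>\<^bsub>C\<^esub> onArr E (\<eta>R t)) \<cdot>\<^bsub>C\<^esub> (onArr E (\<epsilon>L t \<cdot>\<^bsub>A\<^esub> onArr L h) \<cdot>\<^bsub>C\<^esub> \<eta>L (Dom C h))"
    using assms by (simp del: ER.triangle_F)
  also have "\<dots> = h"
    unfolding LE.cotranspose_cotranspose[OF assms(3,5,2)] using assms by simp
  finally have 1: "\<epsilon>R (onOb E t) \<cdot>\<^bsub>C\<^esub> (onArr E (\<eta>R t \<cdot>\<^bsub>A\<^esub> (\<epsilon>L t \<cdot>\<^bsub>A\<^esub> onArr L h)) \<cdot>\<^bsub>C\<^esub> \<eta>L (onOb E s)) = h" .
  have "\<epsilon>R (onOb E t) \<cdot>\<^bsub>C\<^esub> (onArr E (onArr R h \<cdot>\<^bsub>A\<^esub> (\<eta>R s \<cdot>\<^bsub>A\<^esub> \<epsilon>L s)) \<cdot>\<^bsub>C\<^esub> \<eta>L (onOb E s))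
      = (\<epsilon>R (Cod C h) \<cdot>\<^bsub>C\<^esub> onArr E (onArr R h \<cdot>\<^bsub>A\<^esub> \<eta>R s)) \<cdot>\<^bsub>C\<^esub> (onArr E (\<epsilon>L s) \<cdot>\<^bsub>C\<^esub> \<eta>L (onOb E s))"
    using assms by (simp del: LE.triangle_G)
  also have "\<dots> = h"
    unfolding ER.transpose_transpose[OF assms(3,4,1)] using assms by simp
  finally show "\<epsilon>R (onOb E t) \<cdot>\<^bsub>C\<^esub> (onArr E (\<eta>R t \<cdot>\<^bsub>A\<^esub> (\<epsilon>L t \<cdot>\<^bsub>A\<^esub> onArr L h)) \<cdot>\<^bsub>C\<^esub> \<eta>L (onOb E s))
      = \<epsilon>R (onOb E t) \<cdot>\<^bsub>C\<^esub> (onArr E (onArr R h \<cdot>\<^bsub>A\<^esub> (\<eta>R s \<cdot>\<^bsub>A\<^esub> \<epsilon>L s)) \<cdot>\<^bsub>C\<^esub> \<eta>L (onOb E s))"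
    using 1 by simp
qed (use assms in auto)

text \<open>The arrow \<open>L (E s) -> t\<close> corresponding to \<open>h\<close> factors through
  the epimorphism \<open>\<epsilon>L s\<close> once it kills the kernel \<open>k\<close> of the
  latter. After \<open>\<eta>R t\<close> it becomes an arrow that begins with
  \<open>\<epsilon>L s\<close> and so kills \<open>k\<close>; the monomorphism
  \<open>\<eta>R t\<close> then cancels.\<close>

lemma E_bij_intermediate:
  assumes st: "s \<in> Ob A" "t \<in> Ob A" and epi: "epi_arr A (\<epsilon>L s)" and mono: "mono_arr A (\<eta>R t)"
  shows "bij_betw (onArr E) (Hom A s t) (Hom C (onOb E s) (onOb E t))"
proof (rule E_bij[OF st epi])
  fix h assume h: "h \<in> Arr C" "Dom C h = onOb E s" "Cod C h = onOb E t"
  obtain k where k: "is_kernel A (\<epsilon>L s) k" using A.ex_kernel epi_arr_in_Arr[OF epi] by blast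
  note k' = A.is_kernelD[OF k]
  let ?g = "\<epsilon>L t \<cdot>\<^bsub>A\<^esub> onArr L h"
  have "\<eta>R t \<cdot>\<^bsub>A\<^esub> (?g \<cdot>\<^bsub>A\<^esub> k) = (\<eta>R t \<cdot>\<^bsub>A\<^esub> ?g) \<cdot>\<^bsub>A\<^esub> k"
    using k' h st by simp
  also have "\<dots> = onArr R h \<cdot>\<^bsub>A\<^esub> (\<eta>R s \<cdot>\<^bsub>A\<^esub> (\<epsilon>L s \<cdot>\<^bsub>A\<^esub> k))"
    unfolding unit_counit_natural[OF st h] using k'(1-3) h st by simp
  also have "\<dots> = Zero A (Dom A k) (Cod A (\<eta>R t))"
    unfolding k'(4) using k'(1-3) h st by simp
  finally have "?g \<cdot>\<^bsub>A\<^esub> k = Zero A (Dom A k) t"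
    using A.mono_arrD_Zero[OF mono, of "?g \<cdot>\<^bsub>A\<^esub> k"] k'(1-3) h st by simp
  then show "\<exists>f. f \<in> Arr A \<and> Dom A f = s \<and> Cod A f = t \<and> f \<cdot>\<^bsub>A\<^esub> \<epsilon>L s = ?g"
    using A.cokernel_factor[OF A.epi_is_cokernel[OF epi k], of ?g] k'(1-3) h st by auto
qed

end

section \<open>Full subcategories on which \<open>E\<close> is an equivalence\<close>

text \<open>Covers all three essential images at once. Only properties of \<open>E\<close> on
  \<open>S\<close> are recorded, without a functor back, so the same \<open>S\<close> satisfies the
  conditions in the opposite categories, with \<open>L\<close> and \<open>R\<close>
  exchanged.\<close>

locale equivalent_subcategory = adjoint_triple A C L E R \<eta>L \<epsilon>L \<eta>R \<epsilon>R
  for A :: "('p, 'n) precat" and C :: "('o, 'm) precat" and L E R \<eta>L \<epsilon>L \<eta>R \<epsilon>R +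
  fixes S :: "'p set"
  assumes S_subset: "S \<subseteq> Ob A"
    and E_bij_S: "s \<in> S \<Longrightarrow> t \<in> S
      \<Longrightarrow> bij_betw (onArr E) (Hom A s t) (Hom C (onOb E s) (onOb E t))"
    and E_dense: "x \<in> Ob C \<Longrightarrow> \<exists>s \<in> S. isomorphic C (onOb E s) x"
begin

lemma equivalent_subcategory_dual:
  "equivalent_subcategory (dual A) (dual C) R E L \<epsilon>R \<eta>R \<epsilon>L \<eta>L S"
  by (intro equivalent_subcategory.intro adjoint_triple_dual equivalent_subcategory_axioms.intro)
    (use S_subset E_bij_S E_dense in \<open>auto simp: Hom_dual C.isomorphic_dual simp del: Hom_iff\<close>)

lemma preadditive_S: "preadditive_category (A \<restriction>\<^sub>C S)"
  using A.preadditive_category_axioms S_subset by (rule preadditive_category_full_subcat)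

lemma S_Ob [simp]: "s \<in> S \<Longrightarrow> s \<in> Ob A"
  using S_subset by blast

lemma E_inj:
  assumes "onArr E f = onArr E g" "f \<in> Arr A" "g \<in> Arr A" "Dom A f = Dom A g" "Cod A f = Cod A g"
    "Dom A f \<in> S" "Cod A f \<in> S"
  shows "f = g"
  using inj_onD[OF bij_betw_imp_inj_on[OF E_bij_S[OF assms(6,7)]] assms(1)] assms(2-5) by simp

lemma E_surj:
  assumes "h \<in> Arr C" "Dom C h = onOb E s" "Cod C h = onOb E t" "s \<in> S" "t \<in> S"
  obtains f where "f \<in> Arr A" "Dom A f = s" "Cod A f = t" "onArr E f = h"
proof -
  have "h \<in> onArr E ` Hom A s t"
    using bij_betw_imp_surj_on[OF E_bij_S[OF assms(4,5)]] assms(1-3) by simp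
  then show ?thesis using that by auto
qed

lemma E_dense_iso:
  assumes "x \<in> Ob C"
  obtains s t t' where "s \<in> S" "iso_arr C t" "t \<in> Arr C" "Dom C t = onOb E s" "Cod C t = x"
    "t' \<in> Arr C" "Dom C t' = x" "Cod C t' = onOb E s"
    "t' \<cdot>\<^bsub>C\<^esub> t = Ide C (onOb E s)" "t \<cdot>\<^bsub>C\<^esub> t' = Ide C x"
proof -
  obtain s where s: "s \<in> S" "isomorphic C (onOb E s) x" using E_dense[OF assms] by blast
  then obtain t where t: "iso_arr C t" "Dom C t = onOb E s" "Cod C t = x" by (elim C.isomorphicE)
  from t(1) show ?thesis
    by (rule C.iso_arrE) (rule that[OF s(1) t(1)], use t in auto)
qed

text \<open>Test arrows from \<open>S\<close> are sent to \<open>C\<close>, factored there, and the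
  factor lifts because \<open>E\<close> is full on \<open>S\<close>; equations lift because it is
  faithful. Thus kernels in \<open>S\<close> are recognised in \<open>C\<close>, whatever the kernel
  in \<open>A\<close> may be.\<close>

lemma reflect_kernel:
  assumes "is_kernel C (onArr E f) (onArr E k)" "f \<in> Arr A" "k \<in> Arr A" "Cod A k = Dom A f"
    "Dom A k \<in> S" "Dom A f \<in> S" "Cod A f \<in> S"
  shows "is_kernel (A \<restriction>\<^sub>C S) f k"
proof (rule preadditive_category.is_kernelI[OF preadditive_S])
  note ker = assms(1) and arr = assms(2-7)
  show "f \<cdot>\<^bsub>A \<restriction>\<^sub>C S\<^esub> k = Zero (A \<restriction>\<^sub>C S) (Dom (A \<restriction>\<^sub>C S) k) (Cod (A \<restriction>\<^sub>C S) f)"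
    unfolding full_subcat_sel
    by (rule E_inj) (use arr C.is_kernelD[OF ker] LE.right_adjoint_Zero in auto)
  show "mono_arr (A \<restriction>\<^sub>C S) k"
  proof (rule category.mono_arrI)
    show "category (A \<restriction>\<^sub>C S)"
      using preadditive_S by (rule preadditive_category.axioms)
    fix g h
    assume gh: "g \<in> Arr (A \<restriction>\<^sub>C S)" "h \<in> Arr (A \<restriction>\<^sub>C S)" "Dom (A \<restriction>\<^sub>C S) g = Dom (A \<restriction>\<^sub>C S) h"
      "Cod (A \<restriction>\<^sub>C S) g = Dom (A \<restriction>\<^sub>C S) k" "Cod (A \<restriction>\<^sub>C S) h = Dom (A \<restriction>\<^sub>C S) k"
      "k \<cdot>\<^bsub>A \<restriction>\<^sub>C S\<^esub> g = k \<cdot>\<^bsub>A \<restriction>\<^sub>C S\<^esub> h"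
    then have "onArr E (k \<cdot>\<^bsub>A\<^esub> g) = onArr E (k \<cdot>\<^bsub>A\<^esub> h)" by simp
    then have "onArr E k \<cdot>\<^bsub>C\<^esub> onArr E g = onArr E k \<cdot>\<^bsub>C\<^esub> onArr E h"
      using gh(1-5) arr by simp
    then have "onArr E g = onArr E h"
      by (rule C.mono_arrD[OF C.kernel_mono[OF ker]]) (use gh(1-5) arr in auto)
    then show "g = h" by (rule E_inj) (use gh(1-5) arr in auto)
  qed (use arr in auto)
  fix g
  assume g: "g \<in> Arr (A \<restriction>\<^sub>C S)" "Cod (A \<restriction>\<^sub>C S) g = Dom (A \<restriction>\<^sub>C S) f"
    "f \<cdot>\<^bsub>A \<restriction>\<^sub>C S\<^esub> g = Zero (A \<restriction>\<^sub>C S) (Dom (A \<restriction>\<^sub>C S) g) (Cod (A \<restriction>\<^sub>C S) f)"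
  then have "onArr E (f \<cdot>\<^bsub>A\<^esub> g) = onArr E (Zero A (Dom A g) (Cod A f))" by simp
  then have "onArr E f \<cdot>\<^bsub>C\<^esub> onArr E g = Zero C (Dom C (onArr E g)) (Cod C (onArr E f))"
    using g(1,2) arr by (simp add: LE.right_adjoint_Zero)
  then obtain v where v: "v \<in> Arr C" "Dom C v = onOb E (Dom A g)" "Cod C v = onOb E (Dom A k)"
      "onArr E k \<cdot>\<^bsub>C\<^esub> v = onArr E g"
    using C.kernel_factor[OF ker, of "onArr E g"] g(1,2) arr by auto
  obtain u where u: "u \<in> Arr A" "Dom A u = Dom A g" "Cod A u = Dom A k" "onArr E u = v"
    using E_surj[OF v(1-3)] g(1) arr by auto
  have "k \<cdot>\<^bsub>A\<^esub> u = g"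
    by (rule E_inj) (use u v(4) g(1,2) arr in auto)
  then show "\<exists>u. u \<in> Arr (A \<restriction>\<^sub>C S) \<and> Dom (A \<restriction>\<^sub>C S) u = Dom (A \<restriction>\<^sub>C S) g \<and>
      Cod (A \<restriction>\<^sub>C S) u = Dom (A \<restriction>\<^sub>C S) k \<and> k \<cdot>\<^bsub>A \<restriction>\<^sub>C S\<^esub> u = g"
    using u g(1) arr by auto
qed (use assms in auto)

text \<open>The kernel in \<open>A\<close> may have its domain outside \<open>S\<close>. Its value
  under \<open>E\<close> is a kernel in \<open>C\<close>, and density replaces the domain by some
  \<open>E u\<close> with \<open>u\<close> in \<open>S\<close>.\<close>

lemma ex_kernel_S:
  assumes f: "f \<in> Arr (A \<restriction>\<^sub>C S)"
  shows "\<exists>k. is_kernel (A \<restriction>\<^sub>C S) f k"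
proof -
  have f': "f \<in> Arr A" "Dom A f \<in> S" "Cod A f \<in> S" using f by auto
  obtain k where k: "is_kernel A f k" using A.ex_kernel f'(1) by blast
  note k' = A.is_kernelD[OF k]
  obtain u t t' where t: "u \<in> S" "iso_arr C t" "t \<in> Arr C" "Dom C t = onOb E u" "Cod C t = onOb E (Dom A k)"
    "t' \<in> Arr C" "Dom C t' = onOb E (Dom A k)" "Cod C t' = onOb E u"
    "t' \<cdot>\<^bsub>C\<^esub> t = Ide C (onOb E u)" "t \<cdot>\<^bsub>C\<^esub> t' = Ide C (onOb E (Dom A k))"
    using E_dense_iso[of "onOb E (Dom A k)"] k' by auto
  obtain l where l: "l \<in> Arr A" "Dom A l = u" "Cod A l = Dom A f" "onArr E l = onArr E k \<cdot>\<^bsub>C\<^esub> t"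
    using E_surj[of "onArr E k \<cdot>\<^bsub>C\<^esub> t" u "Dom A f"] t k' f' by auto
  have "is_kernel C (onArr E f) (onArr E k \<cdot>\<^bsub>C\<^esub> t)"
    by (rule C.kernel_comp_iso[OF LE.right_adjoint_kernel[OF k] t(2)]) (use t k' in auto)
  then have "is_kernel C (onArr E f) (onArr E l)" unfolding l(4) .
  then have "is_kernel (A \<restriction>\<^sub>C S) f l"
    by (rule reflect_kernel) (use l f' t in auto)
  then show ?thesis ..
qed

text \<open>Monicity must be tested on all objects of \<open>C\<close>. Precomposing with an
  isomorphism from some \<open>E v\<close> turns the test arrows into values of \<open>E\<close>,
  which lift to arrows of \<open>S\<close>.\<close>

lemma E_mono:
  assumes k: "mono_arr (A \<restriction>\<^sub>C S) k"
  shows "mono_arr C (onArr E k)"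
proof (rule C.mono_arrI)
  have arr: "k \<in> Arr A" "Dom A k \<in> S" "Cod A k \<in> S"
    using mono_arr_in_Arr[OF k] by auto
  show "onArr E k \<in> Arr C" using arr by simp
  fix g h
  assume gh: "g \<in> Arr C" "h \<in> Arr C" "Dom C g = Dom C h" "Cod C g = Dom C (onArr E k)"
    "Cod C h = Dom C (onArr E k)" "onArr E k \<cdot>\<^bsub>C\<^esub> g = onArr E k \<cdot>\<^bsub>C\<^esub> h"
  obtain v t where t: "v \<in> S" "iso_arr C t" "t \<in> Arr C" "Dom C t = onOb E v" "Cod C t = Dom C h"
    using E_dense_iso[of "Dom C h"] gh(2) C.Dom_in_Ob by metis
  obtain g' where g': "g' \<in> Arr A" "Dom A g' = v" "Cod A g' = Dom A k" "onArr E g' = g \<cdot>\<^bsub>C\<^esub> t"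
    using E_surj[of "g \<cdot>\<^bsub>C\<^esub> t" v "Dom A k"] gh(1-5) t arr by auto
  obtain h' where h': "h' \<in> Arr A" "Dom A h' = v" "Cod A h' = Dom A k" "onArr E h' = h \<cdot>\<^bsub>C\<^esub> t"
    using E_surj[of "h \<cdot>\<^bsub>C\<^esub> t" v "Dom A k"] gh(1-5) t arr by auto
  have "k \<cdot>\<^bsub>A\<^esub> g' = k \<cdot>\<^bsub>A\<^esub> h'"
    by (rule E_inj) (use g' h' arr t gh(1-5) C.Comp_reassoc[OF gh(6), of t] in auto)
  with g' h' arr t have "g' = h'"
    by - (rule category.mono_arrD[OF preadditive_category.axioms(1)[OF preadditive_S] k], auto)
  then have "g \<cdot>\<^bsub>C\<^esub> t = h \<cdot>\<^bsub>C\<^esub> t" using g'(4) h'(4) by simp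
  then show "g = h"
    by (rule C.epi_arrD[OF C.iso_epi[OF t(2)]]) (use gh(1-5) t in auto)
qed

text \<open>
  The kernel of \<open>k\<close> in \<open>A\<close> is killed by \<open>E\<close>, so \<open>E\<close> turns the epi part of the image factorisation
  of \<open>k\<close> into an isomorphism. Hence \<open>E k\<close> is a kernel of \<open>E\<close> applied to the cokernel of \<open>k\<close>.
\<close>

lemma mono_normal_S:
  assumes k: "mono_arr (A \<restriction>\<^sub>C S) k"
  shows "\<exists>f. is_kernel (A \<restriction>\<^sub>C S) f k"
proof -
  have arr: "k \<in> Arr A" "Dom A k \<in> S" "Cod A k \<in> S"
    using mono_arr_in_Arr[OF k] by auto
  obtain q where q: "is_cokernel A k q" using A.ex_cokernel arr(1) by blast
  note q' = A.is_cokernelD[OF q]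
  obtain i where i: "is_kernel A q i" using A.ex_kernel q' by blast
  note i' = A.is_kernelD[OF i]
  obtain p where p: "p \<in> Arr A" "Dom A p = Dom A k" "Cod A p = Dom A i" "i \<cdot>\<^bsub>A\<^esub> p = k"
    using A.kernel_factor[OF i, of k] q' by auto
  have "image_factorisation A k (Dom A i) p i"
    unfolding image_factorisation_def using p q' i' q i by auto
  then have p_epi: "epi_arr A p" by (rule A.image_factorisation_epi)
  obtain j where j: "is_kernel A p j" using A.ex_kernel p(1) by blast
  note j' = A.is_kernelD[OF j]
  have Ek: "onArr E i \<cdot>\<^bsub>C\<^esub> onArr E p = onArr E k"
    using LE.G.onArr_Comp_arr[of p i] p i' by simp
  have "onArr E p \<cdot>\<^bsub>C\<^esub> onArr E j = Zero C (onOb E (Dom A j)) (onOb E (Cod A p))"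
    using LE.G.onArr_Comp_arr[of j p] j' p(1) by (simp add: LE.right_adjoint_Zero)
  then have "onArr E k \<cdot>\<^bsub>C\<^esub> onArr E j = Zero C (Dom C (onArr E j)) (Cod C (onArr E k))"
    unfolding Ek[symmetric] using i' p(1-3) j' q'(3) by simp
  then have "onArr E j = Zero C (onOb E (Dom A j)) (onOb E (Dom A p))"
    using C.mono_arrD_Zero[OF E_mono[OF k], of "onArr E j"] j' p arr by simp
  then have "iso_arr C (onArr E p)"
    using C.cokernel_Zero_iso[of "onOb E (Dom A j)" "onOb E (Dom A p)" "onArr E p"]
      ER.left_adjoint_cokernel[OF A.epi_is_cokernel[OF p_epi j]] j' p(1) by simp
  then have "is_kernel C (onArr E q) (onArr E i \<cdot>\<^bsub>C\<^esub> onArr E p)"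
    by (rule C.kernel_comp_iso[OF LE.right_adjoint_kernel[OF i]]) (use i' p in auto)
  then have ker: "is_kernel C (onArr E q) (onArr E k)" unfolding Ek .
  \<comment> \<open>The cokernel object may lie outside \<open>S\<close>, so the target of
    \<open>E q\<close> is moved to some \<open>E v\<close>; the isomorphism \<open>t'\<close> does
    not change the kernel.\<close>
  obtain v t t' where t: "v \<in> S" "iso_arr C t" "t \<in> Arr C" "Dom C t = onOb E v" "Cod C t = onOb E (Cod A q)"
    "t' \<in> Arr C" "Dom C t' = onOb E (Cod A q)" "Cod C t' = onOb E v"
    "t' \<cdot>\<^bsub>C\<^esub> t = Ide C (onOb E v)" "t \<cdot>\<^bsub>C\<^esub> t' = Ide C (onOb E (Cod A q))"
    using E_dense_iso[of "onOb E (Cod A q)"] q' by auto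
  have "mono_arr C t'"
    by (rule C.iso_mono[OF C.iso_inverse[OF t(3,6)]]) (use t in auto)
  then have ker': "is_kernel C (t' \<cdot>\<^bsub>C\<^esub> onArr E q) (onArr E k)"
    using ker q' t by (intro C.kernel_mono_comp) auto
  obtain f where f: "f \<in> Arr A" "Dom A f = Cod A k" "Cod A f = v" "onArr E f = t' \<cdot>\<^bsub>C\<^esub> onArr E q"
    using E_surj[of "t' \<cdot>\<^bsub>C\<^esub> onArr E q" "Cod A k" v] t q' arr by auto
  have "is_kernel (A \<restriction>\<^sub>C S) f k"
    by (rule reflect_kernel[OF ker'[folded f(4)]]) (use f arr t in auto)
  then show ?thesis ..
qed

text \<open>The equation between identity and zero arrow passes from \<open>z\<close> to
  \<open>E z\<close>, along an isomorphism to some \<open>E u\<close>, and back to \<open>u\<close>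
  by faithfulness.\<close>

lemma ex_zero_object_S: "\<exists>z. zero_object (A \<restriction>\<^sub>C S) z"
proof -
  obtain z where z: "zero_object A z" using A.ex_zero_object ..
  have z': "z \<in> Ob A" "Ide A z = Zero A z z"
    using A.zero_object_in_Ob[OF z] A.zero_object_Ide[OF z] by auto
  obtain u t t' where t: "u \<in> S" "iso_arr C t" "t \<in> Arr C" "Dom C t = onOb E u" "Cod C t = onOb E z"
    "t' \<in> Arr C" "Dom C t' = onOb E z" "Cod C t' = onOb E u" "t' \<cdot>\<^bsub>C\<^esub> t = Ide C (onOb E u)"
    "t \<cdot>\<^bsub>C\<^esub> t' = Ide C (onOb E z)"
    using E_dense_iso[of "onOb E z"] z' by auto
  have "onArr E (Ide A z) = onArr E (Zero A z z)" using z'(2) by simp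
  then have "Ide C (onOb E z) = Zero C (onOb E z) (onOb E z)"
    using z'(1) by (simp add: LE.right_adjoint_Zero)
  then have "t = Zero C (onOb E u) (onOb E z)"
    using C.Ide_Comp_arr[OF t(3,5)] t z' by simp
  then have "Ide C (onOb E u) = Zero C (onOb E u) (onOb E u)"
    using t(9) t z' by simp
  with t(1) have "onArr E (Ide A u) = onArr E (Zero A u u)"
    by (simp add: LE.right_adjoint_Zero)
  then have "Ide A u = Zero A u u"
    by (rule E_inj) (use t(1) in auto)
  then show ?thesis
    using t(1) by (intro exI[of _ u] preadditive_category.zero_objectI[OF preadditive_S]) auto
qed

text \<open>The equations with identities and zero arrows transfer along \<open>E\<close>, which is
  known to preserve both. The sum equation is obtained differently: in \<open>A\<close> it makes
  \<open>i\<close> and \<open>j\<close> jointly epic, \<open>E\<close> preserves this, and so the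
  sum equation for the lifted arrows may be tested after \<open>i'\<close> and
  \<open>j'\<close>.\<close>

lemma ex_biproduct_S:
  assumes xy: "x \<in> S" "y \<in> S"
  shows "\<exists>s \<in> S. \<exists>i j p q. biproduct (A \<restriction>\<^sub>C S) x y s i j p q"
proof -
  obtain m i j p q where m: "m \<in> Ob A" and bi: "biproduct A x y m i j p q"
    using A.ex_biproduct[of x y] xy by auto
  have i: "i \<in> Arr A" "Dom A i = x" "Cod A i = m" and j: "j \<in> Arr A" "Dom A j = y" "Cod A j = m"
    and p: "p \<in> Arr A" "Dom A p = m" "Cod A p = x" and q: "q \<in> Arr A" "Dom A q = m" "Cod A q = y"
    and eq: "p \<cdot>\<^bsub>A\<^esub> i = Ide A x" "q \<cdot>\<^bsub>A\<^esub> j = Ide A y" "p \<cdot>\<^bsub>A\<^esub> j = Zero A y x" "q \<cdot>\<^bsub>A\<^esub> i = Zero A x y"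
    and sum: "(i \<cdot>\<^bsub>A\<^esub> p) \<boxplus>\<^bsub>A\<^esub> (j \<cdot>\<^bsub>A\<^esub> q) = Ide A m"
    using bi by (auto simp: biproduct_def)
  have Eeq: "onArr E p \<cdot>\<^bsub>C\<^esub> onArr E i = Ide C (onOb E x)" "onArr E q \<cdot>\<^bsub>C\<^esub> onArr E j = Ide C (onOb E y)"
    "onArr E p \<cdot>\<^bsub>C\<^esub> onArr E j = Zero C (onOb E y) (onOb E x)"
    "onArr E q \<cdot>\<^bsub>C\<^esub> onArr E i = Zero C (onOb E x) (onOb E y)"
    using LE.G.onArr_Comp_arr[of i p] LE.G.onArr_Comp_arr[of j q] LE.G.onArr_Comp_arr[of j p]
      LE.G.onArr_Comp_arr[of i q] i j p q eq xy by (simp_all add: LE.right_adjoint_Zero)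
  have joint: "f = g"
    if fg: "f \<in> Arr A" "g \<in> Arr A" "Dom A f = m" "Dom A g = m" "Cod A f = Cod A g"
      "f \<cdot>\<^bsub>A\<^esub> i = g \<cdot>\<^bsub>A\<^esub> i" "f \<cdot>\<^bsub>A\<^esub> j = g \<cdot>\<^bsub>A\<^esub> j" for f g
  proof -
    have decomp: "h = ((h \<cdot>\<^bsub>A\<^esub> i) \<cdot>\<^bsub>A\<^esub> p) \<boxplus>\<^bsub>A\<^esub> ((h \<cdot>\<^bsub>A\<^esub> j) \<cdot>\<^bsub>A\<^esub> q)"
      if h: "h \<in> Arr A" "Dom A h = m" for h
    proof -
      have "h = h \<cdot>\<^bsub>A\<^esub> ((i \<cdot>\<^bsub>A\<^esub> p) \<boxplus>\<^bsub>A\<^esub> (j \<cdot>\<^bsub>A\<^esub> q))"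
        unfolding sum using h by simp
      also have "\<dots> = (h \<cdot>\<^bsub>A\<^esub> (i \<cdot>\<^bsub>A\<^esub> p)) \<boxplus>\<^bsub>A\<^esub> (h \<cdot>\<^bsub>A\<^esub> (j \<cdot>\<^bsub>A\<^esub> q))"
        by (rule A.Comp_Add[of _ m m _ _ "Cod A h"]) (use h i j p q in auto)
      finally show ?thesis using h i j p q by simp
    qed
    show ?thesis
      using decomp[OF fg(1,3)] decomp[OF fg(2,4)] unfolding fg(6,7) by simp
  qed
  obtain u t t' where t: "u \<in> S" "iso_arr C t" "t \<in> Arr C" "Dom C t = onOb E u" "Cod C t = onOb E m"
    "t' \<in> Arr C" "Dom C t' = onOb E m" "Cod C t' = onOb E u"
    "t' \<cdot>\<^bsub>C\<^esub> t = Ide C (onOb E u)" "t \<cdot>\<^bsub>C\<^esub> t' = Ide C (onOb E m)"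
    using E_dense_iso[of "onOb E m"] m by auto
  obtain i' where i': "i' \<in> Arr A" "Dom A i' = x" "Cod A i' = u" "onArr E i' = t' \<cdot>\<^bsub>C\<^esub> onArr E i"
    using E_surj[of "t' \<cdot>\<^bsub>C\<^esub> onArr E i" x u] t i xy by auto
  obtain j' where j': "j' \<in> Arr A" "Dom A j' = y" "Cod A j' = u" "onArr E j' = t' \<cdot>\<^bsub>C\<^esub> onArr E j"
    using E_surj[of "t' \<cdot>\<^bsub>C\<^esub> onArr E j" y u] t j xy by auto
  obtain p' where p': "p' \<in> Arr A" "Dom A p' = u" "Cod A p' = x" "onArr E p' = onArr E p \<cdot>\<^bsub>C\<^esub> t"
    using E_surj[of "onArr E p \<cdot>\<^bsub>C\<^esub> t" u x] t p xy by auto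
  obtain q' where q': "q' \<in> Arr A" "Dom A q' = u" "Cod A q' = y" "onArr E q' = onArr E q \<cdot>\<^bsub>C\<^esub> t"
    using E_surj[of "onArr E q \<cdot>\<^bsub>C\<^esub> t" u y] t q xy by auto
  have t'_epi: "epi_arr C t'"
    by (rule C.iso_epi[OF C.iso_inverse[OF t(3,6)]]) (use t in auto)
  note t_assoc = C.Comp_reassoc[OF t(10)]
  have eq': "p' \<cdot>\<^bsub>A\<^esub> i' = Ide A x" "q' \<cdot>\<^bsub>A\<^esub> j' = Ide A y" "p' \<cdot>\<^bsub>A\<^esub> j' = Zero A y x" "q' \<cdot>\<^bsub>A\<^esub> i' = Zero A x y"
    by (rule E_inj; use i i' j j' p p' q q' t xy Eeq t_assoc in \<open>simp add: LE.right_adjoint_Zero\<close>)+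
  have joint': "f = g"
    if fg: "f \<in> Arr A" "g \<in> Arr A" "Dom A f = u" "Dom A g = u" "Cod A f = Cod A g" "Cod A g \<in> S"
      "f \<cdot>\<^bsub>A\<^esub> i' = g \<cdot>\<^bsub>A\<^esub> i'" "f \<cdot>\<^bsub>A\<^esub> j' = g \<cdot>\<^bsub>A\<^esub> j'" for f g
  proof -
    have "onArr E (f \<cdot>\<^bsub>A\<^esub> i') = onArr E (g \<cdot>\<^bsub>A\<^esub> i')" "onArr E (f \<cdot>\<^bsub>A\<^esub> j') = onArr E (g \<cdot>\<^bsub>A\<^esub> j')"
      using fg(7,8) by simp_all
    then have 1: "onArr E f \<cdot>\<^bsub>C\<^esub> (t' \<cdot>\<^bsub>C\<^esub> onArr E i) = onArr E g \<cdot>\<^bsub>C\<^esub> (t' \<cdot>\<^bsub>C\<^esub> onArr E i)"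
      "onArr E f \<cdot>\<^bsub>C\<^esub> (t' \<cdot>\<^bsub>C\<^esub> onArr E j) = onArr E g \<cdot>\<^bsub>C\<^esub> (t' \<cdot>\<^bsub>C\<^esub> onArr E j)"
      using fg(1-4) i' j' by simp_all
    \<comment> \<open>Here \<open>E\<close> acts as the left adjoint of \<open>R\<close>, so
      \<open>E i\<close> and \<open>E j\<close> are jointly epic.\<close>
    have "onArr E f \<cdot>\<^bsub>C\<^esub> t' = onArr E g \<cdot>\<^bsub>C\<^esub> t'"
      by (rule ER.left_adjoint_joint_epi[OF joint i(1) j(1) i(3) j(3)])
        (use fg(1-5) t i j 1 in simp_all)
    then have "onArr E f = onArr E g"
      by (rule C.epi_arrD[OF t'_epi]) (use t fg(1-5) in auto)
    then show ?thesis by (rule E_inj) (use fg t in auto)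
  qed
  have sum': "(i' \<cdot>\<^bsub>A\<^esub> p') \<boxplus>\<^bsub>A\<^esub> (j' \<cdot>\<^bsub>A\<^esub> q') = Ide A u"
  proof (rule joint')
    have ob: "u \<in> Ob A" "x \<in> Ob A" "y \<in> Ob A" using t(1) xy by auto
    show "((i' \<cdot>\<^bsub>A\<^esub> p') \<boxplus>\<^bsub>A\<^esub> (j' \<cdot>\<^bsub>A\<^esub> q')) \<cdot>\<^bsub>A\<^esub> i' = Ide A u \<cdot>\<^bsub>A\<^esub> i'"
      using A.Add_Comp[of i' x u "i' \<cdot>\<^bsub>A\<^esub> p'" u "j' \<cdot>\<^bsub>A\<^esub> q'"] i' j' p' q' eq' ob by simp
    show "((i' \<cdot>\<^bsub>A\<^esub> p') \<boxplus>\<^bsub>A\<^esub> (j' \<cdot>\<^bsub>A\<^esub> q')) \<cdot>\<^bsub>A\<^esub> j' = Ide A u \<cdot>\<^bsub>A\<^esub> j'"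
      using A.Add_Comp[of j' y u "i' \<cdot>\<^bsub>A\<^esub> p'" u "j' \<cdot>\<^bsub>A\<^esub> q'"] i' j' p' q' eq' ob by simp
  qed (use i' j' p' q' t(1) in auto)
  have "biproduct (A \<restriction>\<^sub>C S) x y u i' j' p' q'"
    unfolding biproduct_def using i' j' p' q' eq' sum' t(1) xy by simp
  then show ?thesis using t(1) by blast
qed

lemma abelian_S: "abelian_category (A \<restriction>\<^sub>C S)"
proof -
  interpret D: equivalent_subcategory "dual A" "dual C" R E L \<epsilon>R \<eta>R \<epsilon>L \<eta>L S
    by (rule equivalent_subcategory_dual)
  show ?thesis
  proof (intro abelian_category.intro additive_category.intro preadditive_S
      additive_category_axioms.intro abelian_category_axioms.intro)
    show "\<exists>z. zero_object (A \<restriction>\<^sub>C S) z" by (rule ex_zero_object_S)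
    show "\<exists>s\<in>Ob (A \<restriction>\<^sub>C S). \<exists>i j p q. biproduct (A \<restriction>\<^sub>C S) x y s i j p q"
      if "x \<in> Ob (A \<restriction>\<^sub>C S)" "y \<in> Ob (A \<restriction>\<^sub>C S)" for x y
      using ex_biproduct_S[of x y] that by simp
    fix f
    show "\<exists>k. is_kernel (A \<restriction>\<^sub>C S) f k" if "f \<in> Arr (A \<restriction>\<^sub>C S)"
      using that by (rule ex_kernel_S)
    show "\<exists>q. is_cokernel (A \<restriction>\<^sub>C S) f q" if "f \<in> Arr (A \<restriction>\<^sub>C S)"
      using D.ex_kernel_S[of f] that by (auto simp: full_subcat_dual)
    show "\<exists>g. is_kernel (A \<restriction>\<^sub>C S) g f" if "mono_arr (A \<restriction>\<^sub>C S) f"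
      using that by (rule mono_normal_S)
    show "\<exists>g. is_cokernel (A \<restriction>\<^sub>C S) g f" if "epi_arr (A \<restriction>\<^sub>C S) f"
      using D.mono_normal_S[of f] that by (auto simp: full_subcat_dual)
  qed
qed

end

section \<open>The three embeddings of \<open>C\<close>\<close>

lemma fully_faithful_dual: "fully_faithful (dual C) (dual D) F \<longleftrightarrow> fully_faithful C D F"
proof -
  have "is_functor (dual C) (dual D) F \<longleftrightarrow> is_functor C D F"
    using is_functor.is_functor_dual[of C D F] is_functor.is_functor_dual[of "dual C" "dual D" F]
    by auto
  then show ?thesis
    unfolding fully_faithful_def by (auto simp: Hom_dual simp del: Hom_iff)
qed

lemma (in category) essential_image_dual:
  "essential_image (dual B) (dual C) F = essential_image B C F"
  by (auto simp: essential_image_def isomorphic_dual)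

text \<open>Through the natural isomorphism \<open>\<theta>\<close> the composite of
  \<open>E\<close> after \<open>F\<close> is isomorphic to the identity. As \<open>E\<close> is
  bijective on hom-sets of the image of \<open>F\<close>, the functor \<open>F\<close> is fully
  faithful and \<open>E\<close> is dense on that image.\<close>

lemma (in adjoint_triple) fully_faithful_section:
  assumes F: "is_functor C A F"
    and iso: "\<And>x. x \<in> Ob C \<Longrightarrow> iso_arr C (\<theta> x)"
    and \<theta>: "\<And>x. x \<in> Ob C \<Longrightarrow> \<theta> x \<in> Arr C \<and> Dom C (\<theta> x) = x \<and> Cod C (\<theta> x) = onOb E (onOb F x)"
    and nat: "\<And>f. f \<in> Arr C
      \<Longrightarrow> \<theta> (Cod C f) \<cdot>\<^bsub>C\<^esub> f = onArr E (onArr F f) \<cdot>\<^bsub>C\<^esub> \<theta> (Dom C f)"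
    and bij: "\<And>s t. s \<in> essential_image C A F \<Longrightarrow> t \<in> essential_image C A F
      \<Longrightarrow> bij_betw (onArr E) (Hom A s t) (Hom C (onOb E s) (onOb E t))"
  shows "fully_faithful C A F"
    and "equivalent_subcategory A C L E R \<eta>L \<epsilon>L \<eta>R \<epsilon>R (essential_image C A F)"
proof -
  interpret F: is_functor C A F by (rule F)
  have F_image: "onOb F x \<in> essential_image C A F" if "x \<in> Ob C" for x
  proof -
    have "isomorphic A (onOb F x) (onOb F x)"
      by (rule A.isomorphicI[OF A.iso_Ide[of "onOb F x"]]) (use that in auto)
    then show ?thesis using that by (auto simp: essential_image_def)
  qed
  have "bij_betw (onArr F) (Hom C x y) (Hom A (onOb F x) (onOb F y))" if xy: "x \<in> Ob C" "y \<in> Ob C" for x y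
  proof (rule bij_betw_imageI)
    note bij_xy = bij[OF F_image[OF xy(1)] F_image[OF xy(2)]]
    show "inj_on (onArr F) (Hom C x y)"
    proof (rule inj_onI)
      fix f g assume fg: "f \<in> Hom C x y" "g \<in> Hom C x y" "onArr F f = onArr F g"
      then have "\<theta> y \<cdot>\<^bsub>C\<^esub> f = \<theta> y \<cdot>\<^bsub>C\<^esub> g"
        using nat[of f] nat[of g] by simp
      then show "f = g"
        by (rule C.mono_arrD[OF C.iso_mono[OF iso[OF xy(2)]]]) (use fg(1,2) \<theta>[OF xy(2)] in auto)
    qed
    show "onArr F ` Hom C x y = Hom A (onOb F x) (onOb F y)"
    proof
      show "Hom A (onOb F x) (onOb F y) \<subseteq> onArr F ` Hom C x y"
      proof
        fix g assume g: "g \<in> Hom A (onOb F x) (onOb F y)"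
        obtain \<theta>' where \<theta>': "\<theta>' \<in> Arr C" "Dom C \<theta>' = onOb E (onOb F y)" "Cod C \<theta>' = y"
          "\<theta> y \<cdot>\<^bsub>C\<^esub> \<theta>' = Ide C (onOb E (onOb F y))"
          using iso[OF xy(2)] \<theta>[OF xy(2)] by (elim C.iso_arrE) auto
        \<comment> \<open>The only candidate for a preimage of \<open>g\<close>: the conjugate of
          \<open>E g\<close> by \<open>\<theta>\<close>. It makes \<open>E (F h)\<close> equal to
          \<open>E g\<close>.\<close>
        define h where "h = \<theta>' \<cdot>\<^bsub>C\<^esub> (onArr E g \<cdot>\<^bsub>C\<^esub> \<theta> x)"
        have h: "h \<in> Arr C" "Dom C h = x" "Cod C h = y"
          unfolding h_def using g \<theta>' \<theta>[OF xy(1)] by auto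
        have "\<theta> y \<cdot>\<^bsub>C\<^esub> h = onArr E g \<cdot>\<^bsub>C\<^esub> \<theta> x"
          unfolding h_def using C.Comp_reassoc[OF \<theta>'(4), of "onArr E g \<cdot>\<^bsub>C\<^esub> \<theta> x"] g \<theta>' xy \<theta>[OF xy(1)] \<theta>[OF xy(2)]
          by simp
        then have "onArr E (onArr F h) \<cdot>\<^bsub>C\<^esub> \<theta> x = onArr E g \<cdot>\<^bsub>C\<^esub> \<theta> x"
          using nat[OF h(1)] h by simp
        then have "onArr E (onArr F h) = onArr E g"
          by (rule C.epi_arrD[OF C.iso_epi[OF iso[OF xy(1)]]]) (use h g \<theta>[OF xy(1)] in auto)
        then have "onArr F h = g"
          by (rule inj_onD[OF bij_betw_imp_inj_on[OF bij_xy]]) (use h g in auto)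
        then show "g \<in> onArr F ` Hom C x y" using h by auto
      qed
    qed auto
  qed
  then show "fully_faithful C A F" unfolding fully_faithful_def using F by blast
  show "equivalent_subcategory A C L E R \<eta>L \<epsilon>L \<eta>R \<epsilon>R (essential_image C A F)"
  proof (intro equivalent_subcategory.intro adjoint_triple_axioms equivalent_subcategory_axioms.intro bij)
    show "essential_image C A F \<subseteq> Ob A" by (auto simp: essential_image_def)
    fix x assume x: "x \<in> Ob C"
    have "isomorphic C x (onOb E (onOb F x))"
      using iso[OF x] \<theta>[OF x] by (intro C.isomorphicI) auto
    then show "\<exists>s\<in>essential_image C A F. isomorphic C (onOb E s) x"
      using F_image[OF x] C.isomorphic_sym by blast
  qed
qed

section \<open>The embeddings by \<open>L\<close> and \<open>R\<close>, and the norm\<close>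

context ff_adjoint_triple
begin

text \<open>An invertible counit is itself an isomorphism from \<open>L (E s)\<close> to
  \<open>s\<close>; conversely the counit is invertible at each \<open>L x\<close>, and this is
  invariant under isomorphism.\<close>

lemma essential_image_L: "essential_image C A L = {s \<in> Ob A. iso_arr A (\<epsilon>L s)}"
proof
  show "essential_image C A L \<subseteq> {s \<in> Ob A. iso_arr A (\<epsilon>L s)}"
  proof
    fix s assume "s \<in> essential_image C A L"
    then obtain x where s: "s \<in> Ob A" and x: "x \<in> Ob C" "isomorphic A (onOb L x) s"
      by (auto simp: essential_image_def)
    from x(2) obtain f where f: "iso_arr A f" "Dom A f = onOb L x" "Cod A f = s"
      by (rule A.isomorphicE)
    then show "s \<in> {s \<in> Ob A. iso_arr A (\<epsilon>L s)}"
      using counit_iso_of_iso[of f] counit_L_iso[OF x(1)] s by simp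
  qed
  show "{s \<in> Ob A. iso_arr A (\<epsilon>L s)} \<subseteq> essential_image C A L"
  proof
    fix s assume "s \<in> {s \<in> Ob A. iso_arr A (\<epsilon>L s)}"
    then have "s \<in> Ob A" "isomorphic A (onOb L (onOb E s)) s"
      by (auto intro: A.isomorphicI)
    then show "s \<in> essential_image C A L"
      unfolding essential_image_def by (auto intro!: bexI[of _ "onOb E s"])
  qed
qed

lemma L_embedding:
  shows L_fully_faithful: "fully_faithful C A L"
    and L_abelian: "abelian_category (A \<restriction>\<^sub>C essential_image C A L)"
proof -
  note L = fully_faithful_section[of L \<eta>L, OF LE.F.is_functor_axioms unit_iso]
  show "fully_faithful C A L"
    by (rule L) (auto simp: LE.unit_natural essential_image_L intro: E_bij_counit_iso simp del: Hom_iff)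
  have "equivalent_subcategory A C L E R \<eta>L \<epsilon>L \<eta>R \<epsilon>R (essential_image C A L)"
    by (rule L) (auto simp: LE.unit_natural essential_image_L intro: E_bij_counit_iso simp del: Hom_iff)
  then show "abelian_category (A \<restriction>\<^sub>C essential_image C A L)"
    by (rule equivalent_subcategory.abelian_S)
qed

lemma L_extension:
  assumes "short_exact A i p" "Dom A i \<in> essential_image C A L" "Cod A p \<in> essential_image C A L"
  shows "Cod A i \<in> essential_image C A L"
proof -
  have "i \<in> Arr A" using assms(1) by (simp add: short_exact_def is_cokernel_def)
  then show ?thesis
    using assms counit_iso_extension unfolding essential_image_L by simp
qed

lemma R_embedding:
  shows R_fully_faithful: "fully_faithful C A R"
    and R_abelian: "abelian_category (A \<restriction>\<^sub>C essential_image C A R)"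
proof -
  interpret D: ff_adjoint_triple "dual A" "dual C" R E L \<epsilon>R \<eta>R \<epsilon>L \<eta>L
    by (rule ff_adjoint_triple_dual)
  show "fully_faithful C A R"
    using D.L_fully_faithful by (simp add: fully_faithful_dual)
  show "abelian_category (A \<restriction>\<^sub>C essential_image C A R)"
    using abelian_category_dual[OF D.L_abelian] by (simp add: full_subcat_dual A.essential_image_dual)
qed

lemma R_extension:
  assumes "short_exact A i p" "Dom A i \<in> essential_image C A R" "Cod A p \<in> essential_image C A R"
  shows "Cod A i \<in> essential_image C A R"
proof -
  \<comment> \<open>In the opposite category the sequence begins with \<open>p\<close>, and its
    middle object is named as the domain of \<open>p\<close>.\<close>
  have "Cod A i = Dom A p" using assms(1) by (simp add: short_exact_def is_cokernel_def)
  then show ?thesis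
    using ff_adjoint_triple.L_extension[OF ff_adjoint_triple_dual, of p i] assms
    by (simp add: A.essential_image_dual)
qed

lemma norm_map:
  assumes "y \<in> Ob C"
  shows "norm_map A C L E R \<eta>L \<epsilon>R y \<in> Arr A"
    and "Dom A (norm_map A C L E R \<eta>L \<epsilon>R y) = onOb L y"
    and "Cod A (norm_map A C L E R \<eta>L \<epsilon>R y) = onOb R y"
    and "\<epsilon>R y \<cdot>\<^bsub>C\<^esub> (onArr E (norm_map A C L E R \<eta>L \<epsilon>R y) \<cdot>\<^bsub>C\<^esub> \<eta>L y) = Ide C y"
proof -
  obtain t where t: "t \<in> Arr C" "Dom C t = onOb E (onOb L y)" "Cod C t = y"
    "t \<cdot>\<^bsub>C\<^esub> \<eta>L y = Ide C y"
    using unit_iso[OF assms] assms by (elim C.iso_arrE) auto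
  \<comment> \<open>Existence of the norm: the inverse of the unit at \<open>y\<close>, transposed
    along \<open>E\<close> and \<open>R\<close>.\<close>
  define n where "n = onArr R t \<cdot>\<^bsub>A\<^esub> \<eta>R (onOb L y)"
  have n: "n \<in> Hom A (onOb L y) (onOb R y)"
    unfolding n_def using t assms by auto
  have "\<epsilon>R y \<cdot>\<^bsub>C\<^esub> onArr E n = t"
    unfolding n_def using ER.transpose_transpose[of t "onOb L y"] t assms by simp
  then have n_eq: "\<epsilon>R y \<cdot>\<^bsub>C\<^esub> onArr E n \<cdot>\<^bsub>C\<^esub> \<eta>L y = Ide C y"
    using t by simp
  have "norm_map A C L E R \<eta>L \<epsilon>R y \<in> Hom A (onOb L y) (onOb R y) \<and>
      \<epsilon>R y \<cdot>\<^bsub>C\<^esub> onArr E (norm_map A C L E R \<eta>L \<epsilon>R y) \<cdot>\<^bsub>C\<^esub> \<eta>L y = Ide C y"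
    unfolding norm_map_def
  proof (rule theI[of _ n])
    fix m assume m: "m \<in> Hom A (onOb L y) (onOb R y) \<and> \<epsilon>R y \<cdot>\<^bsub>C\<^esub> onArr E m \<cdot>\<^bsub>C\<^esub> \<eta>L y = Ide C y"
    show "m = n"
      by (rule norm_inj[of y m y n]) (use m n n_eq assms in auto)
  qed (use n n_eq in blast)
  then show "norm_map A C L E R \<eta>L \<epsilon>R y \<in> Arr A"
    "Dom A (norm_map A C L E R \<eta>L \<epsilon>R y) = onOb L y"
    "Cod A (norm_map A C L E R \<eta>L \<epsilon>R y) = onOb R y"
    "\<epsilon>R y \<cdot>\<^bsub>C\<^esub> (onArr E (norm_map A C L E R \<eta>L \<epsilon>R y) \<cdot>\<^bsub>C\<^esub> \<eta>L y) = Ide C y"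
    using assms by auto
qed

text \<open>In the equation that defines the norm, \<open>\<epsilon>R\<close> cancels
  \<open>E (\<eta>R s)\<close> and \<open>E (\<epsilon>L s)\<close> cancels \<open>\<eta>L\<close>,
  one triangle identity from each adjunction.\<close>

lemma norm_map_E:
  assumes "s \<in> Ob A"
  shows "norm_map A C L E R \<eta>L \<epsilon>R (onOb E s) = \<eta>R s \<cdot>\<^bsub>A\<^esub> \<epsilon>L s"
proof (rule norm_inj[of "onOb E s" _ "onOb E s"])
  have Es: "onOb E s \<in> Ob C" using assms by simp
  note n = norm_map[OF Es]
  have "\<epsilon>R (onOb E s) \<cdot>\<^bsub>C\<^esub> (onArr E (\<eta>R s \<cdot>\<^bsub>A\<^esub> \<epsilon>L s) \<cdot>\<^bsub>C\<^esub> \<eta>L (onOb E s)) = Ide C (onOb E s)"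
    using assms by simp
  then show "\<epsilon>R (onOb E s) \<cdot>\<^bsub>C\<^esub> (onArr E (norm_map A C L E R \<eta>L \<epsilon>R (onOb E s)) \<cdot>\<^bsub>C\<^esub> \<eta>L (onOb E s))
      = \<epsilon>R (onOb E s) \<cdot>\<^bsub>C\<^esub> (onArr E (\<eta>R s \<cdot>\<^bsub>A\<^esub> \<epsilon>L s) \<cdot>\<^bsub>C\<^esub> \<eta>L (onOb E s))"
    using n(4) by simp
qed (use assms norm_map[of "onOb E s"] in auto)

end

section \<open>The intermediate extension\<close>

locale intermediate_extension_functor = ff_adjoint_triple A C L E R \<eta>L \<epsilon>L \<eta>R \<epsilon>R
  for A :: "('p, 'n) precat" and C :: "('o, 'm) precat" and L E R \<eta>L \<epsilon>L \<eta>R \<epsilon>R +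
  fixes I :: "('o, 'm, 'p, 'n) ftor" and \<pi> \<iota> :: "'o \<Rightarrow> 'n"
  assumes intermediate: "intermediate_extension A C L E R \<eta>L \<epsilon>R I \<pi> \<iota>"
begin

abbreviation norm :: "'o \<Rightarrow> 'n" where
  "norm \<equiv> norm_map A C L E R \<eta>L \<epsilon>R"

lemma image_norm:
  assumes "x \<in> Ob C"
  shows "\<pi> x \<in> Arr A" "Dom A (\<pi> x) = onOb L x" "Cod A (\<pi> x) = onOb I x"
    "\<iota> x \<in> Arr A" "Dom A (\<iota> x) = onOb I x" "Cod A (\<iota> x) = onOb R x"
    "\<iota> x \<cdot>\<^bsub>A\<^esub> \<pi> x = norm x" "epi_arr A (\<pi> x)" "mono_arr A (\<iota> x)"
proof -
  have im: "image_factorisation A (norm x) (onOb I x) (\<pi> x) (\<iota> x)"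
    using intermediate assms by (simp add: intermediate_extension_def)
  then show "\<pi> x \<in> Arr A" "Dom A (\<pi> x) = onOb L x" "Cod A (\<pi> x) = onOb I x"
    "\<iota> x \<in> Arr A" "Dom A (\<iota> x) = onOb I x" "Cod A (\<iota> x) = onOb R x"
    "\<iota> x \<cdot>\<^bsub>A\<^esub> \<pi> x = norm x"
    using norm_map[OF assms] by (auto simp: image_factorisation_def)
  show "epi_arr A (\<pi> x)" using im by (rule A.image_factorisation_epi)
  show "mono_arr A (\<iota> x)" using im A.kernel_mono by (auto simp: image_factorisation_def)
qed

lemma I_arr:
  assumes "f \<in> Arr C"
  shows "onArr I f \<in> Arr A" "Dom A (onArr I f) = onOb I (Dom C f)" "Cod A (onArr I f) = onOb I (Cod C f)"
    "onArr I f \<cdot>\<^bsub>A\<^esub> \<pi> (Dom C f) = \<pi> (Cod C f) \<cdot>\<^bsub>A\<^esub> onArr L f"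
  using intermediate assms by (auto simp: intermediate_extension_def)

text \<open>The values on arrows are determined by their compatibility with the epimorphisms
  \<open>\<pi>\<close>, so functoriality is inherited from \<open>L\<close>.\<close>

lemma is_functor_I: "is_functor C A I"
proof
  fix x assume x: "x \<in> Ob C"
  note \<pi> = image_norm[OF x]
  show Ix: "onOb I x \<in> Ob A" using A.Cod_in_Ob[OF \<pi>(1)] \<pi>(3) by simp
  have "onArr I (Ide C x) \<cdot>\<^bsub>A\<^esub> \<pi> x = Ide A (onOb I x) \<cdot>\<^bsub>A\<^esub> \<pi> x"
    using I_arr(4)[of "Ide C x"] x \<pi> by simp
  then show "onArr I (Ide C x) = Ide A (onOb I x)"
    by (rule A.epi_arrD[OF \<pi>(8)]) (use \<pi>(1-3) I_arr[of "Ide C x"] x Ix in auto)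
next
  fix f x y assume "f \<in> Hom C x y"
  then show "onArr I f \<in> Hom A (onOb I x) (onOb I y)" using I_arr[of f] by auto
next
  fix f g x y z assume fg: "f \<in> Hom C x y" "g \<in> Hom C y z"
  then have f: "f \<in> Arr C" "Dom C f = x" "Cod C f = y" and g: "g \<in> Arr C" "Dom C g = y" "Cod C g = z"
    and ob: "x \<in> Ob C" "y \<in> Ob C" "z \<in> Ob C" by auto
  note \<pi> = image_norm[OF ob(1)] and \<pi>y = image_norm[OF ob(2)] and \<pi>z = image_norm[OF ob(3)]
  have fg': "g \<cdot>\<^bsub>C\<^esub> f \<in> Arr C" using f g by simp
  have "onArr I (g \<cdot>\<^bsub>C\<^esub> f) \<cdot>\<^bsub>A\<^esub> \<pi> x = (\<pi> z \<cdot>\<^bsub>A\<^esub> onArr L g) \<cdot>\<^bsub>A\<^esub> onArr L f"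
    using I_arr(4)[OF fg'] f g \<pi>z(1-3) by simp
  also have "\<dots> = onArr I g \<cdot>\<^bsub>A\<^esub> (\<pi> y \<cdot>\<^bsub>A\<^esub> onArr L f)"
    using A.Comp_reassoc[OF I_arr(4)[OF g(1)], of "onArr L f"] f g \<pi>y(1-3) \<pi>z(1-3) I_arr(1-3)[OF g(1)] by simp
  also have "\<dots> = (onArr I g \<cdot>\<^bsub>A\<^esub> onArr I f) \<cdot>\<^bsub>A\<^esub> \<pi> x"
    using I_arr[OF f(1)] I_arr(1-3)[OF g(1)] f g \<pi>(1-3) by simp
  finally show "onArr I (g \<cdot>\<^bsub>C\<^esub> f) = onArr I g \<cdot>\<^bsub>A\<^esub> onArr I f"
    by (rule A.epi_arrD[OF \<pi>(8)])
      (use \<pi>(1-3) I_arr(1-3)[OF fg'] I_arr(1-3)[OF f(1)] I_arr(1-3)[OF g(1)] f g in auto)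
qed

text \<open>By the definition of the norm, \<open>\<epsilon>R x\<close> after
  \<open>E (norm x)\<close> is the inverse of the unit. Since \<open>norm x\<close> begins with
  \<open>\<pi> x\<close>, this gives a left inverse of \<open>E (\<pi> x)\<close>, which is epic
  because \<open>E\<close> is a left adjoint.\<close>

lemma E_pi_iso:
  assumes "x \<in> Ob C"
  shows "iso_arr C (onArr E (\<pi> x))"
proof (rule C.epi_split_iso[OF ER.left_adjoint_epi[OF image_norm(8)[OF assms]]])
  note \<pi> = image_norm[OF assms]
  obtain t where t: "t \<in> Arr C" "Dom C t = onOb E (onOb L x)" "Cod C t = x"
    "t \<cdot>\<^bsub>C\<^esub> \<eta>L x = Ide C x" "\<eta>L x \<cdot>\<^bsub>C\<^esub> t = Ide C (onOb E (onOb L x))"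
    using unit_iso[OF assms] assms by (elim C.iso_arrE) auto
  let ?g = "\<eta>L x \<cdot>\<^bsub>C\<^esub> (\<epsilon>R x \<cdot>\<^bsub>C\<^esub> onArr E (\<iota> x))"
  have En: "onArr E (\<iota> x) \<cdot>\<^bsub>C\<^esub> onArr E (\<pi> x) = onArr E (norm x)"
    using \<pi> LE.G.onArr_Comp_arr[of "\<pi> x" "\<iota> x"] by simp
  have "\<epsilon>R x \<cdot>\<^bsub>C\<^esub> onArr E (norm x) = (\<epsilon>R x \<cdot>\<^bsub>C\<^esub> onArr E (norm x)) \<cdot>\<^bsub>C\<^esub> (\<eta>L x \<cdot>\<^bsub>C\<^esub> t)"
    unfolding t(5) using norm_map[OF assms] assms by simp
  also have "\<dots> = (\<epsilon>R x \<cdot>\<^bsub>C\<^esub> (onArr E (norm x) \<cdot>\<^bsub>C\<^esub> \<eta>L x)) \<cdot>\<^bsub>C\<^esub> t"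
    using norm_map(1-3)[OF assms] assms t(1-3) by simp
  also have "\<dots> = t"
    unfolding norm_map(4)[OF assms] using t(1,3) by simp
  finally have "\<epsilon>R x \<cdot>\<^bsub>C\<^esub> (onArr E (\<iota> x) \<cdot>\<^bsub>C\<^esub> onArr E (\<pi> x)) = t"
    unfolding En .
  then show "?g \<cdot>\<^bsub>C\<^esub> onArr E (\<pi> x) = Ide C (Dom C (onArr E (\<pi> x)))"
    using t \<pi> assms by simp
qed (use assms image_norm(1-6)[OF assms] in auto)

text \<open>The image of the norm is a quotient of \<open>L x\<close> and a subobject of
  \<open>R x\<close>, which gives both conditions. Conversely they make
  \<open>\<eta>R s \<cdot> \<epsilon>L s\<close> an epi-mono factorisation of the norm at
  \<open>E s\<close>, and such factorisations are unique up to isomorphism.\<close>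

lemma essential_image_I:
  "essential_image C A I = {s \<in> Ob A. epi_arr A (\<epsilon>L s) \<and> mono_arr A (\<eta>R s)}"
proof
  interpret D: ff_adjoint_triple "dual A" "dual C" R E L \<epsilon>R \<eta>R \<epsilon>L \<eta>L
    by (rule ff_adjoint_triple_dual)
  show "essential_image C A I \<subseteq> {s \<in> Ob A. epi_arr A (\<epsilon>L s) \<and> mono_arr A (\<eta>R s)}"
  proof
    fix s assume "s \<in> essential_image C A I"
    then obtain x where s: "s \<in> Ob A" and x: "x \<in> Ob C" "isomorphic A (onOb I x) s"
      by (auto simp: essential_image_def)
    note \<pi> = image_norm[OF x(1)]
    obtain f where f: "iso_arr A f" "f \<in> Arr A" "Dom A f = onOb I x" "Cod A f = s"
      using x(2) by (rule A.isomorphicE)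
    obtain g where g: "iso_arr A g" "g \<in> Arr A" "Dom A g = s" "Cod A g = onOb I x"
      using A.isomorphic_sym[OF x(2)] by (rule A.isomorphicE)
    have "epi_arr A (f \<cdot>\<^bsub>A\<^esub> \<pi> x)"
      by (rule A.epi_comp[OF \<pi>(8) A.iso_epi[OF f(1)]]) (use \<pi> f in auto)
    then have "epi_arr A (\<epsilon>L s)"
      using counit_epi_of_epi[of "f \<cdot>\<^bsub>A\<^esub> \<pi> x"] A.iso_epi[OF counit_L_iso[OF x(1)]] f \<pi> by simp
    moreover have "mono_arr A (\<iota> x \<cdot>\<^bsub>A\<^esub> g)"
      by (rule A.mono_comp[OF A.iso_mono[OF g(1)] \<pi>(9)]) (use \<pi> g in auto)
    then have "mono_arr A (\<eta>R s)"
      using D.counit_epi_of_epi[of "\<iota> x \<cdot>\<^bsub>A\<^esub> g"] A.iso_mono[of "\<eta>R (onOb R x)"] D.counit_L_iso[of x] x(1) g \<pi>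
      by simp
    ultimately show "s \<in> {s \<in> Ob A. epi_arr A (\<epsilon>L s) \<and> mono_arr A (\<eta>R s)}"
      using s by simp
  qed
  show "{s \<in> Ob A. epi_arr A (\<epsilon>L s) \<and> mono_arr A (\<eta>R s)} \<subseteq> essential_image C A I"
  proof
    fix s assume "s \<in> {s \<in> Ob A. epi_arr A (\<epsilon>L s) \<and> mono_arr A (\<eta>R s)}"
    then have s: "s \<in> Ob A" "epi_arr A (\<epsilon>L s)" "mono_arr A (\<eta>R s)" by auto
    then have Es: "onOb E s \<in> Ob C" by simp
    note \<pi> = image_norm[OF Es]
    have "isomorphic A (Cod A (\<pi> (onOb E s))) (Cod A (\<epsilon>L s))"
      by (rule A.epi_mono_factorisation_unique[of _ "\<iota> (onOb E s)" _ "\<eta>R s"])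
        (use \<pi> s norm_map_E[OF s(1)] in auto)
    then show "s \<in> essential_image C A I"
      using \<pi>(3) s Es by (auto simp: essential_image_def)
  qed
qed

lemma I_embedding:
  shows I_fully_faithful: "fully_faithful C A I"
    and I_abelian: "abelian_category (A \<restriction>\<^sub>C essential_image C A I)"
proof -
  \<comment> \<open>The unit leads from \<open>x\<close> to \<open>E (L x)\<close>, and the
    isomorphism \<open>E (\<pi> x)\<close> continues to \<open>E (I x)\<close>.\<close>
  let ?\<theta> = "\<lambda>x. onArr E (\<pi> x) \<cdot>\<^bsub>C\<^esub> \<eta>L x"
  have iso: "iso_arr C (?\<theta> x)" if x: "x \<in> Ob C" for x
    by (rule C.iso_comp[OF unit_iso[OF x] E_pi_iso[OF x]]) (use x image_norm[OF x] in auto)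
  have arr: "?\<theta> x \<in> Arr C \<and> Dom C (?\<theta> x) = x \<and> Cod C (?\<theta> x) = onOb E (onOb I x)" if "x \<in> Ob C" for x
    using that image_norm[OF that] by auto
  have nat: "?\<theta> (Cod C f) \<cdot>\<^bsub>C\<^esub> f = onArr E (onArr I f) \<cdot>\<^bsub>C\<^esub> ?\<theta> (Dom C f)" if f: "f \<in> Arr C" for f
  proof -
    have ob: "Dom C f \<in> Ob C" "Cod C f \<in> Ob C" using f by auto
    note \<pi> = image_norm(1-3)[OF ob(1)] image_norm(1-3)[OF ob(2)] and If = I_arr[OF f]
    have "?\<theta> (Cod C f) \<cdot>\<^bsub>C\<^esub> f = onArr E (\<pi> (Cod C f) \<cdot>\<^bsub>A\<^esub> onArr L f) \<cdot>\<^bsub>C\<^esub> \<eta>L (Dom C f)"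
      using f \<pi> LE.unit_natural[OF f] by simp
    also have "\<dots> = onArr E (onArr I f \<cdot>\<^bsub>A\<^esub> \<pi> (Dom C f)) \<cdot>\<^bsub>C\<^esub> \<eta>L (Dom C f)"
      unfolding If(4) ..
    also have "\<dots> = onArr E (onArr I f) \<cdot>\<^bsub>C\<^esub> ?\<theta> (Dom C f)"
      using f \<pi> If(1-3) by simp
    finally show ?thesis .
  qed
  have bij: "bij_betw (onArr E) (Hom A s t) (Hom C (onOb E s) (onOb E t))"
    if "s \<in> essential_image C A I" "t \<in> essential_image C A I" for s t
    using that unfolding essential_image_I by (auto intro: E_bij_intermediate simp del: Hom_iff)
  note I = fully_faithful_section[of I ?\<theta>, OF is_functor_I iso arr nat bij]
  show "fully_faithful C A I" by (rule I)
  show "abelian_category (A \<restriction>\<^sub>C essential_image C A I)"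
    by (rule equivalent_subcategory.abelian_S[OF I(2)])
qed

lemma I_extension:
  assumes "short_exact A i p" "Dom A i \<in> essential_image C A I" "Cod A p \<in> essential_image C A I"
  shows "Cod A i \<in> essential_image C A I"
proof -
  interpret D: ff_adjoint_triple "dual A" "dual C" R E L \<epsilon>R \<eta>R \<epsilon>L \<eta>L
    by (rule ff_adjoint_triple_dual)
  have i: "i \<in> Arr A" "Cod A i = Dom A p" using assms(1) by (auto simp: short_exact_def is_cokernel_def)
  then have "mono_arr A (\<eta>R (Cod A i))"
    using D.counit_epi_extension[of p i] assms unfolding essential_image_I by simp
  with i assms counit_epi_extension[of i p] show ?thesis
    unfolding essential_image_I using A.Cod_in_Ob[of i] by auto
qed

end

section \<open>Subcategories of the ambient category\<close>

locale codistinguished_subcategory = category T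
  for T :: "('p, 'n) precat" and \<Delta> :: "('n \<times> 'n \<times> 'n) set" and A :: "'p set" +
  assumes codistinguished: "codistinguished_abelian_subcategory T \<Delta> A"
begin

lemma A_subset: "A \<subseteq> Ob T"
  using codistinguished
  by (simp add: codistinguished_abelian_subcategory_def additive_subcategory_def subcategory_def)

lemma A_iso_closed: "x \<in> A \<Longrightarrow> y \<in> Ob T \<Longrightarrow> isomorphic T x y \<Longrightarrow> y \<in> A"
  using codistinguished
  by (auto simp: codistinguished_abelian_subcategory_def additive_subcategory_def subcategory_def)

lemma abelian_A: "abelian_category (T \<restriction>\<^sub>C A)"
  using codistinguished by (simp add: codistinguished_abelian_subcategory_def)

lemma triangle_short_exact:
  "(f, g, h) \<in> \<Delta> \<Longrightarrow> Dom T f \<in> A \<Longrightarrow> Cod T f \<in> A \<Longrightarrow> Cod T g \<in> A \<Longrightarrow> short_exact (T \<restriction>\<^sub>C A) f g"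
  using codistinguished by (auto simp: codistinguished_abelian_subcategory_def)

text \<open>An object of \<open>T\<close> isomorphic to some \<open>F x\<close> already lies in
  \<open>A\<close>, which is closed under isomorphism.\<close>

lemma essential_image_into_ambient:
  assumes "is_functor C (T \<restriction>\<^sub>C A) F"
  shows "essential_image C T (into_ambient F) = essential_image C (T \<restriction>\<^sub>C A) F"
proof -
  interpret is_functor C "T \<restriction>\<^sub>C A" F by fact
  have "onOb F x \<in> A" if "x \<in> Ob C" for x using onOb[OF that] by simp
  then show ?thesis
    using A_subset A_iso_closed
    by (auto simp: essential_image_def into_ambient_def id_ftor_def comp_ftor_def isomorphic_full_subcat)
qed

text \<open>A triangle with vertices in the essential image is short exact in \<open>A\<close>, and
  kernels and cokernels of \<open>A\<close> between objects of the image keep their universal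
  property there.\<close>

lemma realises_codistinguishedI:
  assumes ff: "fully_faithful C (T \<restriction>\<^sub>C A) F"
    and ab: "abelian_category (T \<restriction>\<^sub>C A \<restriction>\<^sub>C essential_image C (T \<restriction>\<^sub>C A) F)"
  shows "realises_codistinguished T \<Delta> A C F"
proof -
  have F: "is_functor C (T \<restriction>\<^sub>C A) F" using ff by (simp add: fully_faithful_def)
  interpret F: is_functor C "T \<restriction>\<^sub>C A" F by (rule F)
  let ?S = "essential_image C (T \<restriction>\<^sub>C A) F"
  have S: "?S \<subseteq> A" by (auto simp: essential_image_def)
  have FA: "onOb F x \<in> A" if "x \<in> Ob C" for x using F.onOb[OF that] by simp
  have "is_functor C T (into_ambient F)"
  proof
    show "onOb (into_ambient F) x \<in> Ob T" if "x \<in> Ob C" for x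
      using FA[OF that] A_subset by (auto simp: into_ambient_def id_ftor_def comp_ftor_def)
  qed (use F.onArr F.onArr_Ide F.onArr_Comp_arr in \<open>auto simp: into_ambient_def id_ftor_def comp_ftor_def\<close>)
  then have "fully_faithful C T (into_ambient F)"
    using ff FA unfolding fully_faithful_def
    by (auto simp: Hom_full_subcat into_ambient_def id_ftor_def comp_ftor_def simp del: Hom_iff)
  moreover have ab': "abelian_category (T \<restriction>\<^sub>C ?S)"
    using ab by (simp add: full_subcat_full_subcat[OF S])
  have "subcategory T ?S"
    unfolding subcategory_def
  proof (intro conjI ballI impI)
    show "?S \<subseteq> Ob T" using S A_subset by blast
    fix x y assume x: "x \<in> ?S" and y: "y \<in> Ob T" "isomorphic T x y"
    then obtain c where "c \<in> Ob C" "isomorphic T (onOb F c) x" "x \<in> A"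
      by (auto simp: essential_image_def isomorphic_full_subcat)
    then show "y \<in> ?S"
      using isomorphic_trans[OF _ y(2)] A_iso_closed[OF _ y] y(1) FA
      by (auto simp: essential_image_def isomorphic_full_subcat)
  qed
  then have "codistinguished_abelian_subcategory T \<Delta> ?S"
    unfolding codistinguished_abelian_subcategory_def additive_subcategory_def
  proof (intro conjI ab' allI impI)
    show "additive_category (T \<restriction>\<^sub>C ?S)"
      using ab' by (rule abelian_category.axioms)
    fix f g h assume t: "(f, g, h) \<in> \<Delta> \<and> Dom T f \<in> ?S \<and> Cod T f \<in> ?S \<and> Cod T g \<in> ?S"
    then have "short_exact (T \<restriction>\<^sub>C A) f g"
      using S triangle_short_exact[of f g h] by blast
    then have "short_exact (T \<restriction>\<^sub>C A \<restriction>\<^sub>C ?S) f g"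
      by (rule short_exact_full_subcat) (use t in auto)
    then show "short_exact (T \<restriction>\<^sub>C ?S) f g"
      by (simp add: full_subcat_full_subcat[OF S])
  qed
  ultimately show ?thesis
    using F by (simp add: realises_codistinguished_def essential_image_into_ambient)
qed

text \<open>Extension closure of \<open>A\<close> puts the middle vertex into \<open>A\<close>; the
  triangle then becomes a short exact sequence of \<open>A\<close>, to which closure inside
  \<open>A\<close> applies.\<close>

lemma extension_closed_essential_image:
  assumes "extension_closed T \<Delta> A" "is_functor C (T \<restriction>\<^sub>C A) F"
    and "\<And>i p. short_exact (T \<restriction>\<^sub>C A) i p \<Longrightarrow> Dom (T \<restriction>\<^sub>C A) i \<in> essential_image C (T \<restriction>\<^sub>C A) F
      \<Longrightarrow> Cod (T \<restriction>\<^sub>C A) p \<in> essential_image C (T \<restriction>\<^sub>C A) F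
      \<Longrightarrow> Cod (T \<restriction>\<^sub>C A) i \<in> essential_image C (T \<restriction>\<^sub>C A) F"
  shows "extension_closed T \<Delta> (essential_image C T (into_ambient F))"
  unfolding essential_image_into_ambient[OF assms(2)] extension_closed_def
proof (intro allI impI)
  let ?S = "essential_image C (T \<restriction>\<^sub>C A) F"
  fix f g h assume t: "(f, g, h) \<in> \<Delta> \<and> Dom T f \<in> ?S \<and> Cod T g \<in> ?S"
  have "?S \<subseteq> A" by (auto simp: essential_image_def)
  then have A: "Dom T f \<in> A" "Cod T g \<in> A" using t by auto
  then have "Cod T f \<in> A" using assms(1) t unfolding extension_closed_def by blast
  then have "short_exact (T \<restriction>\<^sub>C A) f g" using triangle_short_exact A t by blast
  then show "Cod T f \<in> ?S" using assms(3)[of f g] t by simp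
qed

end

theorem theorem4p12:
  fixes T :: "('p, 'n) precat" and \<Sigma> :: "('p, 'n, 'p, 'n) ftor" and \<Delta> :: "('n \<times> 'n \<times> 'n) set"
    and A :: "'p set" and C :: "('o, 'm) precat"
    and L R I :: "('o, 'm, 'p, 'n) ftor" and E :: "('p, 'n, 'o, 'm) ftor"
    and \<eta>L :: "'o \<Rightarrow> 'm" and \<epsilon>L :: "'p \<Rightarrow> 'n" and \<eta>R :: "'p \<Rightarrow> 'n" and \<epsilon>R :: "'o \<Rightarrow> 'm"
    and \<pi> \<iota> :: "'o \<Rightarrow> 'n"
  assumes "triangulated_category T \<Sigma> \<Delta>"
    and "codistinguished_abelian_subcategory T \<Delta> A"
    and "additive_category C"
    and "fully_faithful_triple (T \<restriction>\<^sub>C A) C L E R \<eta>L \<epsilon>L \<eta>R \<epsilon>R"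
    and "intermediate_extension (T \<restriction>\<^sub>C A) C L E R \<eta>L \<epsilon>R I \<pi> \<iota>"
  shows "realises_codistinguished T \<Delta> A C L \<and>
         realises_codistinguished T \<Delta> A C R \<and>
         realises_codistinguished T \<Delta> A C I \<and>
         (extension_closed T \<Delta> A \<longrightarrow>
            extension_closed T \<Delta> (essential_image C T (into_ambient L)) \<and>
            extension_closed T \<Delta> (essential_image C T (into_ambient R)) \<and>
            extension_closed T \<Delta> (essential_image C T (into_ambient I)))"
proof -
  interpret T: triangulated_category T \<Sigma> \<Delta> by fact
  interpret S: codistinguished_subcategory T \<Delta> A
    by unfold_locales fact
  interpret A: abelian_category "T \<restriction>\<^sub>C A" by (rule S.abelian_A)
  interpret C: additive_category C by fact
  have adj: "adjunction C (T \<restriction>\<^sub>C A) L E \<eta>L \<epsilon>L" "adjunction (T \<restriction>\<^sub>C A) C E R \<eta>R \<epsilon>R"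
    and ff: "fully_faithful C (T \<restriction>\<^sub>C A) L \<or> fully_faithful C (T \<restriction>\<^sub>C A) R"
    using assms(4) by (auto simp: fully_faithful_triple_def adjunction_triple_def)
  interpret triple: adjoint_triple "T \<restriction>\<^sub>C A" C L E R \<eta>L \<epsilon>L \<eta>R \<epsilon>R
    by (intro adjoint_triple.intro adjoint_pair.intro adjoint_pair_axioms.intro adj
        A.abelian_category_axioms C.additive_category_axioms A.category_axioms C.category_axioms)
  interpret ff: ff_adjoint_triple "T \<restriction>\<^sub>C A" C L E R \<eta>L \<epsilon>L \<eta>R \<epsilon>R
    using ff by (rule triple.ff_adjoint_tripleI)
  interpret intermediate: intermediate_extension_functor "T \<restriction>\<^sub>C A" C L E R \<eta>L \<epsilon>L \<eta>R \<epsilon>R I \<pi> \<iota>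
    by unfold_locales fact
  have functors: "is_functor C (T \<restriction>\<^sub>C A) F" if "fully_faithful C (T \<restriction>\<^sub>C A) F" for F
    using that by (simp add: fully_faithful_def)
  show ?thesis
  proof (intro conjI impI)
    show "realises_codistinguished T \<Delta> A C L" "realises_codistinguished T \<Delta> A C R"
      "realises_codistinguished T \<Delta> A C I"
      by (rule S.realises_codistinguishedI[OF ff.L_embedding]
          S.realises_codistinguishedI[OF ff.R_embedding]
          S.realises_codistinguishedI[OF intermediate.I_embedding])+
    assume ext: "extension_closed T \<Delta> A"
    show "extension_closed T \<Delta> (essential_image C T (into_ambient L))"
      using ff.L_extension
      by (rule S.extension_closed_essential_image[OF ext functors[OF ff.L_fully_faithful]])
    show "extension_closed T \<Delta> (essential_image C T (into_ambient R))"
      using ff.R_extension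
      by (rule S.extension_closed_essential_image[OF ext functors[OF ff.R_fully_faithful]])
    show "extension_closed T \<Delta> (essential_image C T (into_ambient I))"
      using intermediate.I_extension
      by (rule S.extension_closed_essential_image[OF ext functors[OF intermediate.I_fully_faithful]])
  qed
qed

end
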